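(* Let $|q|<1$. Then \begin{align*} \sum_{i,j\geq 0}\frac{q^{4i^2+3j^2-4ij-4i+2j}}{(q^8;q^8)_i(q^8;q^8)_j} &=2\frac{J_{16}J_{48,112}}{J_8^2}+q\frac{J_8J_{56}^2J_{112}J_{8,112}J_{24,112}}{J_4J_{4,112}J_{16,112}J_{28,112}J_{48,112}J_{52,112}},\\ \sum_{i,j\geq 0}\frac{q^{4i^2+3j^2-4ij}}{(q^8;q^8)_i(q^8;q^8)_j} &=\frac{J_8J_{56}^2J_{112}J_{24,112}J_{40,112}}{J_4J_{12,112}J_{28,112}J_{32,112}J_{44,112}J_{48,112}}+2q^3\frac{J_{16}J_{32,112}}{J_8^2},\\ \sum_{i,j\geq 0} \frac{q^{4i^2+3j^2-4ij+4j}}{(q^8;q^8)_i(q^8;q^8)_j}&=\frac{J_8J_{56}^2J_{112}J_{8,112}J_{40,112}}{J_4J_{16,112}J_{20,112}J_{28,112}J_{32,112}J_{36,112}}+2q^7\frac{J_{16}J_{16,112}}{J_8^2}. \end{align*} As a consequence, with $A=\begin{pmatrix}1&-1/2\\-1/2&3/4\end{pmatrix}$ and $(B,C)\in\{((-1/2,1/4)^{\mathrm T},1/28),\ ((0,0)^{\mathrm T},-3/56),\ ((0,1/2)^{\mathrm T},1/56)\}$, the function $\tau\mapsto f_{A,B,C}(q^{56})$ (with $q=e^{2\pi i\tau}$) is a modular function on $\Gamma_1(3136)$.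
   Context: Notation: $(a;q)_n=\prod_{k=0}^{n-1}(1-aq^k)$, $(a;q)_\infty=\prod_{k\ge0}(1-aq^k)$, $(a_1,\dots,a_m;q)_n=(a_1;q)_n\cdots(a_m;q)_n$; $J_m=(q^m;q^m)_\infty$ and $J_{a,m}=(q^a,q^{m-a},q^m;q^m)_\infty$. Fractional powers $q^{x}$ mean $e^{2\pi i x\tau}$ where $q=e^{2\pi i\tau}$, $\tau$ in the upper half-plane. For a positive definite symmetric rational $2\times2$ matrix $A$, a rational vector $B$ and rational scalar $C$, the Nahm sum is $f_{A,B,C}(q)=\sum_{n=(n_1,n_2)^{\mathrm T}\in\mathbb{Z}_{\ge0}^2}\frac{q^{\frac12 n^{\mathrm T}An+n^{\mathrm T}B+C}}{(q;q)_{n_1}(q;q)_{n_2}}$. $\Gamma_1(N)=\{\gamma\in\mathrm{SL}_2(\mathbb Z):\gamma\equiv\begin{pmatrix}1&*\\0&1\end{pmatrix}\pmod N\}$. *)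

theory Defs
  imports "HOL-Complex_Analysis.Complex_Analysis" "HOL-Number_Theory.Cong"
begin

definition qpoch :: "complex \<Rightarrow> complex \<Rightarrow> nat \<Rightarrow> complex" where
  "qpoch a q n = (\<Prod>k<n. 1 - a * q ^ k)"

definition qpoch_inf :: "complex \<Rightarrow> complex \<Rightarrow> complex" where
  "qpoch_inf a q = (\<Prod>k. 1 - a * q ^ k)"

definition J :: "complex \<Rightarrow> nat \<Rightarrow> complex" where
  "J q m = qpoch_inf (q ^ m) (q ^ m)"

text \<open>The symbol \<open>J\<^bsub>a,m\<^esub>\<close>, only meant for \<open>0 < a < m\<close>: the difference \<open>m - a\<close> is
  truncated subtraction on the natural numbers.\<close>

definition JJ :: "complex \<Rightarrow> nat \<Rightarrow> nat \<Rightarrow> complex" where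
  "JJ q a m = qpoch_inf (q ^ a) (q ^ m) * qpoch_inf (q ^ (m - a)) (q ^ m) * qpoch_inf (q ^ m) (q ^ m)"

text \<open>The fractional power \<open>q\<^sup>x\<close>, where \<open>q = exp (2 \<pi> i \<tau>)\<close>.\<close>

definition qpow :: "complex \<Rightarrow> real \<Rightarrow> complex" where
  "qpow \<tau> x = exp (2 * of_real pi * \<i> * of_real x * \<tau>)"

text \<open>The Nahm sum as a function of \<open>\<tau>\<close>. Because of the fractional powers it is not a function
  of \<open>q\<close> alone; replacing \<open>q\<close> by \<open>q\<^sup>k\<close> means replacing \<open>\<tau>\<close> by \<open>k \<tau>\<close>.\<close>

definition nahm_sum :: "real^2^2 \<Rightarrow> real^2 \<Rightarrow> real \<Rightarrow> complex \<Rightarrow> complex" where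
  "nahm_sum A B C \<tau> =
     (\<Sum>\<^sub>\<infinity>(n1, n2)\<in>(UNIV :: (nat \<times> nat) set).
        let n = vector [real n1, real n2] :: real^2; q = qpow \<tau> 1
        in qpow \<tau> (1/2 * (n \<bullet> (A *v n)) + n \<bullet> B + C) / (qpoch q q n1 * qpoch q q n2))"

definition upper_half_plane :: "complex set" where
  "upper_half_plane = {\<tau>. Im \<tau> > 0}"

definition SL2Z :: "(int^2^2) set" where
  "SL2Z = {\<gamma>. det \<gamma> = 1}"

definition Gamma1 :: "int \<Rightarrow> (int^2^2) set" where
  "Gamma1 N = {\<gamma> \<in> SL2Z. [\<gamma>$1$1 = 1] (mod N) \<and> [\<gamma>$2$1 = 0] (mod N) \<and> [\<gamma>$2$2 = 1] (mod N)}"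

definition act :: "int^2^2 \<Rightarrow> complex \<Rightarrow> complex" where
  "act \<gamma> = moebius (of_int (\<gamma>$1$1)) (of_int (\<gamma>$1$2)) (of_int (\<gamma>$2$1)) (of_int (\<gamma>$2$2))"

text \<open>Meromorphy at the cusp \<open>\<gamma> \<infinity>\<close>: near \<open>i \<infinity>\<close>, the function \<open>f \<circ> \<gamma>\<close> is given by a Laurent series
  with finite principal part in \<open>exp (2 \<pi> i \<tau> / h)\<close>, for some positive integer \<open>h\<close>.\<close>

definition meromorphic_at_cusp :: "(complex \<Rightarrow> complex) \<Rightarrow> int^2^2 \<Rightarrow> bool" where
  "meromorphic_at_cusp f \<gamma> \<longleftrightarrow>
     (\<exists>h::nat. h > 0 \<and> (\<exists>g. g meromorphic_on {0} \<and>
        (\<exists>Y>0. \<forall>\<tau>. Im \<tau> > Y \<longrightarrow> f (act \<gamma> \<tau>) = g (exp (2 * of_real pi * \<i> * \<tau> / of_nat h)))))"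

text \<open>Modular functions (weight 0) on a subgroup of finite index in \<open>SL\<^sub>2(\<int>)\<close>. Nice meromorphy
  normalises the value at a pole to \<open>0\<close> and excludes removable singularities,
  so that pointwise invariance is the right notion.\<close>

definition modular_function_on :: "(complex \<Rightarrow> complex) \<Rightarrow> (int^2^2) set \<Rightarrow> bool" where
  "modular_function_on f \<Gamma> \<longleftrightarrow>
     f nicely_meromorphic_on upper_half_plane \<and>
     (\<forall>\<gamma>\<in>\<Gamma>. \<forall>\<tau>\<in>upper_half_plane. f (act \<gamma> \<tau>) = f \<tau>) \<and>
     (\<forall>\<gamma>\<in>SL2Z. meromorphic_at_cusp f \<gamma>)"

end

theory Submission
  imports Defs
begin

text \<open>
  Summing over \<open>i\<close> first by Euler's formula turns the double sum into a single sum over \<open>j\<close> whose even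
  and odd parts are series of Slater type modulo 28 and 14. Both come from Bailey's lemma: the required
  Bailey pairs are alternating sums of Gaussian binomial coefficients, evaluated by Pascal's rule because
  one of the two resulting sums is antisymmetric and vanishes. With the base \<open>\<rho> = \<i> q\<^sup>2\<close>, so that
  \<open>\<rho>\<^sup>2 = - q\<^sup>4\<close> and \<open>\<rho>\<^sup>4 = q\<^sup>8\<close>, the triple product yields all six series.

  For the modularity, every product occurring in the identities is, up to a constant, a quotient of Klein
  forms in \<open>784 \<tau>\<close>: besides the forms with characteristics \<open>(e/28, 0)\<close> one needs the product of the three
  forms of level 2, which is a constant times \<open>\<eta>\<^sup>-\<^sup>6\<close>. Klein forms transform under \<open>SL\<^sub>2(\<int>)\<close> without
  multiplier system; this follows from Liouville's theorem, since both sides, as functions of the elliptic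
  variable, have the same quasi-periods, zeros and derivative at \<open>0\<close>.
\<close>

section \<open>q-Pochhammer symbols\<close>

text \<open>The constants are forced. Put \<open>q = e2pi (7 * \<tau>)\<close>, so that the Nahm sum
  at \<open>56 * \<tau>\<close> has nome \<open>q ^ 8\<close>: the factor 8 clears the denominators
  of the quadratic and linear terms, the factor 7 what is left in \<open>C\<close>. The products
  live modulo 28 in \<open>p = q ^ 4 = e2pi (28 * \<tau>)\<close>; hence their nome is
  \<open>p ^ 28 = e2pi (784 * \<tau>)\<close>, and the residue \<open>e\<close> becomes the
  characteristic \<open>e / 28\<close>. Conjugation by diag(784, 1) divides the lower left entry by
  784; at level 3136 = 4 * 784 it remains a multiple of 4, so that half-integral characteristics
  also move by integers. All six theta series have exponents \<open>7 r^2 + k r\<close>. The 7 is 3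
  + 4, with \<open>3 r^2\<close> inside the Bailey pair and \<open>4 r^2\<close> from the power of
  \<open>q\<close>, either as \<open>q = \<rho> ^ 4\<close> or as \<open>q = \<rho>\<close> on even
  indices. Klein forms have weight -1. Every product needs nine more of them in the denominator than
  in the numerator, and the cube of the product of level 2, of weight -9, compensates this. Since
  Klein forms carry no multiplier system, invariance reduces to signs, and these to the parity of a
  sum of residues.\<close>

lemma qpoch_0 [simp]: "qpoch a q 0 = 1"
  by (simp add: qpoch_def)

lemma qpoch_Suc: "qpoch a q (Suc n) = qpoch a q n * (1 - a * q ^ n)"
  by (simp add: qpoch_def)

lemma qpoch_add: "qpoch a q (m + n) = qpoch a q m * qpoch (a * q ^ m) q n"
  by (induction n) (simp_all add: qpoch_Suc power_add mult_ac)

lemma qpoch_Suc_left: "qpoch a q (Suc n) = (1 - a) * qpoch (a * q) q n"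
  using qpoch_add[of a q 1 n] by (simp add: qpoch_def)

lemma qpoch_mult_uminus: "qpoch a q n * qpoch (-a) q n = qpoch (a^2) (q^2) n"
  by (induction n)
     (auto simp: qpoch_Suc algebra_simps power2_eq_square power_mult_distrib)

lemma qpoch_multisection: "qpoch a q (k * n) = (\<Prod>j<k. qpoch (a * q ^ j) (q ^ k) n)"
proof (induction n)
  case (Suc n)
  have "qpoch a q (k * Suc n) = qpoch a q (k * n) * (\<Prod>j<k. 1 - a * q ^ j * (q ^ k) ^ n)"
    unfolding mult_Suc_right add.commute[of k] qpoch_add
    by (simp add: qpoch_def power_mult mult_ac)
  with Suc show ?case
    by (simp add: qpoch_Suc prod.distrib)
qed simp

lemma power_neq_1:
  fixes q :: complex
  assumes "norm q < 1" "n > 0"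
  shows "q ^ n \<noteq> 1"
proof
  assume "q ^ n = 1"
  hence "norm q ^ n = 1" by (metis norm_one norm_power)
  moreover have "norm q ^ n < 1" using assms by (simp add: power_less_one_iff)
  ultimately show False by simp
qed

lemma qpoch_nonzero:
  assumes "norm q < 1"
  shows "qpoch q q n \<noteq> 0"
  using power_neq_1[OF assms, of "Suc _"] by (simp add: qpoch_def)

context
  fixes q :: complex
  assumes q: "norm q < 1"
begin

lemma convergent_prod_qpoch: "convergent_prod (\<lambda>k. 1 - a * q ^ k)"
proof (rule abs_convergent_prod_imp_convergent_prod)
  have "summable (\<lambda>k. norm a * norm q ^ k)"
    using q by (intro summable_mult summable_geometric) auto
  thus "abs_convergent_prod (\<lambda>k. 1 - a * q ^ k)"
    unfolding abs_convergent_prod_conv_summable by (simp add: norm_mult norm_power)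
qed

lemma qpoch_LIMSEQ: "(\<lambda>n. qpoch a q n) \<longlonglongrightarrow> qpoch_inf a q"
  unfolding qpoch_def qpoch_inf_def
  by (rule has_prod_imp_tendsto') (use convergent_prod_qpoch in auto)

lemma qpoch_inf_unfold: "qpoch_inf a q = qpoch a q m * qpoch_inf (a * q ^ m) q"
proof (rule LIMSEQ_unique)
  show "(\<lambda>n. qpoch a q (m + n)) \<longlonglongrightarrow> qpoch_inf a q"
    using LIMSEQ_ignore_initial_segment[OF qpoch_LIMSEQ, of a m] by (simp add: add.commute)
  show "(\<lambda>n. qpoch a q (m + n)) \<longlonglongrightarrow> qpoch a q m * qpoch_inf (a * q ^ m) q"
    unfolding qpoch_add by (intro tendsto_intros qpoch_LIMSEQ)
qed

lemma qpoch_inf_unfold_1: "qpoch_inf a q = (1 - a) * qpoch_inf (a * q) q"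
  using qpoch_inf_unfold[of a 1] by (simp add: qpoch_def)

lemma qpoch_inf_multisection:
  assumes "k > 0"
  shows "qpoch_inf a q = (\<Prod>j<k. qpoch_inf (a * q ^ j) (q ^ k))"
proof (rule LIMSEQ_unique)
  have qk: "norm (q ^ k) < 1"
    using q assms by (simp add: norm_power power_less_one_iff)
  have "filterlim (\<lambda>n. k * n) at_top sequentially"
    using assms by (intro mult_nat_left_at_top) auto
  thus "(\<lambda>n. qpoch a q (k * n)) \<longlonglongrightarrow> qpoch_inf a q"
    by (rule filterlim_compose[OF qpoch_LIMSEQ])
  have "(\<lambda>n. qpoch (a * q ^ j) (q ^ k) n) \<longlonglongrightarrow> qpoch_inf (a * q ^ j) (q ^ k)" for j
    unfolding qpoch_def qpoch_inf_def
  proof (rule has_prod_imp_tendsto')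
    have "summable (\<lambda>m. norm (a * q ^ j) * norm (q ^ k) ^ m)"
      using qk by (intro summable_mult summable_geometric) auto
    hence "abs_convergent_prod (\<lambda>m. 1 - a * q ^ j * (q ^ k) ^ m)"
      unfolding abs_convergent_prod_conv_summable by (simp add: norm_mult norm_power)
    thus "(\<lambda>m. 1 - a * q ^ j * (q ^ k) ^ m) has_prod (\<Prod>m. 1 - a * q ^ j * (q ^ k) ^ m)"
      using abs_convergent_prod_imp_convergent_prod by blast
  qed
  thus "(\<lambda>n. qpoch a q (k * n)) \<longlonglongrightarrow> (\<Prod>j<k. qpoch_inf (a * q ^ j) (q ^ k))"
    unfolding qpoch_multisection by (intro tendsto_prod)
qed

lemma qpoch_inf_nonzero_iff: "qpoch_inf a q \<noteq> 0 \<longleftrightarrow> (\<forall>k. a * q ^ k \<noteq> 1)"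
proof -
  have "qpoch_inf a q = 0 \<longleftrightarrow> (\<exists>k. 1 - a * q ^ k = 0)"
    using has_prod_eq_0_iff[OF convergent_prod_has_prod[OF convergent_prod_qpoch[of a]]]
    by (auto simp: qpoch_inf_def)
  thus ?thesis by auto
qed

lemma qpoch_inf_nonzero:
  assumes "norm a < 1"
  shows "qpoch_inf a q \<noteq> 0"
  unfolding qpoch_inf_nonzero_iff
proof
  fix k
  have "norm (a * q ^ k) \<le> norm a * 1"
    unfolding norm_mult norm_power using q by (intro mult_left_mono power_le_one) auto
  thus "a * q ^ k \<noteq> 1" using assms by auto
qed

text \<open>The partial products are nonzero and tend to a nonzero limit, so their reciprocals are
  bounded. In the series below only the powers in the numerators then have to be estimated.\<close>

lemma inverse_qpoch_bounded:
  assumes "\<And>k. a * q ^ k \<noteq> 1"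
  obtains C where "C \<ge> 1" "\<And>n. norm (inverse (qpoch a q n)) \<le> C"
proof -
  have "qpoch_inf a q \<noteq> 0"
    using assms by (simp add: qpoch_inf_nonzero_iff)
  hence "(\<lambda>n. inverse (qpoch a q n)) \<longlonglongrightarrow> inverse (qpoch_inf a q)"
    by (intro tendsto_inverse qpoch_LIMSEQ)
  hence "Bseq (\<lambda>n. inverse (qpoch a q n))"
    by (rule convergentI[THEN convergent_imp_Bseq])
  then obtain C where "\<And>n. norm (inverse (qpoch a q n)) \<le> C"
    unfolding Bseq_def by blast
  thus ?thesis using that[of "max C 1"] by (metis max.cobounded2 max.coboundedI1)
qed

lemma inverse_qpoch_self_bounded:
  obtains C where "C \<ge> 1" "\<And>n. norm (inverse (qpoch q q n)) \<le> C"
  by (rule inverse_qpoch_bounded[of q]) (use power_neq_1[OF q, of "Suc _"] in auto)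

end

lemma qpoch_inf_mult_uminus:
  assumes "norm q < 1"
  shows "qpoch_inf a q * qpoch_inf (-a) q = qpoch_inf (a^2) (q^2)"
proof (rule LIMSEQ_unique)
  show "(\<lambda>n. qpoch a q n * qpoch (-a) q n) \<longlonglongrightarrow> qpoch_inf a q * qpoch_inf (-a) q"
    by (intro tendsto_intros qpoch_LIMSEQ assms)
  show "(\<lambda>n. qpoch a q n * qpoch (-a) q n) \<longlonglongrightarrow> qpoch_inf (a^2) (q^2)"
    unfolding qpoch_mult_uminus using assms
    by (intro qpoch_LIMSEQ) (simp add: norm_power power_less_one_iff)
qed

text \<open>Both parameters vary: an elliptic variable enters through \<open>f\<close> alone, a
  modular variable or a local parameter at a cusp also through \<open>g\<close>. On a closed disc
  the maxima of both norms give a geometric majorant; by compactness the second one is still below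
  1.\<close>

lemma holomorphic_on_qpoch_inf:
  assumes S: "open S" and f: "f holomorphic_on S" and g: "g holomorphic_on S"
    and less: "\<And>z. z \<in> S \<Longrightarrow> norm (g z) < 1"
  shows "(\<lambda>z. qpoch_inf (f z) (g z)) holomorphic_on S"
proof (rule holomorphic_uniform_sequence[OF S])
  show "(\<lambda>z. qpoch (f z) (g z) n) holomorphic_on S" for n
    unfolding qpoch_def by (intro holomorphic_intros f g)
  fix z assume z: "z \<in> S"
  then obtain d where d: "d > 0" "cball z d \<subseteq> S"
    using S open_contains_cball by blast
  have cf: "continuous_on (cball z d) f" and cg: "continuous_on (cball z d) g"
    using f g d holomorphic_on_imp_continuous_on holomorphic_on_subset by blast+
  have ne: "cball z d \<noteq> {}" using d by simp
  obtain w where w: "w \<in> cball z d" "\<And>y. y \<in> cball z d \<Longrightarrow> norm (g y) \<le> norm (g w)"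
    using continuous_attains_sup[OF compact_cball ne continuous_on_norm[OF cg]] by blast
  obtain v where v: "\<And>y. y \<in> cball z d \<Longrightarrow> norm (f y) \<le> norm (f v)"
    using continuous_attains_sup[OF compact_cball ne continuous_on_norm[OF cf]] by blast
  have gw: "norm (g w) < 1" using w d less by auto
  have "uniformly_convergent_on (cball z d) (\<lambda>N x. \<Prod>n<N. 1 - f x * g x ^ n)"
  proof (rule uniformly_convergent_on_prod')
    show "uniformly_convergent_on (cball z d) (\<lambda>N x. \<Sum>n<N. norm (1 - f x * g x ^ n - 1))"
    proof (rule Weierstrass_m_test')
      show "summable (\<lambda>n. norm (f v) * norm (g w) ^ n)"
        using gw by (intro summable_mult summable_geometric) auto
      fix n x assume "x \<in> cball z d"
      thus "norm (norm (1 - f x * g x ^ n - 1)) \<le> norm (f v) * norm (g w) ^ n"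
        using v[of x] w(2)[of x] by (auto simp: norm_mult norm_power intro!: mult_mono power_mono)
    qed
  qed (use cf cg in \<open>auto intro!: continuous_intros\<close>)
  then obtain l where l: "uniform_limit (cball z d) (\<lambda>N x. qpoch (f x) (g x) N) l sequentially"
    unfolding uniformly_convergent_on_def qpoch_def by blast
  have "l x = qpoch_inf (f x) (g x)" if "x \<in> cball z d" for x
  proof (rule LIMSEQ_unique)
    show "(\<lambda>N. qpoch (f x) (g x) N) \<longlonglongrightarrow> l x"
      using tendsto_uniform_limitI[OF l that] .
    show "(\<lambda>N. qpoch (f x) (g x) N) \<longlonglongrightarrow> qpoch_inf (f x) (g x)"
      using that d less by (intro qpoch_LIMSEQ) auto
  qed
  hence "uniform_limit (cball z d) (\<lambda>N x. qpoch (f x) (g x) N)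
           (\<lambda>x. qpoch_inf (f x) (g x)) sequentially"
    by (intro iffD1[OF uniform_limit_cong' l]) auto
  thus "\<exists>d>0. cball z d \<subseteq> S \<and> uniform_limit (cball z d) (\<lambda>n x. qpoch (f x) (g x) n)
           (\<lambda>x. qpoch_inf (f x) (g x)) sequentially"
    using d by blast
qed

section \<open>Series expansions by Euler and Cauchy\<close>

lemma summable_power_square:
  fixes y r :: real
  assumes "0 \<le> r" "r < 1" "y \<ge> 0"
  shows "summable (\<lambda>i. y ^ i * r ^ (i\<^sup>2))"
proof -
  \<comment> \<open>The term is \<open>(y * r ^ i) ^ i\<close>, so it is eventually dominated by
    powers of 1/2, however large \<open>y\<close> is.\<close>
  have "(\<lambda>i. y * r ^ i) \<longlonglongrightarrow> y * 0"
    using assms by (intro tendsto_intros LIMSEQ_realpow_zero)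
  hence "eventually (\<lambda>i. y * r ^ i < 1/2) sequentially"
    by (intro order_tendstoD) auto
  then obtain N where N: "\<And>i. i \<ge> N \<Longrightarrow> y * r ^ i < 1/2"
    by (auto simp: eventually_at_top_linorder)
  show ?thesis
  proof (rule summable_comparison_test)
    show "summable (\<lambda>i. (1/2::real) ^ i)" by (intro summable_geometric) auto
    have "norm (y ^ i * r ^ (i\<^sup>2)) \<le> (1/2) ^ i" if "i \<ge> N" for i
    proof -
      have "y ^ i * r ^ (i\<^sup>2) = (y * r ^ i) ^ i"
        by (simp add: power_mult_distrib power_mult power2_eq_square)
      moreover have "(y * r ^ i) ^ i \<le> (1/2) ^ i"
        using N[OF that] assms by (intro power_mono) auto
      ultimately show ?thesis using assms by simp
    qed
    thus "\<exists>N. \<forall>n\<ge>N. norm (y ^ n * r ^ (n\<^sup>2)) \<le> (1/2) ^ n" by blast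
  qed
qed

text \<open>Iteration produces the partial products of \<open>a\<close>, while the remaining value
  of \<open>F\<close> tends to 1. Both expansions below rest on this, the second one with
  \<open>F\<close> the reciprocal of its series.\<close>

lemma limit_of_functional_equation:
  fixes F :: "complex \<Rightarrow> complex" and q :: complex
  assumes q: "norm q < 1"
    and eq: "\<And>n. F (z * q ^ n) = (1 - a * q ^ n) * F (z * q ^ Suc n)"
    and lim: "(\<lambda>n. F (z * q ^ n)) \<longlonglongrightarrow> 1"
  shows "F z = qpoch_inf a q"
proof (rule LIMSEQ_unique)
  have *: "F z = qpoch a q n * F (z * q ^ n)" for n
  proof (induction n)
    case (Suc n)
    thus ?case using eq[of n] by (simp add: qpoch_Suc mult_ac)
  qed simp
  show "(\<lambda>n. qpoch a q n * F (z * q ^ n)) \<longlonglongrightarrow> F z"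
    unfolding *[symmetric] by simp
  show "(\<lambda>n. qpoch a q n * F (z * q ^ n)) \<longlonglongrightarrow> qpoch_inf a q"
    using tendsto_mult[OF qpoch_LIMSEQ[OF q, of a] lim] by simp
qed

text \<open>Supplies the limit 1 for the preceding principle: without its constant term every
  summand still carries a factor \<open>y\<close>, which can be pulled out of the majorant.\<close>

lemma norm_power_square_series_minus_1:
  fixes t :: "nat \<Rightarrow> complex"
  assumes t: "t sums F" "t 0 = 1" and nt: "\<And>i. norm (t i) \<le> K * (y ^ i * r ^ (i\<^sup>2))"
    and y: "0 \<le> y" "y \<le> 1" and r: "0 \<le> r" "r < 1" and K: "K \<ge> 0"
  shows "norm (F - 1) \<le> y * (\<Sum>i. K * r ^ (i\<^sup>2))"
proof -
  have s1: "(\<lambda>i. t (Suc i)) sums (F - 1)"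
    using t by (subst sums_Suc_iff) simp
  have S: "summable (\<lambda>i. K * r ^ (i\<^sup>2))"
    using r summable_power_square[of r 1] by (intro summable_mult) auto
  have le: "norm (t (Suc i)) \<le> y * (K * r ^ (i\<^sup>2))" for i
  proof -
    have "y ^ Suc i * r ^ ((Suc i)\<^sup>2) \<le> y * r ^ (i\<^sup>2)"
      using y r by (intro mult_mono power_decreasing) (auto simp: mult_left_le power_le_one)
    from order.trans[OF nt mult_left_mono[OF this K]] show ?thesis by (simp only: mult_ac)
  qed
  have "norm (F - 1) \<le> (\<Sum>i. y * (K * r ^ (i\<^sup>2)))"
    unfolding sums_unique[OF s1] by (rule norm_suminf_le[OF le]) (intro summable_mult S)
  also have "\<dots> = y * (\<Sum>i. K * r ^ (i\<^sup>2))"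
    by (rule suminf_mult[OF S])
  finally show ?thesis .
qed

text \<open>Euler's expansion of \<open>(x;q)\<close> for \<open>x = z * b\<close> and
  \<open>q = b^2\<close>. Working with a square root \<open>b\<close> of the base turns the binomial
  exponent into a square, which suits the triple product; in the double sum \<open>b\<close> is
  \<open>q ^ 4\<close>.\<close>

theorem qpoch_Euler:
  fixes b z :: complex
  assumes b: "norm b < 1"
  shows "((\<lambda>i. (-z) ^ i * b ^ (i\<^sup>2) / qpoch (b^2) (b^2) i) has_sum qpoch_inf (z * b) (b^2)) UNIV"
proof -
  define q where "q = b^2"
  have q: "norm q < 1" using b by (simp add: q_def norm_power power_less_one_iff)
  define t where "t = (\<lambda>z i. (-z) ^ i * b ^ (i\<^sup>2) / qpoch q q i)"
  have q1: "q * q ^ k \<noteq> 1" for k using power_neq_1[OF q, of "Suc k"] by simp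
  obtain C where C: "C \<ge> 1" "\<And>n. norm (inverse (qpoch q q n)) \<le> C"
    using inverse_qpoch_self_bounded[OF q] by blast
  have nt: "norm (t z i) \<le> C * (norm z ^ i * norm b ^ (i\<^sup>2))" for z i
  proof -
    have "norm (t z i) = norm (inverse (qpoch q q i)) * (norm z ^ i * norm b ^ (i\<^sup>2))"
      by (simp add: t_def norm_mult norm_power norm_divide norm_inverse field_simps)
    also have "\<dots> \<le> C * (norm z ^ i * norm b ^ (i\<^sup>2))"
      by (intro mult_right_mono C) auto
    finally show ?thesis .
  qed
  have sb: "summable (\<lambda>i. C * (norm z ^ i * norm b ^ (i\<^sup>2)))" for z :: complex
    using b by (intro summable_mult summable_power_square) auto
  have sn: "summable (\<lambda>i. norm (t z i))" for z
    by (rule summable_comparison_test[OF _ sb[of z]]) (use nt in auto)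
  define F where "F = (\<lambda>z. \<Sum>i. t z i)"
  have tF: "t z sums F z" for z
    unfolding F_def by (rule summable_sums[OF summable_norm_cancel[OF sn]])
  have feq: "F z = (1 - z * b) * F (z * q)" for z
  proof -
    \<comment> \<open>The difference has the factor \<open>1 - q ^ (i + 1)\<close>, which cancels
      the last factor of the denominator and leaves a term of the series at
      \<open>z * q\<close>.\<close>
    have "t z (Suc i) - t (z * q) (Suc i) = - z * b * t (z * q) i" for i
    proof -
      have nz: "qpoch q q i \<noteq> 0" "1 - q * q ^ i \<noteq> 0" using qpoch_nonzero[OF q] q1[of i] by auto
      have e: "(- (z * q)) ^ i = (- z) ^ i * q ^ i"
        by (simp flip: power_mult_distrib)
      have "b ^ ((Suc i)\<^sup>2) = b ^ (i\<^sup>2) * q ^ i * b"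
        by (simp add: q_def power2_eq_square power_add power_mult flip: power_mult_distrib)
           (simp add: power_mult_distrib power_mult mult_ac flip: power_add)
      thus ?thesis
        using nz e by (simp add: t_def qpoch_Suc divide_simps) (simp add: algebra_simps)
    qed
    hence "(\<lambda>i. t z (Suc i) - t (z * q) (Suc i)) sums (- z * b * F (z * q))"
      using sums_mult[OF tF, of "- z * b" "z * q"] by simp
    from sums_Suc[OF this] have "(\<lambda>i. t z i - t (z * q) i) sums (- z * b * F (z * q))"
      by (simp add: t_def)
    from sums_unique2[OF this sums_diff[OF tF tF]] show ?thesis
      by (simp add: algebra_simps)
  qed
  have "F z = qpoch_inf (z * b) q"
  proof (rule limit_of_functional_equation[OF q, where F = F and z = z])
    show "F (z * q ^ n) = (1 - z * b * q ^ n) * F (z * q ^ Suc n)" for n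
      using feq[of "z * q ^ n"] by (simp add: mult_ac)
    have bnd: "norm (F w - 1) \<le> norm w * (\<Sum>i. C * norm b ^ (i\<^sup>2))" if w: "norm w \<le> 1" for w
      by (rule norm_power_square_series_minus_1[OF tF _ nt]) (use w b C in \<open>auto simp: t_def\<close>)
    have lim0: "(\<lambda>n. z * q ^ n) \<longlonglongrightarrow> 0"
      by (rule tendsto_mult_right_zero[OF LIMSEQ_power_zero[OF q]])
    have "eventually (\<lambda>n. norm (z * q ^ n) < 1) sequentially"
      using order_tendstoD(2)[OF tendsto_norm_zero[OF lim0], of 1] by simp
    hence ev: "eventually (\<lambda>n. norm (F (z * q ^ n) - 1) \<le> norm (z * q ^ n) * (\<Sum>i. C * norm b ^ (i\<^sup>2))) sequentially"
      by eventually_elim (rule bnd, rule less_imp_le)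
    have "(\<lambda>n. F (z * q ^ n) - 1) \<longlonglongrightarrow> 0"
      by (rule Lim_null_comparison[OF ev]) (intro tendsto_mult_left_zero tendsto_norm_zero lim0)
    thus "(\<lambda>n. F (z * q ^ n)) \<longlonglongrightarrow> 1"
      by (simp add: LIM_zero_iff)
  qed
  moreover have "(t z has_sum F z) UNIV"
    by (rule norm_summable_imp_has_sum[OF sn tF])
  ultimately show ?thesis by (simp add: t_def q_def)
qed

text \<open>Cauchy's identity; for \<open>z = 1\<close> it sorts partitions by their Durfee square.
  The functional equation \<open>(1 - z q) F(z) = F(z q)\<close> holds by telescoping, not termwise.
  The bound on \<open>z\<close> keeps all the symbols \<open>(z q;q)_m\<close> nonzero.\<close>

theorem qpoch_Durfee:
  fixes q z :: complex
  assumes q: "norm q < 1" and z: "norm z \<le> 1"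
  shows "((\<lambda>m. z ^ m * q ^ (m\<^sup>2) / (qpoch q q m * qpoch (z * q) q m)) has_sum
           inverse (qpoch_inf (z * q) q)) UNIV"
proof -
  have q1: "q * q ^ k \<noteq> 1" for k using power_neq_1[OF q, of "Suc k"] by simp
  have zq1: "z * q * q ^ k \<noteq> 1" if "norm z \<le> 1" for z k
  proof -
    have "norm (z * q * q ^ k) \<le> 1 * norm q * 1"
      unfolding norm_mult norm_power using q that by (intro mult_mono power_le_one) auto
    thus ?thesis using q by auto
  qed
  have nzz: "qpoch (z * q) q m \<noteq> 0" if "norm z \<le> 1" for z m
    using zq1[OF that] by (simp add: qpoch_def)
  have nzq: "qpoch q q m \<noteq> 0" for m using qpoch_nonzero[OF q] .
  have zn: "norm (z * q ^ n) \<le> 1" if "norm z \<le> 1" for n and z :: complex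
    using q that by (simp add: norm_mult norm_power mult_le_one power_le_one)
  define t where "t = (\<lambda>z m. z ^ m * q ^ (m\<^sup>2) / (qpoch q q m * qpoch (z * q) q m))"
  obtain C where C: "C \<ge> 1" "\<And>n. norm (inverse (qpoch q q n)) \<le> C"
    using inverse_qpoch_self_bounded[OF q] by blast
  obtain D where D: "D \<ge> 1" "\<And>n. norm (inverse (qpoch (z * q) q n)) \<le> D"
    using inverse_qpoch_bounded[OF q zq1[OF z]] by blast
  have "Bseq (\<lambda>n. qpoch (z * q) q n)"
    by (rule convergent_imp_Bseq[OF convergentI[OF qpoch_LIMSEQ[OF q]]])
  then obtain E where E: "E > 0" "\<And>n. norm (qpoch (z * q) q n) \<le> E"
    unfolding Bseq_def by blast
  define K where "K = C * (D * E)"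
  \<comment> \<open>The bound has to be independent of \<open>n\<close>, since the argument
    \<open>z * q ^ n\<close> moves. The shifted symbol is a quotient of two symbols with parameter
    \<open>z * q\<close>; \<open>D\<close> and \<open>E\<close> bound the reciprocal of one and the
    size of the other.\<close>
  have K: "norm (inverse (qpoch q q m) * inverse (qpoch (z * q ^ n * q) q m)) \<le> K" for n m
  proof -
    have "qpoch (z * q ^ n * q) q m = qpoch (z * q) q (n + m) / qpoch (z * q) q n"
      using nzz[OF z, of n] by (simp add: qpoch_add mult_ac)
    hence "norm (inverse (qpoch (z * q ^ n * q) q m))
             = norm (inverse (qpoch (z * q) q (n + m))) * norm (qpoch (z * q) q n)"
      by (simp add: norm_divide norm_inverse field_simps)
    also have "\<dots> \<le> D * E" using D E by (intro mult_mono) auto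
    finally show ?thesis unfolding norm_mult K_def using C D E by (intro mult_mono) auto
  qed
  have nt: "norm (t (z * q ^ n) m) \<le> K * (norm (z * q ^ n) ^ m * norm q ^ (m\<^sup>2))" for n m
  proof -
    have "norm (t (z * q ^ n) m) = norm (inverse (qpoch q q m) * inverse (qpoch (z * q ^ n * q) q m))
            * (norm (z * q ^ n) ^ m * norm q ^ (m\<^sup>2))"
      by (simp add: t_def norm_mult norm_power norm_divide norm_inverse field_simps)
    also have "\<dots> \<le> K * (norm (z * q ^ n) ^ m * norm q ^ (m\<^sup>2))"
      by (intro mult_right_mono K) auto
    finally show ?thesis .
  qed
  have K0: "K \<ge> 0" using C D E by (simp add: K_def)
  have sb: "summable (\<lambda>m. K * (norm (z * q ^ n) ^ m * norm q ^ (m\<^sup>2)))" for n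
    using q by (intro summable_mult summable_power_square) auto
  have sn: "summable (\<lambda>m. norm (t (z * q ^ n) m))" for n
    by (rule summable_comparison_test[OF _ sb[of n]]) (use nt in auto)
  define F where "F = (\<lambda>z. \<Sum>i. t z i)"
  have tF: "t (z * q ^ n) sums F (z * q ^ n)" for n
    unfolding F_def by (rule summable_sums[OF summable_norm_cancel[OF sn]])
  have feq: "(1 - w * q) * F w = F (w * q)"
    if w: "norm w \<le> 1" and s1: "t w sums F w" and s2: "t (w * q) sums F (w * q)"
       and s3: "(\<lambda>m. w ^ m * q ^ (m\<^sup>2) / (qpoch q q m * qpoch (w * q * q) q m)) \<longlonglongrightarrow> 0" for w
  proof -
    have wq: "norm (w * q) \<le> 1" using zn[OF w, of 1] by simp
    define S where "S = (\<lambda>m. w ^ m * q ^ (m\<^sup>2) / (qpoch q q m * qpoch (w * q * q) q m))"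
    \<comment> \<open>Telescoping certificate:
      \<open>T m = S m * (1 - q ^ m) * (1 - w * q * q ^ m)\<close>. The value 0 prescribed at
      \<open>m = 0\<close>, where \<open>m - 1\<close> would be truncated, agrees with this
      formula.\<close>
    define T where "T = (\<lambda>m. if m = 0 then 0 else w ^ m * q ^ (m\<^sup>2) / (qpoch q q (m-1) * qpoch (w * q * q) q (m-1)))"
    have "(1 - w * q) * t w m - t (w * q) m = T m - T (Suc m)" for m
    proof -
      note nz = nzq[of m] nzz[OF w, of m] nzz[OF wq, of m] zq1[OF w, of 0] zq1[OF w, of m]
      have 1: "(1 - w * q) / qpoch (w * q) q m = (1 - w * q * q ^ m) / qpoch (w * q * q) q m"
        using nz qpoch_Suc[of "w * q" q m] qpoch_Suc_left[of "w * q" q m] by (simp add: divide_simps mult_ac)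
      have "(1 - w * q) * t w m - t (w * q) m = S m * (1 - w * q * q ^ m - q ^ m)"
      proof -
        have "(1 - w * q) * t w m = ((1 - w * q) / qpoch (w * q) q m) * (w ^ m * q ^ (m\<^sup>2) / qpoch q q m)"
          by (simp add: t_def)
        also have "\<dots> = S m * (1 - w * q * q ^ m)"
        proof -
          have "x / u * (v / y) = v / (y * u) * x" for x u v y :: complex by (simp add: mult.commute)
          thus ?thesis unfolding 1 S_def .
        qed
        finally have 2: "(1 - w * q) * t w m = S m * (1 - w * q * q ^ m)" .
        have 3: "t (w * q) m = S m * q ^ m"
          by (simp add: t_def S_def power_mult_distrib)
        show ?thesis unfolding 2 3 by (simp only: right_diff_distrib)
      qed
      also have "\<dots> = T m - T (Suc m)"
      proof -
        have T1: "T (Suc m) = S m * (w * q ^ m * q ^ m * q)"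
          by (simp add: T_def S_def power2_eq_square power_add mult_ac)
        have T0: "T m = S m * (1 - q ^ m) * (1 - w * q * q ^ m)"
        proof (cases m)
          case (Suc k)
          have "q * q ^ k \<noteq> 1" "w * q * q * q ^ k \<noteq> 1" using q1 zq1[OF wq] by auto
          thus ?thesis using Suc nzq[of k] nzz[OF wq, of k]
            by (simp add: T_def S_def qpoch_Suc divide_simps)
        qed (simp add: T_def)
        show ?thesis unfolding T0 T1 by (simp add: algebra_simps)
      qed
      finally show ?thesis .
    qed
    moreover have "(\<lambda>m. T m - T (Suc m)) sums (T 0 - 0)"
    proof (rule telescope_sums')
      have "(\<lambda>m. T (Suc m)) \<longlonglongrightarrow> 0"
      proof -
        have "(\<lambda>m. S m * (w * q ^ m * q ^ m * q)) \<longlonglongrightarrow> 0 * (w * 0 * 0 * q)"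
          using s3 unfolding S_def[symmetric] by (intro tendsto_intros LIMSEQ_power_zero q)
        thus ?thesis by (simp add: T_def S_def power2_eq_square power_add mult_ac)
      qed
      thus "T \<longlonglongrightarrow> 0" by (simp add: filterlim_sequentially_Suc)
    qed
    ultimately have "(\<lambda>m. (1 - w * q) * t w m - t (w * q) m) sums 0" by (simp add: T_def)
    from sums_unique2[OF this sums_diff[OF sums_mult[OF s1] s2]] show ?thesis
      by (metis eq_iff_diff_eq_0)
  qed
  have "inverse (F z) = qpoch_inf (z * q) q"
  proof (rule limit_of_functional_equation[OF q, where F = "\<lambda>z. inverse (F z)"])
    show "inverse (F (z * q ^ n)) = (1 - z * q * q ^ n) * inverse (F (z * q ^ Suc n))" for n
    proof -
      have z': "z * q ^ Suc n = z * q ^ n * q" by (simp add: mult_ac)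
      have "(1 - z * q ^ n * q) * F (z * q ^ n) = F (z * q ^ n * q)"
      proof (rule feq)
        show "norm (z * q ^ n) \<le> 1" using zn[OF z] .
        show "t (z * q ^ n) sums F (z * q ^ n)" by (rule tF)
        show "t (z * q ^ n * q) sums F (z * q ^ n * q)" using tF[of "Suc n"] unfolding z' .
        have lim: "(\<lambda>m. K * (norm (z * q ^ n) ^ m * norm q ^ (m\<^sup>2))) \<longlonglongrightarrow> 0"
          using summable_LIMSEQ_zero[OF sb] .
        have le: "norm ((z * q ^ n) ^ m * q ^ (m\<^sup>2) / (qpoch q q m * qpoch (z * q ^ n * q * q) q m))
                         \<le> K * (norm (z * q ^ n) ^ m * norm q ^ (m\<^sup>2))" for m
        proof -
          have "norm ((z * q ^ n) ^ m * q ^ (m\<^sup>2) / (qpoch q q m * qpoch (z * q ^ n * q * q) q m))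
             = norm (inverse (qpoch q q m) * inverse (qpoch (z * q ^ Suc n * q) q m))
            * (norm (z * q ^ n) ^ m * norm q ^ (m\<^sup>2))"
            unfolding z' by (simp add: norm_mult norm_power norm_divide norm_inverse field_simps)
          also have "\<dots> \<le> K * (norm (z * q ^ n) ^ m * norm q ^ (m\<^sup>2))"
            by (intro mult_right_mono K) auto
          finally show ?thesis .
        qed
        show "(\<lambda>m. (z * q ^ n) ^ m * q ^ (m\<^sup>2) / (qpoch q q m * qpoch (z * q ^ n * q * q) q m)) \<longlonglongrightarrow> 0"
          by (rule Lim_null_comparison[OF always_eventually[OF allI[OF le]] lim])
      qed
      moreover have "1 - z * q * q ^ n \<noteq> 0" using zq1[OF z, of n] by simp
      moreover have "z * q * q ^ n = z * q ^ n * q" by (simp only: mult_ac)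
      ultimately show ?thesis unfolding z'
        by (metis inverse_mult_distrib mult.assoc mult_1 right_inverse)
    qed
    have bnd: "norm (F (z * q ^ n) - 1) \<le> norm (z * q ^ n) * (\<Sum>i. K * norm q ^ (i\<^sup>2))" for n
      by (rule norm_power_square_series_minus_1[OF tF _ nt]) (use zn[OF z] q K0 in \<open>auto simp: t_def\<close>)
    have lim0: "(\<lambda>n. z * q ^ n) \<longlonglongrightarrow> 0"
      by (rule tendsto_mult_right_zero[OF LIMSEQ_power_zero[OF q]])
    have "(\<lambda>n. F (z * q ^ n) - 1) \<longlonglongrightarrow> 0"
      by (rule Lim_null_comparison[OF always_eventually[OF allI[OF bnd]]])
         (intro tendsto_mult_left_zero tendsto_norm_zero lim0)
    hence "(\<lambda>n. F (z * q ^ n)) \<longlonglongrightarrow> 1"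
      by (simp add: LIM_zero_iff)
    from tendsto_inverse[OF this] show "(\<lambda>n. inverse (F (z * q ^ n))) \<longlonglongrightarrow> 1" by simp
  qed
  moreover have "(t z has_sum F z) UNIV"
    using norm_summable_imp_has_sum[OF sn[of 0], of "F z"] tF[of 0] by simp
  moreover from calculation(1) have "F z = inverse (qpoch_inf (z * q) q)"
    by (metis inverse_inverse_eq)
  ultimately show ?thesis by (simp add: t_def)
qed

section \<open>The Jacobi triple product\<close>

lemma summable_on_times_nonneg:
  fixes f g :: "_ \<Rightarrow> real"
  assumes "f summable_on A" "g summable_on B"
    and "\<And>x. x \<in> A \<Longrightarrow> f x \<ge> 0" "\<And>y. y \<in> B \<Longrightarrow> g y \<ge> 0"
  shows "(\<lambda>(x, y). f x * g y) summable_on A \<times> B"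
proof (rule summable_on_SigmaI)
  show "((\<lambda>y. case (x, y) of (x, y) \<Rightarrow> f x * g y) has_sum f x * infsum g B) B" for x
    using has_sum_cmult_right[OF has_sum_infsum[OF assms(2)]] by simp
  show "(\<lambda>x. f x * infsum g B) summable_on A"
    by (intro summable_on_cmult_left assms)
qed (use assms in auto)

lemma has_sum_times:
  fixes f g :: "_ \<Rightarrow> complex"
  assumes f: "(f has_sum a) A" and g: "(g has_sum b) B"
  shows "((\<lambda>(x, y). f x * g y) has_sum a * b) (A \<times> B)"
proof (rule has_sum_SigmaI)
  show "((\<lambda>y. case (x, y) of (x, y) \<Rightarrow> f x * g y) has_sum f x * b) B" for x
    using has_sum_cmult_right[OF g] by simp
  show "((\<lambda>x. f x * b) has_sum a * b) A"
    by (intro has_sum_cmult_left f)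
  have "(\<lambda>x. norm (f x)) summable_on A" "(\<lambda>x. norm (g x)) summable_on B"
    using f g has_sum_imp_summable summable_on_iff_abs_summable_on_complex by blast+
  hence "(\<lambda>(x, y). norm (f x) * norm (g y)) summable_on A \<times> B"
    by (intro summable_on_times_nonneg) auto
  hence "(\<lambda>z. norm (case z of (x, y) \<Rightarrow> f x * g y)) summable_on A \<times> B"
    by (simp add: case_prod_unfold norm_mult)
  thus "(\<lambda>(x, y). f x * g y) summable_on A \<times> B"
    by (rule abs_summable_summable)
qed

text \<open>The case \<open>z = q ^ N\<close> of Cauchy's identity, divided by
  \<open>(q;q)_N\<close>: Durfee rectangles with sides \<open>m\<close> and \<open>m + N\<close>.
  What matters is that the value does not depend on \<open>N\<close>.\<close>

lemma qpoch_Durfee_rectangle: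
  fixes q :: complex
  assumes q: "norm q < 1"
  shows "((\<lambda>m. q ^ (m\<^sup>2 + N * m) / (qpoch q q m * qpoch q q (N + m))) has_sum
           inverse (qpoch_inf q q)) UNIV"
proof -
  have nz: "qpoch q q n \<noteq> 0" for n using qpoch_nonzero[OF q] .
  have "norm (q ^ N) \<le> 1" using q by (simp add: norm_power power_le_one)
  from has_sum_cmult_left[OF qpoch_Durfee[OF q this], of "inverse (qpoch q q N)"]
  have "((\<lambda>m. (q ^ N) ^ m * q ^ (m\<^sup>2) / (qpoch q q m * qpoch (q ^ N * q) q m) * inverse (qpoch q q N))
          has_sum inverse (qpoch_inf (q ^ N * q) q) * inverse (qpoch q q N)) UNIV" .
  moreover have "(q ^ N) ^ m * q ^ (m\<^sup>2) / (qpoch q q m * qpoch (q ^ N * q) q m) * inverse (qpoch q q N)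
          = q ^ (m\<^sup>2 + N * m) / (qpoch q q m * qpoch q q (N + m))" for m
    by (simp add: qpoch_add power_add power_mult field_simps)
  moreover have "inverse (qpoch_inf (q ^ N * q) q) * inverse (qpoch q q N) = inverse (qpoch_inf q q)"
    using qpoch_inf_unfold[OF q, of q N] by (simp add: mult.commute)
  ultimately show ?thesis by simp
qed

text \<open>Multiply the Euler series at \<open>z\<close> and at \<open>1 / z\<close> and collect
  the pairs \<open>(i, j)\<close> by \<open>r = i - j\<close>. The inner sum over
  \<open>min i j\<close> is a Durfee rectangle sum, so apart from the powers of \<open>z\<close> and
  \<open>b\<close> it is the same for all \<open>r\<close>.\<close>

theorem Jacobi_triple_product:
  fixes b z :: complex
  assumes b: "norm b < 1" "b \<noteq> 0" and z: "z \<noteq> 0"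
  shows "((\<lambda>r. (-z) powi r * b powi (r\<^sup>2)) has_sum
           qpoch_inf (z * b) (b\<^sup>2) * qpoch_inf (b / z) (b\<^sup>2) * qpoch_inf (b\<^sup>2) (b\<^sup>2)) (UNIV :: int set)"
proof -
  define q where "q = b\<^sup>2"
  have q: "norm q < 1" using b by (simp add: q_def norm_power power_less_one_iff)
  have q0: "qpoch_inf q q \<noteq> 0" using qpoch_inf_nonzero[OF q q] .
  define e where "e = (\<lambda>z i. (-z) ^ i * b ^ (i\<^sup>2) / qpoch q q i)"
  have "((\<lambda>(i, j). e z i * e (1/z) j) has_sum qpoch_inf (z * b) q * qpoch_inf (1/z * b) q) (UNIV \<times> UNIV)"
    unfolding e_def q_def by (intro has_sum_times qpoch_Euler b)
  \<comment> \<open>Here \<open>m\<close> is the minimum of \<open>i\<close> and \<open>j\<close>.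
    As \<open>nat\<close> truncates, at most one of \<open>nat r\<close> and \<open>nat (-r)\<close>
    is nonzero.\<close>
  also have "?this \<longleftrightarrow> ((\<lambda>(r::int, m). e z (m + nat r) * e (1/z) (m + nat (-r))) has_sum
          qpoch_inf (z * b) q * qpoch_inf (1/z * b) q) (UNIV \<times> UNIV)"
  proof (rule has_sum_reindex_bij_witness)
    fix x :: "nat \<times> nat"
    have n: "i + nat (int j - int i) = j" if "i \<le> j" for i j using that by simp
    show "(\<lambda>(r::int, m). (m + nat r, m + nat (-r))) ((\<lambda>(i, j). (int i - int j, min i j)) x) = x"
      by (cases x) (auto simp: min_def n)
    show "(case (\<lambda>(i, j). (int i - int j, min i j)) x of (r, m) \<Rightarrow> e z (m + nat r) * e (1/z) (m + nat (-r)))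
            = (case x of (i, j) \<Rightarrow> e z i * e (1/z) j)"
      by (cases x) (auto simp: min_def n)
  next
    fix y :: "int \<times> nat"
    show "(\<lambda>(i, j). (int i - int j, min i j)) ((\<lambda>(r::int, m). (m + nat r, m + nat (-r))) y) = y"
      by (cases y) auto
  qed auto
  finally have *: "((\<lambda>(r::int, m). e z (m + nat r) * e (1/z) (m + nat (-r))) has_sum
          qpoch_inf (z * b) q * qpoch_inf (b / z) q) (UNIV \<times> UNIV)" by simp
  have key: "((\<lambda>m. e w (m + n) * e (1/w) m) has_sum ((-w) ^ n * b ^ (n\<^sup>2) * inverse (qpoch_inf q q))) UNIV"
    if "w \<noteq> 0" for w n
  proof -
    have "e w (m + n) * e (1/w) m
            = (-w) ^ n * b ^ (n\<^sup>2) * (q ^ (m\<^sup>2 + n * m) / (qpoch q q m * qpoch q q (n + m)))" for m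
    proof -
      have "(-w) ^ m * (- (1/w)) ^ m = 1"
        using that by (simp flip: power_mult_distrib)
      hence 1: "(-w) ^ (m + n) * (- (1/w)) ^ m = (-w) ^ n"
        by (simp add: power_add)
      have 2: "b ^ ((m + n)\<^sup>2) * b ^ (m\<^sup>2) = b ^ (n\<^sup>2) * q ^ (m\<^sup>2 + n * m)"
        unfolding q_def power_mult[symmetric] power_add[symmetric]
        by (rule arg_cong[where f = "\<lambda>k. b ^ k"]) (simp add: power2_eq_square algebra_simps)
      have "e w (m + n) * e (1/w) m
          = ((-w) ^ (m + n) * (- (1/w)) ^ m) * (b ^ ((m + n)\<^sup>2) * b ^ (m\<^sup>2)) / (qpoch q q m * qpoch q q (n + m))"
      proof -
        have "a * b / c * (a' * b' / c') = a * a' * (b * b') / (c' * c)" for a b c a' b' c' :: complex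
          by (simp add: mult_ac)
        thus ?thesis unfolding e_def add.commute[of n m] .
      qed
      thus ?thesis unfolding 1 2 by simp
    qed
    thus ?thesis
      using has_sum_cmult_right[OF qpoch_Durfee_rectangle[OF q], of "(-w) ^ n * b ^ (n\<^sup>2)" n]
      by (simp only:)
  qed
  have inner: "((\<lambda>m. e z (m + nat r) * e (1/z) (m + nat (-r))) has_sum
           ((-z) powi r * b powi (r\<^sup>2) * inverse (qpoch_inf q q))) UNIV" for r
  proof (cases "r \<ge> 0")
    case True
    then obtain n where "r = int n" using nonneg_int_cases by blast
    thus ?thesis using key[OF z, of n] by (simp flip: of_nat_power)
  next
    case False
    define n where "n = nat (-r)"
    have r: "r = - int n" using False by (simp add: n_def)
    have "(-z) powi r = (- (1/z)) ^ n"
      unfolding r by (simp add: power_int_minus divide_inverse flip: power_inverse)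
    moreover have "b powi (r\<^sup>2) = b ^ (n\<^sup>2)" "nat r = 0" "nat (-r) = n"
      unfolding r by (simp_all flip: of_nat_power)
    ultimately show ?thesis using key[of "1/z" n] z by (simp add: mult.commute[of "e z _"])
  qed
  have "((\<lambda>r. (-z) powi r * b powi (r\<^sup>2) * inverse (qpoch_inf q q)) has_sum
          qpoch_inf (z * b) q * qpoch_inf (b / z) q) UNIV"
    by (rule has_sum_SigmaD[OF *]) (simp only: prod.case inner)
  from has_sum_cmult_left[OF this, of "qpoch_inf q q"] q0 show ?thesis
    by (simp add: mult.assoc q_def)
qed

text \<open>Triple product with base \<open>b ^ 7\<close> and \<open>z = b powi k\<close>. The
  restriction on \<open>k\<close> places \<open>a\<close> strictly between 0 and 14, where the
  truncated difference in \<open>JJ\<close> is a true one.\<close>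

lemma JJ_has_sum:
  fixes b :: complex and k :: int
  assumes b: "norm b < 1" "b \<noteq> 0" and k: "\<bar>k\<bar> < 7" and a: "int a = 7 - k"
  shows "((\<lambda>r. (-1) powi r * b powi (7 * r\<^sup>2 + k * r)) has_sum JJ b a 14) UNIV"
proof -
  have b7: "norm (b ^ 7) < 1" using b by (simp add: norm_power power_less_one_iff)
  have *: "(- (b powi k)) powi r * (b ^ 7) powi (r\<^sup>2) = (-1) powi r * b powi (7 * r\<^sup>2 + k * r)" for r
  proof -
    have 1: "(b ^ 7) powi (r\<^sup>2) = b powi (7 * r\<^sup>2)"
      unfolding power_int_power by simp
    have 2: "(- (b powi k)) powi r = (-1) powi r * b powi (k * r)"
      unfolding power_int_mult power_int_mult_distrib[symmetric] by simp
    have 3: "b powi (7 * r\<^sup>2 + k * r) = b powi (7 * r\<^sup>2) * b powi (k * r)"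
      by (rule power_int_add) (use b in simp)
    show ?thesis unfolding 1 2 3 by (simp only: mult_ac)
  qed
  have 1: "b powi k * b ^ 7 = b ^ (14 - a)"
  proof -
    have "b powi k * b ^ 7 = b powi (k + 7)"
      using power_int_add[of b k 7] b by simp
    also have "k + 7 = int (14 - a)" using k a by simp
    finally show ?thesis by (simp only: power_int_of_nat)
  qed
  have 2: "b ^ 7 / b powi k = b ^ a"
  proof -
    have "b ^ 7 / b powi k = b powi (7 - k)"
      using power_int_diff[of b 7 k] b by simp
    thus ?thesis unfolding a[symmetric] by (simp only: power_int_of_nat)
  qed
  have 3: "(b ^ 7)\<^sup>2 = b ^ 14" by (simp flip: power_mult)
  have nz: "b ^ 7 \<noteq> 0" "b powi k \<noteq> 0" using b by auto
  show ?thesis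
    using Jacobi_triple_product[OF b7 nz]
    unfolding * 1 2 3 JJ_def mult.commute[of "qpoch_inf (b ^ a) _"] .
qed

section \<open>Alternating sums of Gaussian binomials\<close>

text \<open>With an integral lower index and the value 0 outside the range, sums over all integers
  have finite support, and Pascal's rule and the symmetry hold without boundary conditions.\<close>

definition gbinom :: "complex \<Rightarrow> nat \<Rightarrow> int \<Rightarrow> complex" where
  "gbinom q N k = (if 0 \<le> k \<and> k \<le> int N
     then qpoch q q N / (qpoch q q (nat k) * qpoch q q (N - nat k)) else 0)"

lemma gbinom_sym: "gbinom q N (int N - k) = gbinom q N k"
proof (cases "0 \<le> k \<and> k \<le> int N")
  case True
  then obtain m where "k = int m" using nonneg_int_cases by blast
  with True have "nat (int N - k) = N - m" "N - (N - m) = m" "nat k = m" by auto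
  thus ?thesis using True by (simp add: gbinom_def mult.commute)
qed (auto simp: gbinom_def)

text \<open>The exponent is negative for \<open>k > N + 1\<close>, hence the integer power; there
  the accompanying binomial vanishes.\<close>

lemma gbinom_Suc:
  assumes q: "norm q < 1" "q \<noteq> 0"
  shows "gbinom q (Suc N) k = gbinom q N k + q powi (int N + 1 - k) * gbinom q N (k - 1)"
proof -
  have nz: "qpoch q q n \<noteq> 0" for n using qpoch_nonzero[OF q(1)] .
  have q1: "1 - q * q ^ n \<noteq> 0" for n using power_neq_1[OF q(1), of "Suc n"] by simp
  consider "k < 0 \<or> k > int N + 1" | "k = 0" | "k = int N + 1" | "1 \<le> k" "k \<le> int N" by linarith
  thus ?thesis
  proof cases
    case 1 thus ?thesis by (auto simp: gbinom_def)
  next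
    case 2 thus ?thesis using nz by (simp add: gbinom_def)
  next
    case 3
    hence "nat k = Suc N" "nat (k - 1) = N" by auto
    thus ?thesis using nz 3 by (simp add: gbinom_def)
  next
    case 4
    define m where "m = nat (k - 1)"
    define d where "d = nat (int N - k)"
    have N: "N = Suc (m + d)" and k: "k = int m + 1" using 4 by (auto simp: m_def d_def)
    have e1: "gbinom q (Suc N) k = qpoch q q (Suc N) / (qpoch q q (Suc m) * qpoch q q (Suc d))"
    proof -
      have "nat k = Suc m" "Suc N - Suc m = Suc d" using N k by auto
      thus ?thesis using 4 by (simp only: gbinom_def) simp
    qed
    have e2: "gbinom q N k = qpoch q q N / (qpoch q q (Suc m) * qpoch q q d)"
    proof -
      have "nat k = Suc m" "N - Suc m = d" using N k by auto
      thus ?thesis using 4 by (simp only: gbinom_def) simp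
    qed
    have e3: "gbinom q N (k - 1) = qpoch q q N / (qpoch q q m * qpoch q q (Suc d))"
    proof -
      have "nat (k - 1) = m" "N - m = Suc d" using N k by auto
      thus ?thesis using 4 by (simp only: gbinom_def) simp
    qed
    have e4: "q powi (int N + 1 - k) = q * q ^ d"
    proof -
      have "int N + 1 - k = int (Suc d)" using N k by simp
      thus ?thesis by (simp only: power_int_of_nat power_Suc)
    qed
    have e5: "q ^ N = q * (q ^ m * q ^ d)" using N by (simp add: power_add)
    show ?thesis unfolding e1 e2 e3 e4 qpoch_Suc e5 using nz[of m] nz[of d] nz[of N] q1[of m] q1[of d]
      by (simp add: divide_simps) (simp add: algebra_simps)
  qed
qed

lemma gbinom_sum_summable:
  assumes "\<nu> \<noteq> (0::int)"
  shows "(\<lambda>k. f k * gbinom q N (c - \<nu> * k)) summable_on UNIV"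
proof (rule finite_nonzero_values_imp_summable_on)
  have "{k. f k * gbinom q N (c - \<nu> * k) \<noteq> 0} \<subseteq> {-(\<bar>c\<bar> + int N)..\<bar>c\<bar> + int N}"
  proof
    fix k assume "k \<in> {k. f k * gbinom q N (c - \<nu> * k) \<noteq> 0}"
    hence "0 \<le> c - \<nu> * k" "c - \<nu> * k \<le> int N" by (auto simp: gbinom_def split: if_splits)
    hence "\<bar>\<nu> * k\<bar> \<le> \<bar>c\<bar> + int N" by linarith
    moreover have "1 * \<bar>k\<bar> \<le> \<bar>\<nu>\<bar> * \<bar>k\<bar>" using assms by (intro mult_right_mono) auto
    ultimately show "k \<in> {-(\<bar>c\<bar> + int N)..\<bar>c\<bar> + int N}" by (auto simp: abs_mult)
  qed
  thus "finite {x \<in> UNIV. f x * gbinom q N (c - \<nu> * x) \<noteq> 0}"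
    using finite_subset by auto
qed

lemma infsum_int_shift: "(\<Sum>\<^sub>\<infinity>k::int. f (k + c)) = (\<Sum>\<^sub>\<infinity>k. f k)"
  by (rule infsum_reindex_bij_witness[where i = "\<lambda>k. k - c" and j = "\<lambda>k. k + c"]) auto

lemma infsum_int_reflect: "(\<Sum>\<^sub>\<infinity>k::int. f (c - k)) = (\<Sum>\<^sub>\<infinity>k. f k)"
  by (rule infsum_reindex_bij_witness[where i = "\<lambda>k. c - k" and j = "\<lambda>k. c - k"]) auto

text \<open>Up to \<open>(q;q)_N\<close> the second member of a Bailey pair whose first member is
  supported on the multiples of \<open>\<nu>\<close>. The parameters \<open>u\<close>,
  \<open>N\<close>, \<open>c\<close> are free because Pascal's rule moves all three.\<close>

definition gsum :: "complex \<Rightarrow> complex \<Rightarrow> int \<Rightarrow> int \<Rightarrow> nat \<Rightarrow> int \<Rightarrow> complex" where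
  "gsum \<rho> q \<nu> u N c = (\<Sum>\<^sub>\<infinity>r::int. (-1) powi r * \<rho> powi (3 * r\<^sup>2 + u * r) * gbinom q N (c - \<nu> * r))"

lemma minus_one_powi_add1: "(-1::complex) powi (r + 1) = - ((-1) powi r)"
  by (simp add: power_int_add)

context
  fixes \<rho> q :: complex
  assumes q: "norm q < 1" "q \<noteq> 0" and r0: "\<rho> \<noteq> 0"
begin

lemma gsum_reflect:
  "gsum \<rho> q \<nu> u N c = gsum \<rho> q \<nu> (-u) N (int N - c)"
proof -
  have "gsum \<rho> q \<nu> u N c
      = (\<Sum>\<^sub>\<infinity>r::int. (-1) powi (0-r) * \<rho> powi (3 * (0-r)\<^sup>2 + u * (0-r)) * gbinom q N (c - \<nu> * (0-r)))"
    unfolding gsum_def by (rule infsum_int_reflect[symmetric])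
  also have "\<dots> = gsum \<rho> q \<nu> (-u) N (int N - c)"
    unfolding gsum_def
  proof (intro infsum_cong)
    fix r :: int
    have "gbinom q N (c - \<nu> * (0-r)) = gbinom q N (int N - c - \<nu> * r)"
      using gbinom_sym[of q N "c - \<nu> * (0-r)"] by (simp add: algebra_simps)
    thus "(-1) powi (0-r) * \<rho> powi (3 * (0-r)\<^sup>2 + u * (0-r)) * gbinom q N (c - \<nu> * (0-r)) =
          (-1) powi r * \<rho> powi (3 * r\<^sup>2 + - u * r) * gbinom q N (int N - c - \<nu> * r)"
      by (simp add: power_int_minus_one_minus)
  qed
  finally show ?thesis .
qed

lemma gsum_shift:
  "gsum \<rho> q \<nu> u N c = - (\<rho> powi (3 + u)) * gsum \<rho> q \<nu> (u + 6) N (c - \<nu>)"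
proof -
  have "gsum \<rho> q \<nu> u N c
      = (\<Sum>\<^sub>\<infinity>r::int. (-1) powi (r+1) * \<rho> powi (3 * (r+1)\<^sup>2 + u * (r+1)) * gbinom q N (c - \<nu> * (r+1)))"
    unfolding gsum_def by (rule infsum_int_shift[symmetric])
  also have "\<dots> = (\<Sum>\<^sub>\<infinity>r::int. - (\<rho> powi (3 + u)) * ((-1) powi r * \<rho> powi (3 * r\<^sup>2 + (u + 6) * r) * gbinom q N (c - \<nu> - \<nu> * r)))"
  proof (intro infsum_cong)
    fix r :: int
    have 1: "3 * (r+1)\<^sup>2 + u * (r+1) = (3 + u) + (3 * r\<^sup>2 + (u + 6) * r)"
      by (simp add: power2_eq_square algebra_simps)
    have 2: "\<rho> powi (3 * (r+1)\<^sup>2 + u * (r+1)) = \<rho> powi (3 + u) * \<rho> powi (3 * r\<^sup>2 + (u + 6) * r)"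
      unfolding 1 by (rule power_int_add) (use r0 in simp)
    have 3: "c - \<nu> * (r+1) = c - \<nu> - \<nu> * r" by (simp add: algebra_simps)
    show "(-1) powi (r+1) * \<rho> powi (3 * (r+1)\<^sup>2 + u * (r+1)) * gbinom q N (c - \<nu> * (r+1)) =
      - (\<rho> powi (3 + u)) * ((-1) powi r * \<rho> powi (3 * r\<^sup>2 + (u + 6) * r) * gbinom q N (c - \<nu> - \<nu> * r))"
      unfolding 2 3 minus_one_powi_add1 by (simp only: mult_minus_left mult_minus_right mult_ac)
  qed
  also have "\<dots> = - (\<rho> powi (3 + u)) * gsum \<rho> q \<nu> (u + 6) N (c - \<nu>)"
    unfolding gsum_def by (rule infsum_cmult_right') 
  finally show ?thesis .
qed

text \<open>For \<open>u = -3\<close> the shift \<open>r -> r + 1\<close> has the factor -1 and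
  leads to \<open>u = 3\<close>; the reflection \<open>r -> -r\<close> leads back to
  \<open>u = -3\<close>. The hypothesis on \<open>\<nu>\<close> says that the lower index is
  restored too, so the sum equals its negative.\<close>

lemma gsum_antisym:
  assumes "\<nu> = 2 * c - int N"
  shows "gsum \<rho> q \<nu> (-3) N c = 0"
proof -
  have c: "int N - (c - \<nu>) = c" using assms by simp
  have "gsum \<rho> q \<nu> (-3) N c = - gsum \<rho> q \<nu> (-3) N c"
    using gsum_shift[of \<nu> "-3" N c] gsum_reflect[of \<nu> 3 N "c - \<nu>", unfolded c] by simp
  thus ?thesis by simp
qed

lemma gsum_antisym':
  assumes "\<nu> = int N - 2 * c"
  shows "gsum \<rho> q \<nu> 3 N c = 0"
  using gsum_reflect[of \<nu> 3 N c] gsum_antisym[of \<nu> "int N - c" N] assms by simp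

text \<open>The power \<open>q powi (\<nu> * r)\<close> from Pascal's rule is linear in
  \<open>r\<close> and is absorbed by moving \<open>u\<close> by \<open>e * \<nu>\<close>.\<close>

lemma gsum_Suc:
  assumes \<nu>: "\<nu> \<noteq> 0" and qe: "q = \<rho> ^ e" 
  shows "gsum \<rho> q \<nu> u (Suc N) c = gsum \<rho> q \<nu> u N c
           + q powi (int N + 1 - c) * gsum \<rho> q \<nu> (u + int e * \<nu>) N (c - 1)"
proof -
  have "gsum \<rho> q \<nu> u (Suc N) c
     = (\<Sum>\<^sub>\<infinity>r::int. (-1) powi r * \<rho> powi (3 * r\<^sup>2 + u * r) * gbinom q N (c - \<nu> * r) +
          q powi (int N + 1 - c) * ((-1) powi r * \<rho> powi (3 * r\<^sup>2 + (u + int e * \<nu>) * r) * gbinom q N (c - 1 - \<nu> * r)))"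
    unfolding gsum_def
  proof (intro infsum_cong)
    fix r :: int
    have 1: "q powi (int N + 1 - (c - \<nu> * r)) = q powi (int N + 1 - c) * \<rho> powi (int e * \<nu> * r)"
    proof -
      have "q powi (int N + 1 - (c - \<nu> * r)) = q powi ((int N + 1 - c) + \<nu> * r)" by (simp add: algebra_simps)
      also have "\<dots> = q powi (int N + 1 - c) * q powi (\<nu> * r)"
        by (rule power_int_add) (use q in simp)
      also have "q powi (\<nu> * r) = \<rho> powi (int e * \<nu> * r)"
        unfolding qe power_int_power by (simp only: mult.assoc)
      finally show ?thesis .
    qed
    have 2: "\<rho> powi (3 * r\<^sup>2 + (u + int e * \<nu>) * r) = \<rho> powi (3 * r\<^sup>2 + u * r) * \<rho> powi (int e * \<nu> * r)"
    proof -
      have e: "3 * r\<^sup>2 + (u + int e * \<nu>) * r = (3 * r\<^sup>2 + u * r) + int e * \<nu> * r"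
        by (simp add: algebra_simps)
      show ?thesis unfolding e by (rule power_int_add) (use r0 in simp)
    qed
    have 3: "c - \<nu> * r - 1 = c - 1 - \<nu> * r" by simp
    show "(-1) powi r * \<rho> powi (3 * r\<^sup>2 + u * r) * gbinom q (Suc N) (c - \<nu> * r) =
      (-1) powi r * \<rho> powi (3 * r\<^sup>2 + u * r) * gbinom q N (c - \<nu> * r) +
          q powi (int N + 1 - c) * ((-1) powi r * \<rho> powi (3 * r\<^sup>2 + (u + int e * \<nu>) * r) * gbinom q N (c - 1 - \<nu> * r))"
      unfolding gbinom_Suc[OF q] 1 2 3 by (simp only: distrib_left mult_ac)
  qed
  also have "\<dots> = gsum \<rho> q \<nu> u N c + (\<Sum>\<^sub>\<infinity>r::int. q powi (int N + 1 - c) * 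
      ((-1) powi r * \<rho> powi (3 * r\<^sup>2 + (u + int e * \<nu>) * r) * gbinom q N (c - 1 - \<nu> * r)))"
    unfolding gsum_def
    by (intro infsum_add gbinom_sum_summable \<nu> summable_on_cmult_right)
  also have "(\<Sum>\<^sub>\<infinity>r::int. q powi (int N + 1 - c) * 
      ((-1) powi r * \<rho> powi (3 * r\<^sup>2 + (u + int e * \<nu>) * r) * gbinom q N (c - 1 - \<nu> * r)))
      = q powi (int N + 1 - c) * gsum \<rho> q \<nu> (u + int e * \<nu>) N (c - 1)"
    unfolding gsum_def by (rule infsum_cmult_right')
  finally show ?thesis .
qed

text \<open>Conjugation by the reflection turns the previous rule into the other form of Pascal's
  rule.\<close>

lemma gsum_Suc':
  assumes \<nu>: "\<nu> \<noteq> 0" and qe: "q = \<rho> ^ e" 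
  shows "gsum \<rho> q \<nu> u (Suc N) c = gsum \<rho> q \<nu> u N (c - 1)
           + q powi c * gsum \<rho> q \<nu> (u - int e * \<nu>) N c"
proof -
  have "gsum \<rho> q \<nu> u (Suc N) c = gsum \<rho> q \<nu> (-u) (Suc N) (int (Suc N) - c)"
    by (rule gsum_reflect)
  also have "\<dots> = gsum \<rho> q \<nu> (-u) N (int (Suc N) - c)
      + q powi c * gsum \<rho> q \<nu> (-u + int e * \<nu>) N (int (Suc N) - c - 1)"
    unfolding gsum_Suc[OF assms] by simp
  also have "gsum \<rho> q \<nu> (-u) N (int (Suc N) - c) = gsum \<rho> q \<nu> u N (c - 1)"
    by (subst gsum_reflect) simp
  also have "gsum \<rho> q \<nu> (-u + int e * \<nu>) N (int (Suc N) - c - 1) = gsum \<rho> q \<nu> (u - int e * \<nu>) N c"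
    by (subst gsum_reflect) simp
  finally show ?thesis .
qed

lemma gsum_0: "\<nu> \<noteq> 0 \<Longrightarrow> gsum \<rho> q \<nu> u 0 0 = 1"
proof -
  assume \<nu>: "\<nu> \<noteq> 0"
  have "gsum \<rho> q \<nu> u 0 0
      = (\<Sum>\<^sub>\<infinity>r\<in>{0::int}. (-1) powi r * \<rho> powi (3 * r\<^sup>2 + u * r) * gbinom q 0 (0 - \<nu> * r))"
    unfolding gsum_def using \<nu> by (intro infsum_cong_neutral) (auto simp: gbinom_def)
  thus ?thesis by (simp add: gbinom_def)
qed

context
  assumes q4: "q = \<rho> ^ 4"
begin

text \<open>Pascal's rule leaves sums with \<open>u = 1\<close> and \<open>u = 5\<close>. Reflection
  sends the first and the shift sends the second to one and the same sum with
  \<open>u = -1\<close>.\<close>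

lemma gsum_1_odd: "gsum \<rho> q 1 1 (2 * n + 1) (int n) = (1 - \<rho>\<^sup>2 * q ^ n) * gsum \<rho> q 1 (-1) (2 * n) (int n)"
proof -
  have "gsum \<rho> q 1 1 (Suc (2 * n)) (int n)
      = gsum \<rho> q 1 1 (2 * n) (int n) + q powi (int n + 1) * gsum \<rho> q 1 5 (2 * n) (int n - 1)"
    using gsum_Suc[of 1 4 1 "2 * n" "int n"] q4 by simp
  also have "gsum \<rho> q 1 1 (2 * n) (int n) = gsum \<rho> q 1 (-1) (2 * n) (int n)"
    by (subst gsum_reflect) simp
  also have "gsum \<rho> q 1 5 (2 * n) (int n - 1) = - gsum \<rho> q 1 (-1) (2 * n) (int n) / \<rho>\<^sup>2"
    using gsum_shift[of 1 "-1" "2 * n" "int n"] r0 by (simp add: field_simps)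
  also have "q powi (int n + 1) = \<rho>\<^sup>2 * \<rho>\<^sup>2 * q ^ n"
  proof -
    have "q powi (int n + 1) = q ^ Suc n" by (metis of_nat_Suc add.commute power_int_of_nat)
    thus ?thesis by (simp add: q4 power4_eq_xxxx power2_eq_square)
  qed
  also have "\<rho>\<^sup>2 * \<rho>\<^sup>2 * q ^ n * (- gsum \<rho> q 1 (-1) (2 * n) (int n) / \<rho>\<^sup>2)
               = - (\<rho>\<^sup>2 * q ^ n * gsum \<rho> q 1 (-1) (2 * n) (int n))"
    using r0 by (simp add: field_simps)
  finally show ?thesis by (simp add: left_diff_distrib)
qed

lemma gsum_1_Suc:
  "gsum \<rho> q 1 (-1) (2 * n + 1) (int n + 1) = gsum \<rho> q 1 1 (2 * n + 1) (int n)"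
  by (subst gsum_reflect) simp

text \<open>In the step from \<open>2 n + 1\<close> to \<open>2 n + 2\<close> the second sum in
  Pascal's rule has \<open>u = 3\<close> and vanishes by antisymmetry, so only the factor gained in
  the odd step is added.\<close>

lemma gsum_1_even: "gsum \<rho> q 1 (-1) (2 * n) (int n) = qpoch (\<rho>\<^sup>2) q n"
proof (induction n)
  case 0 thus ?case by (simp add: gsum_0)
next
  case (Suc n)
  have "gsum \<rho> q 1 (-1) (Suc (2 * n + 1)) (int n + 1)
      = gsum \<rho> q 1 (-1) (2 * n + 1) (int n + 1) + q powi (int n + 1) * gsum \<rho> q 1 3 (2 * n + 1) (int n)"
    using gsum_Suc[of 1 4 "-1" "2 * n + 1" "int n + 1"] q4 by simp
  also have "gsum \<rho> q 1 3 (2 * n + 1) (int n) = 0"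
    by (rule gsum_antisym') simp
  finally show ?case
    using Suc gsum_1_Suc[of n] gsum_1_odd[of n] by (simp add: qpoch_Suc add_ac)
qed

text \<open>Here the second form of Pascal's rule is the useful one, as its first term is the
  vanishing sum.\<close>

lemma gsum_1_even': "gsum \<rho> q 1 3 (2 * n) (int n) = q ^ n * qpoch (\<rho>\<^sup>2) q n"
proof (cases n)
  case (Suc m)
  have "gsum \<rho> q 1 3 (Suc (2 * m + 1)) (int m + 1)
      = gsum \<rho> q 1 3 (2 * m + 1) (int m) + q powi (int m + 1) * gsum \<rho> q 1 (-1) (2 * m + 1) (int m + 1)"
    using gsum_Suc'[of 1 4 3 "2 * m + 1" "int m + 1"] q4 by simp
  also have "gsum \<rho> q 1 3 (2 * m + 1) (int m) = 0"
    by (rule gsum_antisym') simp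
  also have "q powi (int m + 1) = q ^ Suc m" by (metis of_nat_Suc add.commute power_int_of_nat)
  finally show ?thesis
    using Suc gsum_1_Suc[of m] gsum_1_odd[of m] gsum_1_even[of m]
    by (simp add: qpoch_Suc add_ac)
qed (simp add: gsum_0)

end

end

context
  fixes q :: complex
  assumes q: "norm q < 1" "q \<noteq> 0"
begin

text \<open>For \<open>\<nu> = 2\<close> the vanishing sum appears already in the step to an odd
  upper index, so no factor is gained here; the factors \<open>1 + q ^ (n + 1)\<close> come from the
  even steps.\<close>

lemma gsum_2_odd: "gsum q q 2 1 (2 * n + 1) (int n) = gsum q q 2 (-1) (2 * n) (int n)"
proof -
  have "gsum q q 2 1 (Suc (2 * n)) (int n)
      = gsum q q 2 1 (2 * n) (int n) + q powi (int n + 1) * gsum q q 2 3 (2 * n) (int n - 1)"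
    using gsum_Suc[OF q q(2), of 2 1 1 "2 * n" "int n"] by simp
  also have "gsum q q 2 3 (2 * n) (int n - 1) = 0"
    by (rule gsum_antisym'[OF q q(2)]) simp
  also have "gsum q q 2 1 (2 * n) (int n) = gsum q q 2 (-1) (2 * n) (int n)"
    by (subst gsum_reflect[OF q q(2)]) simp
  finally show ?thesis by simp
qed

lemma gsum_2_even: "gsum q q 2 (-1) (2 * n) (int n) = qpoch (-q) q n"
proof (induction n)
  case 0 thus ?case by (simp add: gsum_0[OF q q(2)])
next
  case (Suc n)
  have "gsum q q 2 (-1) (Suc (2 * n + 1)) (int n + 1)
      = gsum q q 2 (-1) (2 * n + 1) (int n + 1) + q powi (int n + 1) * gsum q q 2 1 (2 * n + 1) (int n)"
    using gsum_Suc[OF q q(2), of 2 1 "-1" "2 * n + 1" "int n + 1"] by simp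
  also have "gsum q q 2 (-1) (2 * n + 1) (int n + 1) = gsum q q 2 1 (2 * n + 1) (int n)"
    by (subst gsum_reflect[OF q q(2)]) simp
  also have "q powi (int n + 1) = q ^ Suc n" by (metis of_nat_Suc add.commute power_int_of_nat)
  finally show ?case
    using Suc gsum_2_odd[of n] by (simp add: qpoch_Suc add_ac algebra_simps)
qed

lemma gsum_2_odd': "gsum q q 2 3 (2 * n + 1) (int n) = q ^ n * qpoch (-q) q n"
proof -
  have "gsum q q 2 3 (Suc (2 * n)) (int n)
      = gsum q q 2 3 (2 * n) (int n - 1) + q ^ n * gsum q q 2 1 (2 * n) (int n)"
    using gsum_Suc'[OF q q(2), of 2 1 3 "2 * n" "int n"] by simp
  also have "gsum q q 2 3 (2 * n) (int n - 1) = 0"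
    by (rule gsum_antisym'[OF q q(2)]) simp
  also have "gsum q q 2 1 (2 * n) (int n) = gsum q q 2 (-1) (2 * n) (int n)"
    by (subst gsum_reflect[OF q q(2)]) simp
  finally show ?thesis by (simp add: gsum_2_even)
qed

end

section \<open>Bailey's lemma and identities of Slater type\<close>

lemma summable_on_power_int:
  fixes t :: real
  assumes "0 \<le> t" "t < 1"
  shows "(\<lambda>k::int. t ^ nat \<bar>k\<bar>) summable_on UNIV"
proof -
  have *: "(\<lambda>n::nat. t ^ n) summable_on UNIV"
    using assms by (intro norm_summable_imp_summable_on) (auto simp: norm_power)
  have "(\<lambda>k::int. t ^ nat \<bar>k\<bar>) summable_on range int"
    by (subst summable_on_reindex) (use * in \<open>auto simp: o_def\<close>)
  moreover have "(\<lambda>k::int. t ^ nat \<bar>k\<bar>) summable_on range (\<lambda>n. - int n)"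
    by (subst summable_on_reindex) (use * in \<open>auto simp: o_def inj_on_def\<close>)
  ultimately have "(\<lambda>k::int. t ^ nat \<bar>k\<bar>) summable_on range int \<union> range (\<lambda>n. - int n)"
    by (rule summable_on_union)
  also have "range int \<union> range (\<lambda>n. - int n) = UNIV"
  proof -
    have "k \<in> range int \<union> range (\<lambda>n. - int n)" for k
      by (cases k rule: int_cases2) auto
    thus ?thesis by blast
  qed
  finally show ?thesis .
qed

text \<open>The quotient on the left is the reciprocal of \<open>(q;q)_(n-r) (q;q)_(n+r+s)\<close>,
  which makes the sum over \<open>n\<close> a Durfee rectangle sum. The cases \<open>s = 0\<close>
  and \<open>s = 1\<close> are those of Bailey pairs relative to 1 and to \<open>q\<close>.\<close>

lemma Durfee_gbinom:
  fixes q :: complex and r :: int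
  assumes q: "norm q < 1" "q \<noteq> 0" and s: "s \<le> 1"
  shows "((\<lambda>n. q ^ (n\<^sup>2 + s * n) * (gbinom q (2 * n + s) (int n - r) / qpoch q q (2 * n + s))) has_sum
           (q powi (r\<^sup>2 + int s * r) * inverse (qpoch_inf q q))) UNIV"
proof -
  have main: "((\<lambda>n. q ^ (n\<^sup>2 + s * n) * (gbinom q (2 * n + s) (int n - int a) / qpoch q q (2 * n + s))) has_sum
           (q ^ (a\<^sup>2 + s * a) * inverse (qpoch_inf q q))) UNIV" for a :: nat
  proof -
    have "((\<lambda>m. q ^ (a\<^sup>2 + s * a) * (q ^ (m\<^sup>2 + (2 * a + s) * m) / (qpoch q q m * qpoch q q ((2 * a + s) + m))))
            has_sum (q ^ (a\<^sup>2 + s * a) * inverse (qpoch_inf q q))) UNIV"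
      by (intro has_sum_cmult_right qpoch_Durfee_rectangle q)
    also have "?this \<longleftrightarrow> ((\<lambda>n. q ^ (n\<^sup>2 + s * n) * (gbinom q (2 * n + s) (int n - int a) / qpoch q q (2 * n + s))) has_sum
           (q ^ (a\<^sup>2 + s * a) * inverse (qpoch_inf q q))) {a..}"
    proof (rule has_sum_reindex_bij_witness[where i = "\<lambda>n. n - a" and j = "\<lambda>m. m + a"])
      fix m :: nat
      have 1: "gbinom q (2 * (m + a) + s) (int (m + a) - int a) / qpoch q q (2 * (m + a) + s)
          = 1 / (qpoch q q m * qpoch q q ((2 * a + s) + m))"
      proof -
        have "2 * (m + a) + s - m = 2 * a + s + m" by simp
        thus ?thesis using qpoch_nonzero[OF q(1)] by (simp add: gbinom_def add.commute)
      qed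
      have 2: "(m + a)\<^sup>2 + s * (m + a) = (a\<^sup>2 + s * a) + (m\<^sup>2 + (2 * a + s) * m)"
        by (simp add: power2_eq_square algebra_simps)
      show "q ^ ((m + a)\<^sup>2 + s * (m + a)) * (gbinom q (2 * (m + a) + s) (int (m + a) - int a) / qpoch q q (2 * (m + a) + s))
         = q ^ (a\<^sup>2 + s * a) * (q ^ (m\<^sup>2 + (2 * a + s) * m) / (qpoch q q m * qpoch q q ((2 * a + s) + m)))"
        unfolding 1 2 power_add[of q "a\<^sup>2 + s * a" "m\<^sup>2 + (2 * a + s) * m"] by simp
    qed auto
    also have "\<dots> \<longleftrightarrow> ?thesis"
      by (rule has_sum_cong_neutral) (auto simp: gbinom_def)
    finally show ?thesis .
  qed
  show ?thesis
  proof (cases "r \<ge> 0")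
    case True
    define a where "a = nat r"
    have r: "r = int a" using True by (simp add: a_def)
    have "r\<^sup>2 + int s * r = int (a\<^sup>2 + s * a)" unfolding r by simp
    thus ?thesis using main[of a] unfolding r by (simp only: power_int_of_nat)
  next
    case False
    \<comment> \<open>The exponent and the binomial are invariant under \<open>r -> -s - r\<close>,
      which sends negative \<open>r\<close> to nonnegative integers because \<open>s\<close> is at
      most 1.\<close>
    define a where "a = nat (- r - int s)"
    have r: "r = - int s - int a" using False s by (simp add: a_def)
    have 1: "r\<^sup>2 + int s * r = int (a\<^sup>2 + s * a)"
      unfolding r by (simp add: power2_eq_square algebra_simps)
    have 2: "gbinom q (2 * n + s) (int n - r) = gbinom q (2 * n + s) (int n - int a)" for n
      using gbinom_sym[of q "2 * n + s" "int n - int a"] unfolding r by (simp add: algebra_simps)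
    show ?thesis using main[of a] unfolding 1 2 by (simp only: power_int_of_nat)
  qed
qed

lemma norm_powi_le_1:
  fixes x :: complex
  assumes "norm x \<le> 1" "k \<ge> 0"
  shows "norm (x powi k) \<le> 1"
  using assms by (simp add: power_int_nonneg_exp norm_power power_le_one)

lemma norm_minus_one_powi: "norm ((-1 :: complex) powi k) = 1"
  by (simp add: norm_power_int)

text \<open>Bailey's lemma in the limit where both free parameters tend to infinity. A double series
  over \<open>n\<close> and \<open>k\<close> is summed in both orders: rows give
  \<open>gsum\<close>, columns give Durfee rectangles. The bound on \<open>u\<close> makes
  \<open>3 k^2 + u k\<close> nonnegative.\<close>

theorem Bailey_gsum:
  fixes \<rho> q :: complex
  assumes \<rho>: "norm \<rho> < 1" "\<rho> \<noteq> 0" and q: "q = \<rho> ^ e" "e > 0"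
    and s: "s \<le> 1" and u: "\<bar>u\<bar> \<le> 3" and \<nu>: "\<nu> > 0"
    and S: "((\<lambda>k. (-1) powi k * \<rho> powi (3 * k\<^sup>2 + u * k) * q powi ((\<nu> * k)\<^sup>2 + int s * (\<nu> * k))) has_sum S) UNIV"
  shows "((\<lambda>n. q ^ (n\<^sup>2 + s * n) * gsum \<rho> q \<nu> u (2 * n + s) (int n) / qpoch q q (2 * n + s))
           has_sum S * inverse (qpoch_inf q q)) UNIV"
proof -
  have nq: "norm q < 1" "q \<noteq> 0"
    using \<rho> q by (auto simp: norm_power power_less_one_iff)
  define \<alpha> where "\<alpha> = (\<lambda>k. (-1) powi k * \<rho> powi (3 * k\<^sup>2 + u * k))"
  have \<alpha>: "norm (\<alpha> k) \<le> 1" for k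
  proof -
    have "\<bar>u * k\<bar> \<le> 3 * \<bar>k\<bar>" unfolding abs_mult by (intro mult_right_mono u) auto
    moreover have "\<bar>k\<bar> \<le> k\<^sup>2"
    proof (cases "k = 0")
      case False
      hence "\<bar>k\<bar> * 1 \<le> \<bar>k\<bar> * \<bar>k\<bar>" by (intro mult_left_mono) auto
      thus ?thesis by (simp add: power2_eq_square)
    qed simp
    ultimately have "3 * k\<^sup>2 + u * k \<ge> 0" by linarith
    thus ?thesis
      unfolding \<alpha>_def norm_mult norm_minus_one_powi using \<rho> norm_powi_le_1[of \<rho>] by simp
  qed
  define w where "w = (\<lambda>n r. gbinom q (2 * n + s) (int n - r) / qpoch q q (2 * n + s))"
  define F where "F = (\<lambda>(n::nat, k::int). q ^ (n\<^sup>2 + s * n) * (\<alpha> k * w n (\<nu> * k)))"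
  obtain C where C: "C \<ge> 1" "\<And>n. norm (inverse (qpoch q q n)) \<le> C"
    using inverse_qpoch_self_bounded[OF nq(1)] by blast
  \<comment> \<open>Half of the decay \<open>norm q ^ n = t ^ n * t ^ n\<close> is spent on
    \<open>k\<close>: the support of the binomials forces \<open>\<bar>k\<bar> \<le> n + 1\<close>,
    and the division by \<open>t\<close> in the bound pays for the \<open>+ 1\<close>.\<close>
  define t where "t = sqrt (norm q)"
  have t: "0 < t" "t < 1" and tq: "norm q = t * t" using nq by (auto simp: t_def)
  have wn: "norm (w n r) \<le> C * C" for n r
  proof (cases "0 \<le> int n - r \<and> int n - r \<le> int (2 * n + s)")
    case True
    have "w n r = inverse (qpoch q q (nat (int n - r))) * inverse (qpoch q q (2 * n + s - nat (int n - r)))"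
      using True qpoch_nonzero[OF nq(1)] by (simp add: w_def gbinom_def field_simps)
    thus ?thesis using C by (simp only: norm_mult) (intro mult_mono; force)
  next
    case False
    hence "w n r = 0" unfolding w_def gbinom_def by (simp only: if_False) simp
    thus ?thesis using C by simp
  qed
  have bound: "norm (F (n, k)) \<le> C * C / t * (t ^ n * t ^ nat \<bar>k\<bar>)" for n k
  proof (cases "w n (\<nu> * k) = 0")
    case True
    thus ?thesis using C t by (simp add: F_def)
  next
    case False
    hence "0 \<le> int n - \<nu> * k" "int n - \<nu> * k \<le> int (2 * n + s)"
      by (auto simp: w_def gbinom_def split: if_splits)
    hence "\<bar>\<nu> * k\<bar> \<le> int n + 1" using s by linarith
    moreover have "1 * \<bar>k\<bar> \<le> \<bar>\<nu>\<bar> * \<bar>k\<bar>" using \<nu> by (intro mult_right_mono) auto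
    ultimately have "nat \<bar>k\<bar> \<le> Suc n" by (simp add: abs_mult)
    hence tk: "t ^ Suc n \<le> t ^ nat \<bar>k\<bar>" using t by (intro power_decreasing) auto
    have "n \<le> n\<^sup>2 + s * n" by (simp add: power2_eq_square le_square trans_le_add1)
    hence "norm (q ^ (n\<^sup>2 + s * n)) \<le> norm q ^ n"
      unfolding norm_power using nq by (intro power_decreasing) auto
    also have "\<dots> = t ^ n * t ^ Suc n / t" using t by (simp add: tq power_mult_distrib)
    also have "\<dots> \<le> t ^ n * t ^ nat \<bar>k\<bar> / t"
      using t tk by (intro divide_right_mono mult_left_mono) auto
    finally have 1: "norm (q ^ (n\<^sup>2 + s * n)) \<le> t ^ n * t ^ nat \<bar>k\<bar> / t" .
    have 2: "norm (\<alpha> k) * norm (w n (\<nu> * k)) \<le> 1 * (C * C)"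
      using \<alpha> wn by (intro mult_mono) auto
    have "norm (F (n, k)) = norm (q ^ (n\<^sup>2 + s * n)) * (norm (\<alpha> k) * norm (w n (\<nu> * k)))"
      by (simp add: F_def norm_mult)
    also have "\<dots> \<le> t ^ n * t ^ nat \<bar>k\<bar> / t * (1 * (C * C))"
      by (rule mult_mono[OF 1 2]) (use t in auto)
    finally show ?thesis by (simp add: mult_ac)
  qed
  have "(\<lambda>n. t ^ n) summable_on UNIV"
    using t by (intro norm_summable_imp_summable_on) (auto simp: norm_power)
  hence "(\<lambda>(n, k). t ^ n * t ^ nat \<bar>k\<bar>) summable_on (UNIV :: nat set) \<times> (UNIV :: int set)"
    using t by (intro summable_on_times_nonneg summable_on_power_int) auto
  hence "(\<lambda>x. C * C / t * (case x of (n, k) \<Rightarrow> t ^ n * t ^ nat \<bar>k\<bar>)) summable_on (UNIV :: nat set) \<times> (UNIV :: int set)"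
    by (rule summable_on_cmult_right)
  hence "(\<lambda>x. norm (F x)) summable_on (UNIV :: nat set) \<times> (UNIV :: int set)"
    by (rule summable_on_comparison_test) (use bound in \<open>auto simp: case_prod_unfold\<close>)
  hence sF: "F summable_on (UNIV :: nat set) \<times> (UNIV :: int set)"
    by (rule abs_summable_summable)
  define T where "T = infsum F (UNIV \<times> UNIV)"
  have T: "(F has_sum T) (UNIV \<times> UNIV)"
    unfolding T_def by (rule has_sum_infsum[OF sF])
  have row: "((\<lambda>k. F (n, k)) has_sum q ^ (n\<^sup>2 + s * n) * gsum \<rho> q \<nu> u (2 * n + s) (int n) / qpoch q q (2 * n + s)) UNIV" for n
  proof -
    have "(\<lambda>k. \<alpha> k * gbinom q (2 * n + s) (int n - \<nu> * k)) summable_on UNIV"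
      by (rule gbinom_sum_summable) (use \<nu> in simp)
    from has_sum_cmult_right[OF has_sum_infsum[OF this], of "q ^ (n\<^sup>2 + s * n) / qpoch q q (2 * n + s)"]
    show ?thesis by (simp add: F_def w_def gsum_def \<alpha>_def)
  qed
  have T1: "((\<lambda>n. q ^ (n\<^sup>2 + s * n) * gsum \<rho> q \<nu> u (2 * n + s) (int n) / qpoch q q (2 * n + s)) has_sum T) UNIV"
    by (rule has_sum_SigmaD[OF T row])
  have col: "((\<lambda>n. F (n, k)) has_sum \<alpha> k * (q powi ((\<nu> * k)\<^sup>2 + int s * (\<nu> * k)) * inverse (qpoch_inf q q))) UNIV" for k
  proof -
    have "F (n, k) = \<alpha> k * (q ^ (n\<^sup>2 + s * n) * (gbinom q (2 * n + s) (int n - \<nu> * k) / qpoch q q (2 * n + s)))" for n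
      by (simp add: F_def w_def)
    thus ?thesis using has_sum_cmult_right[OF Durfee_gbinom[OF nq s], of "\<alpha> k" "\<nu> * k"]
      by (simp only:)
  qed
  have "((\<lambda>(k, n). F (n, k)) has_sum T) (UNIV \<times> UNIV)"
    using T by (subst (asm) has_sum_swap)
  hence "((\<lambda>k. \<alpha> k * (q powi ((\<nu> * k)\<^sup>2 + int s * (\<nu> * k)) * inverse (qpoch_inf q q))) has_sum T) UNIV"
    by (rule has_sum_SigmaD) (simp only: prod.case col)
  moreover have "((\<lambda>k. \<alpha> k * (q powi ((\<nu> * k)\<^sup>2 + int s * (\<nu> * k)) * inverse (qpoch_inf q q))) has_sum S * inverse (qpoch_inf q q)) UNIV"
    using has_sum_cmult_left[OF S, of "inverse (qpoch_inf q q)"] unfolding \<alpha>_def mult.assoc .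
  ultimately have "T = S * inverse (qpoch_inf q q)"
    by (rule has_sum_unique)
  with T1 show ?thesis by simp
qed

text \<open>The condition \<open>int e * \<nu>\<^sup>2 = 4\<close> makes the exponents
  \<open>3 r^2\<close> and \<open>e * (\<nu> r)^2\<close> add up to \<open>7 r^2\<close>; the linear
  terms of the two parts determine \<open>a\<close>.\<close>

theorem gsum_JJ_has_sum:
  fixes \<rho> q :: complex
  assumes \<rho>: "norm \<rho> < 1" "\<rho> \<noteq> 0" and q: "q = \<rho> ^ e" "e > 0"
    and s: "s \<le> 1" and u: "\<bar>u\<bar> \<le> 3" and \<nu>: "\<nu> > 0"
    and e: "int e * \<nu>\<^sup>2 = 4" and a: "int a = 7 - (u + int e * int s * \<nu>)" "a > 0" "a < 14"
  shows "((\<lambda>n. q ^ (n\<^sup>2 + s * n) * gsum \<rho> q \<nu> u (2 * n + s) (int n) / qpoch q q (2 * n + s))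
           has_sum JJ \<rho> a 14 * inverse (qpoch_inf q q)) UNIV"
proof (rule Bailey_gsum[OF \<rho> q s u \<nu>])
  define k where "k = u + int e * int s * \<nu>"
  have "((\<lambda>r. (-1) powi r * \<rho> powi (7 * r\<^sup>2 + k * r)) has_sum JJ \<rho> a 14) UNIV"
    by (rule JJ_has_sum[OF \<rho>]) (use a in \<open>auto simp: k_def\<close>)
  also have "(\<lambda>r. (-1) powi r * \<rho> powi (7 * r\<^sup>2 + k * r)) =
     (\<lambda>k. (-1) powi k * \<rho> powi (3 * k\<^sup>2 + u * k) * q powi ((\<nu> * k)\<^sup>2 + int s * (\<nu> * k)))"
  proof
    fix r :: int
    have "int e * ((\<nu> * r)\<^sup>2 + int s * (\<nu> * r)) = (int e * \<nu>\<^sup>2) * r\<^sup>2 + int e * int s * \<nu> * r"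
      by (simp add: power_mult_distrib algebra_simps)
    hence 1: "7 * r\<^sup>2 + k * r = (3 * r\<^sup>2 + u * r) + int e * ((\<nu> * r)\<^sup>2 + int s * (\<nu> * r))"
      unfolding e k_def by (simp add: algebra_simps)
    have 2: "\<rho> powi (7 * r\<^sup>2 + k * r) = \<rho> powi (3 * r\<^sup>2 + u * r) * q powi ((\<nu> * r)\<^sup>2 + int s * (\<nu> * r))"
      unfolding 1 q(1) power_int_power by (rule power_int_add) (use \<rho> in simp)
    show "(-1) powi r * \<rho> powi (7 * r\<^sup>2 + k * r) = (-1) powi r * \<rho> powi (3 * r\<^sup>2 + u * r) * q powi ((\<nu> * r)\<^sup>2 + int s * (\<nu> * r))"
      unfolding 2 by (simp only: mult.assoc)
  qed
  finally show "((\<lambda>k. (-1) powi k * \<rho> powi (3 * k\<^sup>2 + u * k) * q powi ((\<nu> * k)\<^sup>2 + int s * (\<nu> * k))) has_sum JJ \<rho> a 14) UNIV" .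
qed

section \<open>Six series of Slater type, for \<open>q = \<rho> ^ 4\<close> and for
  \<open>q = \<rho>\<close>\<close>

context
  fixes \<rho> q :: complex
  assumes \<rho>: "norm \<rho> < 1" "\<rho> \<noteq> 0" and q4: "q = \<rho> ^ 4"
begin

lemma norm_q4: "norm q < 1" "q \<noteq> 0"
  using \<rho> q4 by (auto simp: norm_power power_less_one_iff)

lemma Slater_28_a:
  "((\<lambda>n. q ^ (n\<^sup>2) * qpoch (\<rho>\<^sup>2) q n / qpoch q q (2 * n)) has_sum JJ \<rho> 8 14 / qpoch_inf q q) UNIV"
  using gsum_JJ_has_sum[OF \<rho> q4, of 0 "-1" 1 8] gsum_1_even[OF norm_q4 \<rho>(2) q4]
  by (simp add: divide_inverse)

lemma Slater_28_b:
  "((\<lambda>n. q ^ (n\<^sup>2 + n) * qpoch (\<rho>\<^sup>2) q n / qpoch q q (2 * n)) has_sum JJ \<rho> 4 14 / qpoch_inf q q) UNIV"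
  using gsum_JJ_has_sum[OF \<rho> q4, of 0 3 1 4] gsum_1_even'[OF norm_q4 \<rho>(2) q4]
  by (simp add: divide_inverse power_add mult_ac)

lemma Slater_28_c:
  "((\<lambda>n. q ^ (n\<^sup>2 + n) * qpoch (\<rho>\<^sup>2) q (Suc n) / qpoch q q (2 * n + 1)) has_sum JJ \<rho> 2 14 / qpoch_inf q q) UNIV"
proof -
  have "gsum \<rho> q 1 1 (2 * n + 1) (int n) = qpoch (\<rho>\<^sup>2) q (Suc n)" for n
    unfolding gsum_1_odd[OF norm_q4 \<rho>(2) q4] gsum_1_even[OF norm_q4 \<rho>(2) q4] qpoch_Suc by simp
  thus ?thesis using gsum_JJ_has_sum[OF \<rho> q4, of 1 1 1 2] by (simp add: divide_inverse)
qed

end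

context
  fixes q :: complex
  assumes q: "norm q < 1" "q \<noteq> 0"
begin

lemma Slater_14_a:
  "((\<lambda>n. q ^ (n\<^sup>2) * qpoch (-q) q n / qpoch q q (2 * n)) has_sum JJ q 8 14 / qpoch_inf q q) UNIV"
  using gsum_JJ_has_sum[OF q, of q 1 0 "-1" 2 8] gsum_2_even[OF q]
  by (simp add: divide_inverse)

lemma Slater_14_b:
  "((\<lambda>n. q ^ (n\<^sup>2 + n) * qpoch (-q) q n / qpoch q q (2 * n + 1)) has_sum JJ q 4 14 / qpoch_inf q q) UNIV"
  using gsum_JJ_has_sum[OF q, of q 1 1 1 2 4] gsum_2_even[OF q] gsum_2_odd[OF q]
  by (simp add: divide_inverse)

lemma Slater_14_c:
  "((\<lambda>n. q ^ (n\<^sup>2 + 2 * n) * qpoch (-q) q n / qpoch q q (2 * n + 1)) has_sum JJ q 2 14 / qpoch_inf q q) UNIV"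
proof -
  have "q ^ (n\<^sup>2 + 2 * n) = q ^ (n\<^sup>2 + n) * q ^ n" for n
    by (simp add: mult_2 add.assoc flip: power_add)
  thus ?thesis
  using gsum_JJ_has_sum[OF q, of q 1 1 3 2 2] gsum_2_odd'[OF q]
  by (simp add: divide_inverse mult.assoc)
qed

end

section \<open>Infinite products modulo 28\<close>

lemma divide_eqI_cross:
  fixes a b c d :: complex
  assumes "b \<noteq> 0" "d \<noteq> 0" "a * d = c * b"
  shows "a / b = c / d"
  using assms by (simp add: frac_eq_eq)

text \<open>Made for products \<open>x\<close>, \<open>y1\<close>, \<open>y2\<close>,
  \<open>y3\<close> of factors \<open>1 + p ^ k\<close>, each known only through multiplication by
  factors \<open>1 - p ^ k\<close>. After clearing these, an equality of monomials remains.\<close>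

lemma divide_eqI_cross4:
  fixes x y1 y2 y3 :: complex
  assumes "x * d1 = n1" "y1 * d2 = n2" "y2 * d3 = n3" "y3 * d4 = n4"
    and eq: "(n1 * n2 * n3 * n4 * r) * d = c * b * (d1 * d2 * d3 * d4)"
    and nz: "d1 \<noteq> 0" "d2 \<noteq> 0" "d3 \<noteq> 0" "d4 \<noteq> 0" "b \<noteq> 0" "d \<noteq> 0"
  shows "x * (y1 * y2 * y3 * r) / b = c / d"
proof (rule divide_eqI_cross)
  have "(x * (y1 * y2 * y3 * r) * d) * (d1 * d2 * d3 * d4) = (n1 * n2 * n3 * n4 * r) * d"
    unfolding assms(1-4)[symmetric] by (simp only: mult_ac)
  also have "\<dots> = (c * b) * (d1 * d2 * d3 * d4)" by (rule eq)
  finally show "x * (y1 * y2 * y3 * r) * d = c * b" using nz by simp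
qed fact+

text \<open>One symbol per residue class modulo 28, as a common alphabet: once all products are
  monomials in these, a product identity is a matter of commutativity.\<close>

definition qp :: "complex \<Rightarrow> nat \<Rightarrow> complex" where
  "qp p a = qpoch_inf (p ^ a) (p ^ 28)"

context
  fixes p :: complex
  assumes p: "norm p < 1"
begin

lemma norm_power_lt_1: "n > 0 \<Longrightarrow> norm (p ^ n) < 1"
  using p by (simp add: norm_power power_less_one_iff)

lemma qp_nonzero: "a > 0 \<Longrightarrow> qp p a \<noteq> 0"
  unfolding qp_def by (rule qpoch_inf_nonzero) (use norm_power_lt_1 in auto)

lemma qpoch_inf_eq_prod_qp:
  assumes "m * k = 28"
  shows "qpoch_inf (p ^ a) (p ^ m) = (\<Prod>j<k. qp p (a + m * j))"
proof -
  have "m > 0" "k > 0" using assms by (auto intro!: Nat.gr0I)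
  hence "qpoch_inf (p ^ a) (p ^ m) = (\<Prod>j<k. qpoch_inf (p ^ a * (p ^ m) ^ j) ((p ^ m) ^ k))"
    by (intro qpoch_inf_multisection norm_power_lt_1)
  thus ?thesis by (simp add: qp_def assms flip: power_mult power_add)
qed

lemma qpoch_inf_uminus_mult:
  assumes "m * k = 14" 
  shows "qpoch_inf (- (p ^ a)) (p ^ m) * (\<Prod>j<2*k. qp p (a + m * j)) = (\<Prod>j<k. qp p (2 * a + 2 * m * j))"
proof -
  have "m > 0" using assms by (auto intro!: Nat.gr0I)
  have "qpoch_inf (- (p ^ a)) (p ^ m) * qpoch_inf (p ^ a) (p ^ m) = qpoch_inf (p ^ (2 * a)) (p ^ (2 * m))"
    using qpoch_inf_mult_uminus[OF norm_power_lt_1[OF \<open>m > 0\<close>], of "p ^ a"]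
    by (simp add: mult.commute flip: power_mult)
  moreover have "m * (2 * k) = 28" "2 * m * k = 28"
    using assms by (simp_all add: mult.left_commute[of m] mult.assoc)
  ultimately show ?thesis
    using qpoch_inf_eq_prod_qp[of m "2 * k" a] qpoch_inf_eq_prod_qp[of "2 * m" k "2 * a"] by simp
qed

lemma J1_qp: "J p 1 = qp p 1 * qp p 2 * qp p 3 * qp p 4 * qp p 5 * qp p 6 * qp p 7 * qp p 8 * qp p 9 * qp p 10 * qp p 11 * qp p 12 * qp p 13 * qp p 14 * qp p 15 * qp p 16 * qp p 17 * qp p 18 * qp p 19 * qp p 20 * qp p 21 * qp p 22 * qp p 23 * qp p 24 * qp p 25 * qp p 26 * qp p 27 * qp p 28"
  using qpoch_inf_eq_prod_qp[of 1 28 1] by (simp add: J_def lessThan_nat_numeral mult_ac flip: numeral_2_eq_2)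

lemma J2_qp: "J p 2 = qp p 2 * qp p 4 * qp p 6 * qp p 8 * qp p 10 * qp p 12 * qp p 14 * qp p 16 * qp p 18 * qp p 20 * qp p 22 * qp p 24 * qp p 26 * qp p 28"
  using qpoch_inf_eq_prod_qp[of 2 14 2] by (simp add: J_def lessThan_nat_numeral mult_ac flip: numeral_2_eq_2)

lemma J14_qp: "J p 14 = qp p 14 * qp p 28"
  using qpoch_inf_eq_prod_qp[of 14 2 14] by (simp add: J_def lessThan_nat_numeral mult_ac flip: numeral_2_eq_2)

lemma J28_qp: "J p 28 = qp p 28"
  using qpoch_inf_eq_prod_qp[of 28 1 28] by (simp add: J_def lessThan_nat_numeral mult_ac flip: numeral_2_eq_2)

lemma JJ_qp: "JJ p a 28 = qp p a * qp p (28 - a) * qp p 28"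
  by (simp add: JJ_def qp_def)

lemma X_qp: "qpoch_inf (- p) (p\<^sup>2) * (qp p 1 * qp p 3 * qp p 5 * qp p 7 * qp p 9 * qp p 11 * qp p 13 * qp p 15 * qp p 17 * qp p 19 * qp p 21 * qp p 23 * qp p 25 * qp p 27) = qp p 2 * qp p 6 * qp p 10 * qp p 14 * qp p 18 * qp p 22 * qp p 26"
  using qpoch_inf_uminus_mult[of 2 7 1] by (simp add: lessThan_nat_numeral mult_ac flip: numeral_2_eq_2)

lemma neg3_qp: "qpoch_inf (- (p ^ 3)) (p ^ 14) * (qp p 3 * qp p 17) = qp p 6"
  using qpoch_inf_uminus_mult[of 14 1 3] by (simp add: lessThan_nat_numeral mult_ac flip: numeral_2_eq_2)

lemma neg5_qp: "qpoch_inf (- (p ^ 5)) (p ^ 14) * (qp p 5 * qp p 19) = qp p 10"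
  using qpoch_inf_uminus_mult[of 14 1 5] by (simp add: lessThan_nat_numeral mult_ac flip: numeral_2_eq_2)

lemma neg1_qp: "qpoch_inf (- (p ^ 1)) (p ^ 14) * (qp p 1 * qp p 15) = qp p 2"
  using qpoch_inf_uminus_mult[of 14 1 1] by (simp add: lessThan_nat_numeral mult_ac flip: numeral_2_eq_2)

lemma neg7_qp: "qpoch_inf (- (p ^ 7)) (p ^ 14) * (qp p 7 * qp p 21) = qp p 14"
  using qpoch_inf_uminus_mult[of 14 1 7] by (simp add: lessThan_nat_numeral mult_ac flip: numeral_2_eq_2)

lemma neg9_qp: "qpoch_inf (- (p ^ 9)) (p ^ 14) * (qp p 9 * qp p 23) = qp p 18"
  using qpoch_inf_uminus_mult[of 14 1 9] by (simp add: lessThan_nat_numeral mult_ac flip: numeral_2_eq_2)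

lemma neg11_qp: "qpoch_inf (- (p ^ 11)) (p ^ 14) * (qp p 11 * qp p 25) = qp p 22"
  using qpoch_inf_uminus_mult[of 14 1 11] by (simp add: lessThan_nat_numeral mult_ac flip: numeral_2_eq_2)

lemma neg13_qp: "qpoch_inf (- (p ^ 13)) (p ^ 14) * (qp p 13 * qp p 27) = qp p 26"
  using qpoch_inf_uminus_mult[of 14 1 13] by (simp add: lessThan_nat_numeral mult_ac flip: numeral_2_eq_2)


context
  fixes \<sigma> :: complex
  assumes \<sigma>: "\<sigma>\<^sup>2 = - p"
begin

lemma sigma_even: "\<sigma> ^ (2 * n) = (- p) ^ n"
  using \<sigma> by (simp add: power_mult)

text \<open>The base is \<open>\<sigma> ^ 14\<close>. Separating even and odd factors passes to its
  square \<open>p ^ 14\<close>, at the price of a second symbol whose parameter has the opposite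
  sign.\<close>

lemma qpoch_inf_base_split: "qpoch_inf a (- (p ^ 7)) = qpoch_inf a (p ^ 14) * qpoch_inf (- (a * p ^ 7)) (p ^ 14)"
proof -
  have "norm (- (p ^ 7)) < 1" using norm_power_lt_1[of 7] by simp
  from qpoch_inf_multisection[OF this, of 2 a]
  show ?thesis by (simp add: numeral_2_eq_2 lessThan_Suc flip: power_mult)
qed

text \<open>Only even powers of \<open>\<sigma>\<close> occur, so everything is expressible in
  \<open>p\<close>. The three symbols with a minus sign are placed in front, ready for the clearing
  of denominators.\<close>

lemma JJ_half_base_a: "JJ \<sigma> 6 14 = qpoch_inf (- (p ^ 3)) (p ^ 14) * qpoch_inf (- (p ^ 11)) (p ^ 14)
    * qpoch_inf (- (p ^ 7)) (p ^ 14) * (qp p 10 * qp p 24 * (qp p 4 * qp p 18) * (qp p 14 * qp p 28))"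
proof -
  have "qp p 10 * qp p 24 = qpoch_inf (p ^ 10) (p ^ 14)" "qp p 4 * qp p 18 = qpoch_inf (p ^ 4) (p ^ 14)"
    "qp p 14 * qp p 28 = qpoch_inf (p ^ 14) (p ^ 14)"
    using qpoch_inf_eq_prod_qp[of 14 2 10] qpoch_inf_eq_prod_qp[of 14 2 4] qpoch_inf_eq_prod_qp[of 14 2 14]
    by (simp_all add: lessThan_nat_numeral mult_ac flip: numeral_2_eq_2)
  moreover have "\<sigma> ^ 6 = - (p ^ 3)" "\<sigma> ^ 8 = p ^ 4" "\<sigma> ^ 14 = - (p ^ 7)"
    using sigma_even[of 3] sigma_even[of 4] sigma_even[of 7] by (simp_all del: power_mult_numeral)
  ultimately show ?thesis
    by (simp add: JJ_def qpoch_inf_base_split mult_ac flip: power_add power_Suc power_Suc2)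
qed

lemma product_28_a:
  "qpoch_inf (- p) (p\<^sup>2) * JJ \<sigma> 6 14 / J p 2 =
     J p 2 * (J p 14)\<^sup>2 * J p 28 * JJ p 6 28 * JJ p 10 28 / (J p 1 * JJ p 3 28 * JJ p 7 28 * JJ p 8 28 * JJ p 11 28 * JJ p 12 28)"
  unfolding JJ_half_base_a
by (rule divide_eqI_cross4[OF X_qp neg3_qp neg11_qp neg7_qp],
      (unfold J1_qp J2_qp J14_qp J28_qp JJ_qp power2_eq_square, simp only: mult_ac diff_numeral_Suc arith_simps, simp)[1])
     (simp_all add: J1_qp[unfolded One_nat_def] J2_qp JJ_qp qp_nonzero)

lemma JJ_half_base_b: "JJ \<sigma> 10 14 = qpoch_inf (- (p ^ 5)) (p ^ 14) * qpoch_inf (- (p ^ 9)) (p ^ 14)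
    * qpoch_inf (- (p ^ 7)) (p ^ 14) * (qp p 12 * qp p 26 * (qp p 2 * qp p 16) * (qp p 14 * qp p 28))"
proof -
  have "qp p 12 * qp p 26 = qpoch_inf (p ^ 12) (p ^ 14)" "qp p 2 * qp p 16 = qpoch_inf (p ^ 2) (p ^ 14)"
    "qp p 14 * qp p 28 = qpoch_inf (p ^ 14) (p ^ 14)"
    using qpoch_inf_eq_prod_qp[of 14 2 12] qpoch_inf_eq_prod_qp[of 14 2 2] qpoch_inf_eq_prod_qp[of 14 2 14]
    by (simp_all add: lessThan_nat_numeral mult_ac flip: numeral_2_eq_2)
  moreover have "\<sigma> ^ 10 = - (p ^ 5)" "\<sigma> ^ 4 = p ^ 2" "\<sigma> ^ 14 = - (p ^ 7)"
    using sigma_even[of 5] sigma_even[of 2] sigma_even[of 7] by (simp_all del: power_mult_numeral)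
  ultimately show ?thesis
    by (simp add: JJ_def qpoch_inf_base_split mult_ac flip: power_add power_Suc power_Suc2)
qed

lemma product_28_b:
  "qpoch_inf (- p) (p\<^sup>2) * JJ \<sigma> 10 14 / J p 2 =
     J p 2 * (J p 14)\<^sup>2 * J p 28 * JJ p 2 28 * JJ p 10 28 / (J p 1 * JJ p 4 28 * JJ p 5 28 * JJ p 7 28 * JJ p 8 28 * JJ p 9 28)"
  unfolding JJ_half_base_b
by (rule divide_eqI_cross4[OF X_qp neg5_qp neg9_qp neg7_qp],
      (unfold J1_qp J2_qp J14_qp J28_qp JJ_qp power2_eq_square, simp only: mult_ac diff_numeral_Suc arith_simps, simp)[1])
     (simp_all add: J1_qp[unfolded One_nat_def] J2_qp JJ_qp qp_nonzero)

lemma JJ_half_base_c: "JJ \<sigma> 2 14 = qpoch_inf (- (p ^ 1)) (p ^ 14) * qpoch_inf (- (p ^ 13)) (p ^ 14)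
    * qpoch_inf (- (p ^ 7)) (p ^ 14) * (qp p 8 * qp p 22 * (qp p 6 * qp p 20) * (qp p 14 * qp p 28))"
proof -
  have "qp p 8 * qp p 22 = qpoch_inf (p ^ 8) (p ^ 14)" "qp p 6 * qp p 20 = qpoch_inf (p ^ 6) (p ^ 14)"
    "qp p 14 * qp p 28 = qpoch_inf (p ^ 14) (p ^ 14)"
    using qpoch_inf_eq_prod_qp[of 14 2 8] qpoch_inf_eq_prod_qp[of 14 2 6] qpoch_inf_eq_prod_qp[of 14 2 14]
    by (simp_all add: lessThan_nat_numeral mult_ac flip: numeral_2_eq_2)
  moreover have "\<sigma> ^ 2 = - (p ^ 1)" "\<sigma> ^ 12 = p ^ 6" "\<sigma> ^ 14 = - (p ^ 7)"
    using sigma_even[of 1] sigma_even[of 6] sigma_even[of 7] by (simp_all del: power_mult_numeral)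
  ultimately show ?thesis
    by (simp add: JJ_def qpoch_inf_base_split mult_ac flip: power_add power_Suc power_Suc2)
qed

lemma product_28_c:
  "qpoch_inf (- p) (p\<^sup>2) * JJ \<sigma> 2 14 / J p 2 =
     J p 2 * (J p 14)\<^sup>2 * J p 28 * JJ p 2 28 * JJ p 6 28 / (J p 1 * JJ p 1 28 * JJ p 4 28 * JJ p 7 28 * JJ p 12 28 * JJ p 13 28)"
  unfolding JJ_half_base_c
by (rule divide_eqI_cross4[OF X_qp neg1_qp neg13_qp neg7_qp],
      (unfold J1_qp J2_qp J14_qp J28_qp JJ_qp power2_eq_square, simp only: mult_ac diff_numeral_Suc arith_simps, simp)[1])
     (simp_all add: J1_qp[unfolded One_nat_def] J2_qp JJ_qp qp_nonzero)

end

end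

section \<open>The double sums\<close>

lemma has_sum_even_odd:
  fixes f :: "nat \<Rightarrow> complex"
  assumes "((\<lambda>m. f (2 * m)) has_sum a) UNIV" "((\<lambda>m. f (2 * m + 1)) has_sum b) UNIV"
  shows "(f has_sum (a + b)) UNIV"
proof -
  have "(f has_sum a) (range (\<lambda>m. 2 * m))" "(f has_sum b) (range (\<lambda>m. 2 * m + 1))"
    using assms by (subst has_sum_reindex; simp add: inj_on_def o_def)+
  hence "(f has_sum (a + b)) (range (\<lambda>m. 2 * m) \<union> range (\<lambda>m. 2 * m + 1))"
    by (rule has_sum_Un_disjoint) (auto, presburger)
  also have "range (\<lambda>m. 2 * m) \<union> range (\<lambda>m. 2 * m + 1) = (UNIV :: nat set)"
  proof -
    have "n \<in> range (\<lambda>m. 2 * m) \<union> range (\<lambda>m. 2 * m + 1)" for n :: nat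
      by (cases "even n") (auto intro: range_eqI[of _ _ "n div 2"])
    thus ?thesis by blast
  qed
  finally show ?thesis .
qed

text \<open>The \<open>j\<close>-th term after summation over \<open>i\<close>, by Euler's formula
  with \<open>b = q ^ 4\<close> and \<open>z = - (q powi (a - 4 * int j))\<close>; \<open>a\<close>
  and \<open>c\<close> are the linear coefficients of the exponent in \<open>i\<close> and
  \<open>j\<close>.\<close>

abbreviation euler_row :: "complex \<Rightarrow> complex \<Rightarrow> int \<Rightarrow> int \<Rightarrow> nat \<Rightarrow> complex" where
  "euler_row q Q a c j \<equiv> q powi (3 * (int j)\<^sup>2 + c * int j) * qpoch_inf (- (q powi (a + 4 - 4 * int j))) Q / qpoch Q Q j"

context
  fixes q Q :: complex
  assumes q: "norm q < 1" "q \<noteq> 0" and Q: "Q = q ^ 8"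
begin

lemma norm_Q: "norm Q < 1" "Q \<noteq> 0"
  using q by (auto simp: Q norm_power power_less_one_iff)

lemma Q_power: "Q ^ n = q powi (8 * int n)"
proof -
  have "8 * int n = int (8 * n)" by simp
  thus ?thesis unfolding Q by (simp only: power_int_of_nat power_mult)
qed

lemma powi_split: "k = m + n \<Longrightarrow> q powi k = q powi m * q powi n"
  using q power_int_add[of q m n] by blast

text \<open>In the coordinates \<open>2 i - j\<close> and \<open>j\<close> the quadratic form is
  diagonal, \<open>(2 i - j)^2 + 2 j^2\<close>. The hypothesis \<open>pos\<close> replaces it by a
  linear lower bound, whose geometric majorant justifies summing over \<open>i\<close>
  alone.\<close>

lemma double_sum_via_Euler:
  fixes a c :: int
  assumes pos: "\<And>i j :: nat. 4 * (int i)\<^sup>2 + 3 * (int j)\<^sup>2 - 4 * int i * int j + a * int i + c * int j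
                  \<ge> \<bar>2 * int i - int j\<bar> + int j - 2"
    and S: "((\<lambda>j. euler_row q Q a c j)
               has_sum S) UNIV"
  shows "((\<lambda>(i, j). q powi (4 * (int i)\<^sup>2 + 3 * (int j)\<^sup>2 - 4 * int i * int j + a * int i + c * int j)
            / (qpoch Q Q i * qpoch Q Q j)) has_sum S) UNIV"
proof -
  define E where "E = (\<lambda>i j :: nat. 4 * (int i)\<^sup>2 + 3 * (int j)\<^sup>2 - 4 * int i * int j + a * int i + c * int j)"
  define F where "F = (\<lambda>(i, j). q powi E i j / (qpoch Q Q i * qpoch Q Q j))"
  obtain C where C: "C \<ge> 1" "\<And>n. norm (inverse (qpoch Q Q n)) \<le> C"
    using inverse_qpoch_self_bounded[OF norm_Q(1)] by blast
  define r where "r = norm q"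
  have r: "0 < r" "r < 1" using q by (auto simp: r_def)
  have bound: "norm (F (i, j)) \<le> C * C / r\<^sup>2 * (r ^ nat \<bar>2 * int i - int j\<bar> * r ^ j)" for i j
  proof -
    have "r powi E i j \<le> r powi (\<bar>2 * int i - int j\<bar> + int j - 2)"
      using r pos[of i j] unfolding E_def by (intro power_int_decreasing) auto
    also have "\<dots> = r powi (\<bar>2 * int i - int j\<bar>) * r powi int j / r powi 2"
      using r by (subst power_int_diff, simp, subst power_int_add) auto
    also have "\<dots> = r ^ nat \<bar>2 * int i - int j\<bar> * r ^ j / r\<^sup>2"
      by (simp add: power_int_nonneg_exp)
    finally have 1: "norm (q powi E i j) \<le> r ^ nat \<bar>2 * int i - int j\<bar> * r ^ j / r\<^sup>2"
      by (simp add: norm_power_int r_def)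
    have 2: "norm (inverse (qpoch Q Q i)) * norm (inverse (qpoch Q Q j)) \<le> C * C"
      using C by (intro mult_mono) auto
    have "norm (F (i, j)) = norm (q powi E i j) * (norm (inverse (qpoch Q Q i)) * norm (inverse (qpoch Q Q j)))"
      by (simp add: F_def norm_mult norm_divide norm_inverse field_simps)
    also have "\<dots> \<le> r ^ nat \<bar>2 * int i - int j\<bar> * r ^ j / r\<^sup>2 * (C * C)"
      by (rule mult_mono[OF 1 2]) (use r in auto)
    finally show ?thesis by (simp add: mult_ac)
  qed
  have "(\<lambda>n. r ^ n) summable_on UNIV"
    using r by (intro norm_summable_imp_summable_on) (auto simp: norm_power)
  hence "(\<lambda>(u, j). r ^ nat \<bar>u\<bar> * r ^ j) summable_on (UNIV :: int set) \<times> (UNIV :: nat set)"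
    using r by (intro summable_on_times_nonneg summable_on_power_int) auto
  \<comment> \<open>The pairs \<open>(2 i - j, j)\<close> run injectively through part of a grid on
    which the product of the two geometric series is summable.\<close>
  hence "(\<lambda>(u, j). r ^ nat \<bar>u\<bar> * r ^ j) summable_on (range (\<lambda>(i, j). (2 * int i - int j, j)))"
    by (rule summable_on_subset_banach) auto
  hence "(\<lambda>(i, j). r ^ nat \<bar>2 * int i - int j\<bar> * r ^ j) summable_on UNIV"
    by (subst (asm) summable_on_reindex) (auto simp: inj_on_def o_def case_prod_unfold)
  hence "(\<lambda>x. C * C / r\<^sup>2 * (case x of (i, j) \<Rightarrow> r ^ nat \<bar>2 * int i - int j\<bar> * r ^ j)) summable_on UNIV"
    by (rule summable_on_cmult_right)
  hence "(\<lambda>x. norm (F x)) summable_on UNIV"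
    by (rule summable_on_comparison_test) (use bound in \<open>auto simp: case_prod_unfold\<close>)
  hence sF: "F summable_on UNIV \<times> UNIV"
    unfolding UNIV_Times_UNIV by (rule abs_summable_summable)
  define T where "T = infsum F (UNIV \<times> UNIV)"
  have T: "(F has_sum T) (UNIV \<times> UNIV)"
    unfolding T_def by (rule has_sum_infsum[OF sF])
  have q4: "norm (q ^ 4) < 1" "(q ^ 4)\<^sup>2 = Q" using q by (auto simp: Q norm_power power_less_one_iff)
  have row: "((\<lambda>i. F (i, j)) has_sum euler_row q Q a c j) UNIV" for j
  proof -
    define z where "z = - (q powi (a - 4 * int j))"
    have z4: "z * q ^ 4 = - (q powi (a + 4 - 4 * int j))"
    proof -
      have "q powi (a + 4 - 4 * int j) = q powi (a - 4 * int j) * q powi 4"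
        by (rule powi_split) simp
      thus ?thesis by (simp add: z_def)
    qed
    have 1: "q powi (3 * (int j)\<^sup>2 + c * int j) / qpoch Q Q j * ((-z) ^ i * (q ^ 4) ^ (i\<^sup>2) / qpoch Q Q i) = F (i, j)" for i
    proof -
      have "(-z) ^ i = q powi ((a - 4 * int j) * int i)" 
        unfolding z_def minus_minus by (rule power_int_power')
      moreover have "(q ^ 4) ^ (i\<^sup>2) = q powi (4 * (int i)\<^sup>2)" 
      proof -
        have "4 * (int i)\<^sup>2 = int (4 * i\<^sup>2)" by simp
        thus ?thesis by (simp only: power_int_of_nat power_mult)
      qed
      moreover have "q powi E i j = q powi (3 * (int j)\<^sup>2 + c * int j) * (q powi ((a - 4 * int j) * int i) * q powi (4 * (int i)\<^sup>2))"
      proof -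
        have "q powi E i j = q powi (3 * (int j)\<^sup>2 + c * int j) * q powi ((a - 4 * int j) * int i + 4 * (int i)\<^sup>2)"
          by (rule powi_split) (simp add: E_def algebra_simps)
        also have "q powi ((a - 4 * int j) * int i + 4 * (int i)\<^sup>2) = q powi ((a - 4 * int j) * int i) * q powi (4 * (int i)\<^sup>2)"
          by (rule powi_split) simp
        finally show ?thesis .
      qed
      ultimately show ?thesis by (simp add: F_def)
    qed
    have "((\<lambda>i. q powi (3 * (int j)\<^sup>2 + c * int j) / qpoch Q Q j * ((-z) ^ i * (q ^ 4) ^ (i\<^sup>2) / qpoch Q Q i)) has_sum
        q powi (3 * (int j)\<^sup>2 + c * int j) / qpoch Q Q j * qpoch_inf (z * q ^ 4) Q) UNIV"
      using qpoch_Euler[OF q4(1), of z] unfolding q4(2) by (rule has_sum_cmult_right)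
    thus ?thesis unfolding 1 z4 by simp
  qed
  have "((\<lambda>(j, i). F (i, j)) has_sum T) (UNIV \<times> UNIV)"
    using T by (subst (asm) has_sum_swap)
  hence "((\<lambda>j. euler_row q Q a c j) has_sum T) UNIV"
    by (rule has_sum_SigmaD) (simp only: prod.case row)
  hence "T = S" using S by (rule has_sum_unique)
  with T show ?thesis by (simp add: F_def E_def)
qed

lemma double_sum_even_odd:
  fixes a c :: int
  assumes "\<And>i j :: nat. 4 * (int i)\<^sup>2 + 3 * (int j)\<^sup>2 - 4 * int i * int j + a * int i + c * int j
             \<ge> \<bar>2 * int i - int j\<bar> + int j - 2"
    and "((\<lambda>m. euler_row q Q a c (2 * m)) has_sum S) UNIV" "((\<lambda>m. euler_row q Q a c (2 * m + 1)) has_sum T) UNIV"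
  shows "((\<lambda>(i, j). q powi (4 * (int i)\<^sup>2 + 3 * (int j)\<^sup>2 - 4 * int i * int j + a * int i + c * int j)
            / (qpoch Q Q i * qpoch Q Q j)) has_sum S + T) UNIV"
  by (rule double_sum_via_Euler[OF assms(1) has_sum_even_odd[OF assms(2,3)]])

text \<open>Each released factor \<open>1 + q powi (-8 k)\<close> equals
  \<open>q powi (-8 k) * (1 + Q ^ k)\<close>, and the powers add up to the quadratic exponent. The
  symbol with parameter -1 begins with the factor 2, the source of the coefficient 2 in the three
  identities.\<close>

lemma qpoch_inf_down_0:
  "qpoch_inf (- (q powi (- 8 * int m))) Q = q powi (- 4 * int m * (int m + 1)) * (2 * qpoch (-Q) Q m * qpoch_inf (-Q) Q)"
proof (induction m)
  case 0
  show ?case using qpoch_inf_unfold_1[OF norm_Q(1), of "-1"] by simp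
next
  case (Suc m)
  define k where "k = - 8 * int (Suc m)"
  have 1: "q powi k * Q = q powi (- 8 * int m)"
  proof -
    have "q powi (- 8 * int m) = q powi k * q powi 8" by (rule powi_split) (simp add: k_def)
    thus ?thesis by (simp add: Q)
  qed
  have 2: "1 + q powi k = q powi k * (1 + Q * Q ^ m)"
  proof -
    have "q powi 0 = q powi k * q powi (8 * int (Suc m))"
      by (rule powi_split) (simp add: k_def)
    hence "q powi k * (Q * Q ^ m) = 1" unfolding Q_power[symmetric] by simp
    thus ?thesis by (simp only: distrib_left mult_1_right add.commute)
  qed
  have 3: "q powi (- 4 * int (Suc m) * (int (Suc m) + 1)) = q powi k * q powi (- 4 * int m * (int m + 1))"
    by (rule powi_split) (simp add: k_def power2_eq_square algebra_simps)
  have "qpoch_inf (- (q powi k)) Q = (1 + q powi k) * qpoch_inf (- (q powi k * Q)) Q"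
    using qpoch_inf_unfold_1[OF norm_Q(1), of "- (q powi k)"] by simp
  also have "\<dots> = q powi k * (1 + Q * Q ^ m) * (q powi (- 4 * int m * (int m + 1)) * (2 * qpoch (-Q) Q m * qpoch_inf (-Q) Q))"
    unfolding 1 2 Suc ..
  finally have "qpoch_inf (- (q powi k)) Q = \<dots>" .
  moreover have "1 - - Q * Q ^ m = 1 + Q * Q ^ m" by simp
  ultimately show ?case unfolding 3 qpoch_Suc k_def by (simp only: mult_ac)
qed

text \<open>The same descent in the class of 4 modulo 8, where no factor 2 arises.\<close>

lemma qpoch_inf_down_4:
  "qpoch_inf (- (q powi (4 - 8 * int m))) Q = q powi (- 4 * (int m)\<^sup>2) * (qpoch (-(q ^ 4)) Q m * qpoch_inf (-(q ^ 4)) Q)"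
proof (induction m)
  case 0
  show ?case by simp
next
  case (Suc m)
  define k where "k = 4 - 8 * int (Suc m)"
  have 1: "q powi k * Q = q powi (4 - 8 * int m)"
  proof -
    have "q powi (4 - 8 * int m) = q powi k * q powi 8" by (rule powi_split) (simp add: k_def)
    thus ?thesis by (simp add: Q)
  qed
  have 2: "1 + q powi k = q powi k * (1 + q ^ 4 * Q ^ m)"
  proof -
    have "q powi 0 = q powi k * q powi (4 + 8 * int m)"
      by (rule powi_split) (simp add: k_def)
    also have "q powi (4 + 8 * int m) = q powi 4 * q powi (8 * int m)"
      by (rule powi_split) simp
    finally have "q powi k * (q ^ 4 * Q ^ m) = 1" unfolding Q_power[symmetric] by simp
    thus ?thesis by (simp only: distrib_left mult_1_right add.commute)
  qed
  have 3: "q powi (- 4 * (int (Suc m))\<^sup>2) = q powi k * q powi (- 4 * (int m)\<^sup>2)"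
    by (rule powi_split) (simp add: k_def power2_eq_square algebra_simps)
  have "qpoch_inf (- (q powi k)) Q = (1 + q powi k) * qpoch_inf (- (q powi k * Q)) Q"
    using qpoch_inf_unfold_1[OF norm_Q(1), of "- (q powi k)"] by simp
  also have "\<dots> = q powi k * (1 + q ^ 4 * Q ^ m) * (q powi (- 4 * (int m)\<^sup>2) * (qpoch (-(q ^ 4)) Q m * qpoch_inf (-(q ^ 4)) Q))"
    unfolding 1 2 Suc ..
  finally have "qpoch_inf (- (q powi k)) Q = \<dots>" .
  moreover have "1 - - (q ^ 4) * Q ^ m = 1 + q ^ 4 * Q ^ m" by simp
  ultimately show ?case unfolding 3 qpoch_Suc k_def by (simp only: mult_ac)
qed

end

lemma quad_bound: "(u::int)\<^sup>2 \<ge> \<bar>u\<bar>"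
proof (cases "u = 0")
  case False
  hence "\<bar>u\<bar> * 1 \<le> \<bar>u\<bar> * \<bar>u\<bar>" by (intro mult_left_mono) auto
  thus ?thesis by (simp add: power2_eq_square)
qed simp

context
  fixes q Q :: complex
  assumes q: "norm q < 1" "q \<noteq> 0" and Q: "Q = q ^ 8"
begin

lemma powi_eq_powers:
  assumes "k + l = int d + 8 * int n"
  shows "q powi k * q powi l = q ^ d * Q ^ n"
proof -
  have "q powi k * q powi l = q powi (int d + 8 * int n)"
    by (rule powi_split[OF q Q, symmetric]) (simp add: assms)
  also have "\<dots> = q powi int d * q powi (8 * int n)"
    by (rule powi_split[OF q Q]) simp
  finally show ?thesis unfolding Q_power[OF q Q, symmetric] power_int_of_nat .
qed

lemma row_down_4:
  assumes "a + 4 - 4 * int j = 4 - 8 * int m"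
    and "3 * (int j)\<^sup>2 + c * int j + - 4 * (int m)\<^sup>2 = int d + 8 * int n"
  shows "euler_row q Q a c j
       = q ^ d * qpoch_inf (-(q ^ 4)) Q * (Q ^ n * qpoch (-(q ^ 4)) Q m / qpoch Q Q j)"
  unfolding assms(1) qpoch_inf_down_4[OF q Q] mult.assoc[symmetric] powi_eq_powers[OF assms(2)]
  by (simp add: mult_ac)

lemma row_down_0:
  assumes "a + 4 - 4 * int j = - 8 * int m"
    and "3 * (int j)\<^sup>2 + c * int j + - 4 * int m * (int m + 1) = int d + 8 * int n"
  shows "euler_row q Q a c j
       = 2 * q ^ d * qpoch_inf (-Q) Q * (Q ^ n * qpoch (-Q) Q m / qpoch Q Q j)"
  unfolding assms(1) qpoch_inf_down_0[OF q Q] mult.assoc[symmetric] powi_eq_powers[OF assms(2)]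
  by (simp add: mult_ac)

lemmas nq = norm_Q[OF q Q]

lemma rho: "norm (\<i> * q\<^sup>2) < 1" "\<i> * q\<^sup>2 \<noteq> 0" "Q = (\<i> * q\<^sup>2) ^ 4" "(\<i> * q\<^sup>2)\<^sup>2 = - (q ^ 4)"
  using q by (auto simp: norm_mult norm_power power_less_one_iff Q power_mult_distrib simp flip: power_mult)

text \<open>The linear term \<open>-4 i\<close> exchanges the roles of the parities: even
  \<open>j\<close> lead to parameters \<open>-8 m\<close> and to modulus 14, odd \<open>j\<close> to
  modulus 28.\<close>

lemma double_sum_1:
  "((\<lambda>(i, j). q powi (4 * (int i)\<^sup>2 + 3 * (int j)\<^sup>2 - 4 * int i * int j + -4 * int i + 2 * int j)
      / (qpoch Q Q i * qpoch Q Q j)) has_sum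
    (2 * q ^ 0 * qpoch_inf (-Q) Q * (JJ Q 8 14 / qpoch_inf Q Q)
     + q ^ 1 * qpoch_inf (-(q ^ 4)) Q * (JJ (\<i> * q\<^sup>2) 2 14 / qpoch_inf Q Q))) UNIV"
proof (rule double_sum_even_odd[OF q Q])
  fix i j :: nat
  \<comment> \<open>The exponent is \<open>(2 i - j - 1)^2 + 2 j^2 - 1\<close>; the shift inside the
    square and the constant together cause the \<open>- 2\<close> in the bound.\<close>
  have "\<bar>2 * int i - int j - 1\<bar> \<le> (2 * int i - int j - 1)\<^sup>2" "\<bar>int j\<bar> \<le> (int j)\<^sup>2"
    by (rule quad_bound)+
  thus "\<bar>2 * int i - int j\<bar> + int j - 2 \<le>
       4 * (int i)\<^sup>2 + 3 * (int j)\<^sup>2 - 4 * int i * int j + - 4 * int i + 2 * int j"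
    by (simp add: power2_eq_square algebra_simps)
next
  have 1: "euler_row q Q (-4) 2 (2*m)
     = 2 * q ^ 0 * qpoch_inf (-Q) Q * (Q ^ (m\<^sup>2) * qpoch (-Q) Q m / qpoch Q Q (2*m))" for m
    by (rule row_down_0) (simp_all add: power2_eq_square algebra_simps)
  show "((\<lambda>m. euler_row q Q (-4) 2 (2*m))
     has_sum 2 * q ^ 0 * qpoch_inf (-Q) Q * (JJ Q 8 14 / qpoch_inf Q Q)) UNIV"
    unfolding 1 by (intro has_sum_cmult_right Slater_14_a nq)
  \<comment> \<open>For \<open>j = 2 m + 1\<close> the parameter is
    \<open>-4 - 8 m = 4 - 8 (m + 1)\<close>, hence the index \<open>Suc m\<close>.\<close>
  have 2: "euler_row q Q (-4) 2 (2*m+1)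
     = q ^ 1 * qpoch_inf (-(q^4)) Q * (Q ^ (m\<^sup>2 + m) * qpoch (-(q^4)) Q (Suc m) / qpoch Q Q (2*m+1))" for m
    by (rule row_down_4) (simp_all add: power2_eq_square algebra_simps)
  show "((\<lambda>m. euler_row q Q (-4) 2 (2*m+1))
     has_sum q ^ 1 * qpoch_inf (-(q ^ 4)) Q * (JJ (\<i> * q\<^sup>2) 2 14 / qpoch_inf Q Q)) UNIV"
    unfolding 2 using Slater_28_c[OF rho(1-3)] unfolding rho(4) by (rule has_sum_cmult_right)
qed

lemma double_sum_2:
  "((\<lambda>(i, j). q powi (4 * (int i)\<^sup>2 + 3 * (int j)\<^sup>2 - 4 * int i * int j + 0 * int i + 0 * int j)
      / (qpoch Q Q i * qpoch Q Q j)) has_sum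
    (q ^ 0 * qpoch_inf (-(q ^ 4)) Q * (JJ (\<i> * q\<^sup>2) 8 14 / qpoch_inf Q Q)
      + 2 * q ^ 3 * qpoch_inf (-Q) Q * (JJ Q 4 14 / qpoch_inf Q Q))) UNIV"
proof (rule double_sum_even_odd[OF q Q])
  fix i j :: nat
  have "\<bar>2 * int i - int j\<bar> \<le> (2 * int i - int j)\<^sup>2" "\<bar>int j\<bar> \<le> (int j)\<^sup>2"
    by (rule quad_bound)+
  thus "\<bar>2 * int i - int j\<bar> + int j - 2 \<le>
       4 * (int i)\<^sup>2 + 3 * (int j)\<^sup>2 - 4 * int i * int j + 0 * int i + 0 * int j"
    by (simp add: power2_eq_square algebra_simps)
next
  have 1: "euler_row q Q 0 0 (2*m)
     = q ^ 0 * qpoch_inf (-(q^4)) Q * (Q ^ (m\<^sup>2) * qpoch (-(q^4)) Q m / qpoch Q Q (2*m))" for m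
    by (rule row_down_4) (simp_all add: power2_eq_square algebra_simps)
  show "((\<lambda>m. euler_row q Q 0 0 (2*m))
     has_sum q ^ 0 * qpoch_inf (-(q ^ 4)) Q * (JJ (\<i> * q\<^sup>2) 8 14 / qpoch_inf Q Q)) UNIV"
    unfolding 1 using Slater_28_a[OF rho(1-3)] unfolding rho(4) by (rule has_sum_cmult_right)
  have 2: "euler_row q Q 0 0 (2*m+1)
     = 2 * q ^ 3 * qpoch_inf (-Q) Q * (Q ^ (m\<^sup>2 + m) * qpoch (-Q) Q m / qpoch Q Q (2*m+1))" for m
    by (rule row_down_0) (simp_all add: power2_eq_square algebra_simps)
  show "((\<lambda>m. euler_row q Q 0 0 (2*m+1))
     has_sum 2 * q ^ 3 * qpoch_inf (-Q) Q * (JJ Q 4 14 / qpoch_inf Q Q)) UNIV"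
    unfolding 2 by (intro has_sum_cmult_right Slater_14_b nq)
qed

lemma double_sum_3:
  "((\<lambda>(i, j). q powi (4 * (int i)\<^sup>2 + 3 * (int j)\<^sup>2 - 4 * int i * int j + 0 * int i + 4 * int j)
      / (qpoch Q Q i * qpoch Q Q j)) has_sum
    (q ^ 0 * qpoch_inf (-(q ^ 4)) Q * (JJ (\<i> * q\<^sup>2) 4 14 / qpoch_inf Q Q)
      + 2 * q ^ 7 * qpoch_inf (-Q) Q * (JJ Q 2 14 / qpoch_inf Q Q))) UNIV"
proof (rule double_sum_even_odd[OF q Q])
  fix i j :: nat
  have "\<bar>2 * int i - int j\<bar> \<le> (2 * int i - int j)\<^sup>2" "\<bar>int j\<bar> \<le> (int j)\<^sup>2"
    by (rule quad_bound)+
  thus "\<bar>2 * int i - int j\<bar> + int j - 2 \<le>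
       4 * (int i)\<^sup>2 + 3 * (int j)\<^sup>2 - 4 * int i * int j + 0 * int i + 4 * int j"
    by (simp add: power2_eq_square algebra_simps)
next
  have 1: "euler_row q Q 0 4 (2*m)
     = q ^ 0 * qpoch_inf (-(q^4)) Q * (Q ^ (m\<^sup>2 + m) * qpoch (-(q^4)) Q m / qpoch Q Q (2*m))" for m
    by (rule row_down_4) (simp_all add: power2_eq_square algebra_simps)
  show "((\<lambda>m. euler_row q Q 0 4 (2*m))
     has_sum q ^ 0 * qpoch_inf (-(q ^ 4)) Q * (JJ (\<i> * q\<^sup>2) 4 14 / qpoch_inf Q Q)) UNIV"
    unfolding 1 using Slater_28_b[OF rho(1-3)] unfolding rho(4) by (rule has_sum_cmult_right)
  have 2: "euler_row q Q 0 4 (2*m+1)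
     = 2 * q ^ 7 * qpoch_inf (-Q) Q * (Q ^ (m\<^sup>2 + 2 * m) * qpoch (-Q) Q m / qpoch Q Q (2*m+1))" for m
    by (rule row_down_0) (simp_all add: power2_eq_square algebra_simps)
  show "((\<lambda>m. euler_row q Q 0 4 (2*m+1))
     has_sum 2 * q ^ 7 * qpoch_inf (-Q) Q * (JJ Q 2 14 / qpoch_inf Q Q)) UNIV"
    unfolding 2 by (intro has_sum_cmult_right Slater_14_c nq)
qed

lemma JJ_Q: "JJ Q a 14 = JJ q (8 * a) 112"
proof -
  have "Q ^ k = q ^ (8 * k)" for k by (simp add: Q power_mult)
  moreover have "8 * (14 - a) = 112 - 8 * a" by simp
  ultimately show ?thesis unfolding JJ_def by simp
qed

lemma JJ_p: "JJ (q ^ 4) a 28 = JJ q (4 * a) 112"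
proof -
  have "(q ^ 4) ^ k = q ^ (4 * k)" for k by (simp add: power_mult)
  moreover have "4 * (28 - a) = 112 - 4 * a" by simp
  ultimately show ?thesis unfolding JJ_def by simp
qed

lemma J_p: "J (q ^ 4) m = J q (4 * m)"
  by (simp add: J_def flip: power_mult)

lemma J8: "qpoch_inf Q Q = J q 8"
  by (simp add: J_def Q)

text \<open>The quotient of \<open>J q 16\<close> by one \<open>J q 8\<close> is
  \<open>(-Q;Q)\<close>; the second \<open>J q 8\<close> is the denominator of the Slater type
  series.\<close>

lemma plus_product: "qpoch_inf (-Q) Q * (y / qpoch_inf Q Q) = J q 16 * y / (J q 8)\<^sup>2"
proof -
  have nz: "J q 8 \<noteq> 0" using qpoch_inf_nonzero[OF nq(1) nq(1)] by (simp add: J8)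
  have "J q 8 * qpoch_inf (-Q) Q = J q 16"
    using qpoch_inf_mult_uminus[OF nq(1), of Q] unfolding J8 by (simp add: J_def Q flip: power_mult)
  hence "qpoch_inf (-Q) Q = J q 16 / J q 8" using nz by (simp add: field_simps)
  thus ?thesis by (simp add: J8 power2_eq_square)
qed

lemma p4: "norm (q ^ 4) < 1" "(q ^ 4)\<^sup>2 = Q"
  using q by (auto simp: norm_power power_less_one_iff Q simp flip: power_mult)

lemma product_112_a:
  "qpoch_inf (-(q ^ 4)) Q * (JJ (\<i> * q\<^sup>2) 8 14 / qpoch_inf Q Q) =
     J q 8 * (J q 56)\<^sup>2 * J q 112 * JJ q 24 112 * JJ q 40 112
       / (J q 4 * JJ q 12 112 * JJ q 28 112 * JJ q 32 112 * JJ q 44 112 * JJ q 48 112)"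
proof -
  have "JJ (\<i> * q\<^sup>2) 8 14 = JJ (\<i> * q\<^sup>2) 6 14" by (simp add: JJ_def mult_ac)
  thus ?thesis using product_28_a[OF p4(1) rho(4)] unfolding p4(2) J_p JJ_p J8
    by (simp add: mult.assoc)
qed

lemma product_112_b:
  "qpoch_inf (-(q ^ 4)) Q * (JJ (\<i> * q\<^sup>2) 4 14 / qpoch_inf Q Q) =
     J q 8 * (J q 56)\<^sup>2 * J q 112 * JJ q 8 112 * JJ q 40 112
       / (J q 4 * JJ q 16 112 * JJ q 20 112 * JJ q 28 112 * JJ q 32 112 * JJ q 36 112)"
proof -
  have "JJ (\<i> * q\<^sup>2) 4 14 = JJ (\<i> * q\<^sup>2) 10 14" by (simp add: JJ_def mult_ac)
  thus ?thesis using product_28_b[OF p4(1) rho(4)] unfolding p4(2) J_p JJ_p J8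
    by (simp add: mult.assoc)
qed

lemma product_112_c:
  "qpoch_inf (-(q ^ 4)) Q * (JJ (\<i> * q\<^sup>2) 2 14 / qpoch_inf Q Q) =
     J q 8 * (J q 56)\<^sup>2 * J q 112 * JJ q 8 112 * JJ q 24 112
       / (J q 4 * JJ q 4 112 * JJ q 16 112 * JJ q 28 112 * JJ q 48 112 * JJ q 52 112)"
  using product_28_c[OF p4(1) rho(4)] unfolding p4(2) J_p JJ_p J8
  by (simp add: mult.assoc)

end

section \<open>The three identities for the double sums\<close>

definition "rhs1 q = 2 * (J q 16 * JJ q 48 112 / (J q 8)^2)
          + q * (J q 8 * (J q 56)^2 * J q 112 * JJ q 8 112 * JJ q 24 112
                 / (J q 4 * JJ q 4 112 * JJ q 16 112 * JJ q 28 112 * JJ q 48 112 * JJ q 52 112))"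

definition "rhs2 q = J q 8 * (J q 56)^2 * J q 112 * JJ q 24 112 * JJ q 40 112
            / (J q 4 * JJ q 12 112 * JJ q 28 112 * JJ q 32 112 * JJ q 44 112 * JJ q 48 112)
          + 2 * q^3 * (J q 16 * JJ q 32 112 / (J q 8)^2)"

definition "rhs3 q = J q 8 * (J q 56)^2 * J q 112 * JJ q 8 112 * JJ q 40 112
            / (J q 4 * JJ q 16 112 * JJ q 20 112 * JJ q 28 112 * JJ q 32 112 * JJ q 36 112)
          + 2 * q^7 * (J q 16 * JJ q 16 112 / (J q 8)^2)"

lemma qpoch_inf_0 [simp]: "qpoch_inf 0 q = 1"
  by (simp add: qpoch_inf_def)

lemma J_0 [simp]: "m > 0 \<Longrightarrow> J 0 m = 1"
  by (simp add: J_def power_0_left)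

lemma JJ_0 [simp]: "0 < a \<Longrightarrow> a < m \<Longrightarrow> JJ 0 a m = 1"
  by (simp add: JJ_def power_0_left)

lemma qpoch_0_left [simp]: "qpoch 0 q n = 1"
  by (simp add: qpoch_def)

text \<open>At \<open>q = 0\<close> all symbols are 1, and an integer power of 0 is 1 for exponent 0
  and 0 for every other exponent, including negative ones. The sum therefore counts the zeros of the
  exponent.\<close>

lemma double_sum_0:
  fixes E :: "nat \<Rightarrow> nat \<Rightarrow> int"
  assumes "finite B" "\<And>i j. E i j = 0 \<longleftrightarrow> (i, j) \<in> B"
  shows "((\<lambda>(i, j). 0 powi (E i j) / (qpoch (0^8) (0^8) i * qpoch (0^8) (0^8) j)) has_sum of_nat (card B)) UNIV"
proof (rule has_sum_finite_neutralI[OF assms(1)])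
  show "of_nat (card B) = (\<Sum>x\<in>B. case x of (i, j) \<Rightarrow> 0 powi (E i j) / (qpoch (0^8) (0^8) i * qpoch (0^8) (0^8) j))"
  proof -
    have "(\<Sum>x\<in>B. case x of (i, j) \<Rightarrow> 0 powi (E i j) / (qpoch (0^8) (0^8) i * qpoch (0^8) (0^8) j)) = (\<Sum>x\<in>B. 1)"
      using assms(2) by (intro sum.cong) (auto simp: power_int_0_left_if)
    thus ?thesis by simp
  qed
qed (use assms(2) in \<open>auto simp: power_int_0_left_if\<close>)

theorem Nahm_identity_1:
  assumes "norm q < 1"
  shows "((\<lambda>(i, j). q powi (4 * (int i)^2 + 3 * (int j)^2 - 4 * int i * int j - 4 * int i + 2 * int j)
             / (qpoch (q^8) (q^8) i * qpoch (q^8) (q^8) j)) has_sum rhs1 q) UNIV"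
proof (cases "q = 0")
  case False
  note q = assms False
  have j: "JJ (q ^ 8) 8 14 = JJ q 48 112"
    using JJ_Q[OF q refl, of 8] by (simp add: JJ_def mult_ac)
  have "2 * q ^ 0 * qpoch_inf (-(q ^ 8)) (q ^ 8) * (JJ (q ^ 8) 8 14 / qpoch_inf (q ^ 8) (q ^ 8))
     + q ^ 1 * qpoch_inf (-(q ^ 4)) (q ^ 8) * (JJ (\<i> * q\<^sup>2) 2 14 / qpoch_inf (q ^ 8) (q ^ 8)) = rhs1 q"
    unfolding j mult.assoc plus_product[OF q refl] product_112_c[OF q refl] rhs1_def by simp
  with double_sum_1[OF q refl] show ?thesis by simp
next
  case [simp]: True
  \<comment> \<open>Two zeros, in agreement with the value 2 of the right-hand side at
    \<open>q = 0\<close>.\<close>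
  have "4 * (int i)^2 + 3 * (int j)^2 - 4 * int i * int j - 4 * int i + 2 * int j = 0 \<longleftrightarrow> (i, j) \<in> {(0, 0), (1, 0)}" (is "?E = 0 \<longleftrightarrow> _") for i j
  proof
    assume "?E = 0"
    hence *: "(2 * int i - int j - 1)\<^sup>2 + 2 * (int j)\<^sup>2 = 1"
      by (simp add: power2_eq_square algebra_simps)
    have "int j = 0"
    proof (rule ccontr)
      assume "int j \<noteq> 0"
      hence "(int j)\<^sup>2 \<ge> 1" using quad_bound[of "int j"] by linarith
      thus False using * zero_le_power2[of "2 * int i - int j - 1"] by linarith
    qed
    moreover from this * have "2 * int i - 1 = 1 \<or> 2 * int i - 1 = -1"
      by (simp add: power2_eq_1_iff)
    ultimately show "(i, j) \<in> {(0, 0), (1, 0)}" by auto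
  qed auto
  from double_sum_0[OF _ this] show ?thesis by (simp add: rhs1_def)
qed

theorem Nahm_identity_2:
  assumes "norm q < 1"
  shows "((\<lambda>(i, j). q powi (4 * (int i)^2 + 3 * (int j)^2 - 4 * int i * int j)
             / (qpoch (q^8) (q^8) i * qpoch (q^8) (q^8) j)) has_sum rhs2 q) UNIV"
proof (cases "q = 0")
  case False
  note q = assms False
  have j: "JJ (q ^ 8) 4 14 = JJ q 32 112"
    using JJ_Q[OF q refl, of 4] by simp
  have "q ^ 0 * qpoch_inf (-(q ^ 4)) (q ^ 8) * (JJ (\<i> * q\<^sup>2) 8 14 / qpoch_inf (q ^ 8) (q ^ 8))
      + 2 * q ^ 3 * qpoch_inf (-(q ^ 8)) (q ^ 8) * (JJ (q ^ 8) 4 14 / qpoch_inf (q ^ 8) (q ^ 8)) = rhs2 q"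
    unfolding j mult.assoc plus_product[OF q refl] product_112_a[OF q refl] rhs2_def by simp
  with double_sum_2[OF q refl] show ?thesis by simp
next
  case [simp]: True
  have "4 * (int i)^2 + 3 * (int j)^2 - 4 * int i * int j = 0 \<longleftrightarrow> (i, j) \<in> {(0, 0)}" (is "?E = 0 \<longleftrightarrow> _") for i j
  proof
    assume "?E = 0"
    hence *: "(2 * int i - int j)\<^sup>2 + 2 * (int j)\<^sup>2 = 0"
      by (simp add: power2_eq_square algebra_simps)
    hence "(2 * int i - int j)\<^sup>2 = 0 \<and> (int j)\<^sup>2 = 0"
      using zero_le_power2[of "2 * int i - int j"] zero_le_power2[of "int j"] by linarith
    thus "(i, j) \<in> {(0, 0)}" by auto
  qed auto
  from double_sum_0[OF _ this] show ?thesis by (simp add: rhs2_def)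
qed

theorem Nahm_identity_3:
  assumes "norm q < 1"
  shows "((\<lambda>(i, j). q powi (4 * (int i)^2 + 3 * (int j)^2 - 4 * int i * int j + 4 * int j)
             / (qpoch (q^8) (q^8) i * qpoch (q^8) (q^8) j)) has_sum rhs3 q) UNIV"
proof (cases "q = 0")
  case False
  note q = assms False
  have j: "JJ (q ^ 8) 2 14 = JJ q 16 112"
    using JJ_Q[OF q refl, of 2] by simp
  have "q ^ 0 * qpoch_inf (-(q ^ 4)) (q ^ 8) * (JJ (\<i> * q\<^sup>2) 4 14 / qpoch_inf (q ^ 8) (q ^ 8))
      + 2 * q ^ 7 * qpoch_inf (-(q ^ 8)) (q ^ 8) * (JJ (q ^ 8) 2 14 / qpoch_inf (q ^ 8) (q ^ 8)) = rhs3 q"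
    unfolding j mult.assoc plus_product[OF q refl] product_112_b[OF q refl] rhs3_def by simp
  with double_sum_3[OF q refl] show ?thesis by simp
next
  case [simp]: True
  have "4 * (int i)^2 + 3 * (int j)^2 - 4 * int i * int j + 4 * int j = 0 \<longleftrightarrow> (i, j) \<in> {(0, 0)}" (is "?E = 0 \<longleftrightarrow> _") for i j
  proof
    assume "?E = 0"
    hence *: "(2 * int i - int j)\<^sup>2 + 2 * (int j)\<^sup>2 + 4 * int j = 0"
      by (simp add: power2_eq_square algebra_simps)
    hence "(2 * int i - int j)\<^sup>2 = 0 \<and> (int j) = 0"
      using zero_le_power2[of "2 * int i - int j"] zero_le_power2[of "int j"] by linarith
    thus "(i, j) \<in> {(0, 0)}" by auto
  qed auto
  from double_sum_0[OF _ this] show ?thesis by (simp add: rhs3_def)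
qed

section \<open>Klein forms\<close>

definition e2pi :: "complex \<Rightarrow> complex" where
  "e2pi x = exp (2 * of_real pi * \<i> * x)"

definition sg :: "int \<Rightarrow> complex" where
  "sg k = (if even k then 1 else -1)"

lemma sg_add: "sg (m + n) = sg m * sg n"
  by (simp add: sg_def)

lemma sg_0 [simp]: "sg 0 = 1" and sg_1 [simp]: "sg 1 = -1" and sg_minus [simp]: "sg (-k) = sg k"
  by (simp_all add: sg_def)

lemma e2pi_0 [simp]: "e2pi 0 = 1"
  by (simp add: e2pi_def)

lemma e2pi_nonzero [simp]: "e2pi x \<noteq> 0"
  by (simp add: e2pi_def)

lemma e2pi_add: "e2pi (x + y) = e2pi x * e2pi y"
  by (simp add: e2pi_def distrib_left exp_add)

lemma e2pi_diff: "e2pi (x - y) = e2pi x / e2pi y"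
  by (simp add: e2pi_def right_diff_distrib exp_diff)

lemma e2pi_minus: "e2pi (- x) = inverse (e2pi x)"
  by (simp add: e2pi_def exp_minus)

lemma e2pi_of_nat_mult: "e2pi (of_nat n * x) = e2pi x ^ n"
  by (induction n) (simp_all add: e2pi_add distrib_right)

lemma e2pi_half_int: "e2pi (of_int k / 2) = sg k"
proof (cases "even k")
  case True
  then obtain m where "k = 2 * m" by blast
  thus ?thesis by (simp add: e2pi_def sg_def exp_eq_1)
next
  case False
  then obtain m where k: "k = 2 * m + 1" using oddE by blast
  have "e2pi (of_int k / 2) = e2pi (of_int m) * e2pi (1/2)"
    unfolding e2pi_add[symmetric] k by (simp add: field_simps)
  moreover have "e2pi (of_int m) = 1" by (simp add: e2pi_def exp_eq_1)
  moreover have "e2pi (1/2) = -1" by (simp add: e2pi_def)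
  ultimately show ?thesis using k by (simp add: sg_def)
qed

lemma e2pi_of_int: "e2pi (of_int k) = 1"
  using e2pi_half_int[of "2 * k"] by (simp add: sg_def)

lemma e2pi_1: "e2pi 1 = 1" 
  using e2pi_of_int[of 1] by simp

lemma e2pi_eq_1_iff: "e2pi x = 1 \<longleftrightarrow> (\<exists>n::int. x = of_int n)"
proof
  assume "e2pi x = 1"
  then obtain n :: int where "Re x = of_int n" "Im x = 0"
    by (auto simp: e2pi_def exp_eq_1)
  hence "x = of_int n" by (simp add: complex_eq_iff)
  thus "\<exists>n::int. x = of_int n" ..
qed (auto simp: e2pi_of_int)

lemma norm_e2pi: "norm (e2pi x) = exp (- 2 * pi * Im x)"
  by (simp add: e2pi_def)

lemma norm_e2pi_less_1: "Im \<tau> > 0 \<Longrightarrow> norm (e2pi \<tau>) < 1"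
  by (simp add: norm_e2pi)

lemma e2pi_DERIV [derivative_intros]:
  "(f has_field_derivative f') (at x within S) \<Longrightarrow>
   ((\<lambda>x. e2pi (f x)) has_field_derivative (2 * of_real pi * \<i> * f' * e2pi (f x))) (at x within S)"
  unfolding e2pi_def by (auto intro!: derivative_eq_intros)

lemma e2pi_holomorphic [holomorphic_intros]:
  "f holomorphic_on S \<Longrightarrow> (\<lambda>x. e2pi (f x)) holomorphic_on S"
  unfolding e2pi_def by (intro holomorphic_intros)

text \<open>Up to a factor \<open>-2\<pi>i\<close>, this is \<open>\<theta>\<^sub>1(z) / \<theta>\<^sub>1'(0)\<close>.\<close>

definition phi :: "complex \<Rightarrow> complex \<Rightarrow> complex" where
  "phi z \<tau> = e2pi (- z / 2) * qpoch_inf (e2pi z) (e2pi \<tau>) * qpoch_inf (e2pi (\<tau> - z)) (e2pi \<tau>)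
               / (qpoch_inf (e2pi \<tau>) (e2pi \<tau>))\<^sup>2"

context
  fixes \<tau> :: complex
  assumes \<tau>: "Im \<tau> > 0"
begin

lemma phi_holomorphic: "(\<lambda>z. phi z \<tau>) holomorphic_on S"
proof -
  have "(\<lambda>z. qpoch_inf (e2pi z) (e2pi \<tau>)) holomorphic_on UNIV"
       "(\<lambda>z. qpoch_inf (e2pi (\<tau> - z)) (e2pi \<tau>)) holomorphic_on UNIV"
    by (rule holomorphic_on_qpoch_inf; (intro holomorphic_intros norm_e2pi_less_1 \<tau>)?; simp)+
  hence "(\<lambda>z. phi z \<tau>) holomorphic_on UNIV"
    unfolding phi_def using qpoch_inf_nonzero[OF norm_e2pi_less_1 norm_e2pi_less_1, OF \<tau> \<tau>]
    by (intro holomorphic_intros) auto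
  thus ?thesis using holomorphic_on_subset by blast
qed

lemma phi_add_1: "phi (z + 1) \<tau> = - phi z \<tau>"
proof -
  have "e2pi (- (z + 1) / 2) = - e2pi (- z / 2)"
  proof -
    have "e2pi (- (z + 1) / 2) = e2pi (- z / 2) * e2pi (of_int (-1) / 2)"
      unfolding e2pi_add[symmetric] by (simp add: field_simps)
    thus ?thesis by (simp only: e2pi_half_int sg_minus sg_1) simp
  qed
  moreover have "e2pi (z + 1) = e2pi z" by (simp add: e2pi_add e2pi_1)
  moreover have "e2pi (\<tau> - (z + 1)) = e2pi (\<tau> - z)" by (simp add: e2pi_add e2pi_1 e2pi_diff)
  ultimately show ?thesis by (simp add: phi_def)
qed

text \<open>The period \<open>\<tau>\<close> moves one symbol forward and the other backward by one
  factor. With these factors split off, both sides share the remainder \<open>R\<close>.\<close>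

lemma phi_add_tau: "phi (z + \<tau>) \<tau> = - e2pi (- \<tau> / 2 - z) * phi z \<tau>"
proof -
  define R where "R = qpoch_inf (e2pi z * e2pi \<tau>) (e2pi \<tau>) * qpoch_inf (e2pi (- z) * e2pi \<tau>) (e2pi \<tau>)
                        / (qpoch_inf (e2pi \<tau>) (e2pi \<tau>))\<^sup>2"
  note unf = qpoch_inf_unfold_1[OF norm_e2pi_less_1[OF \<tau>]]
  have h: "e2pi (z + \<tau>) = e2pi z * e2pi \<tau>" "e2pi (\<tau> - z) = e2pi (- z) * e2pi \<tau>" "e2pi (\<tau> - (z + \<tau>)) = e2pi (- z)"
    by (simp_all flip: e2pi_add)
  have 1: "phi z \<tau> = e2pi (- z / 2) * (1 - e2pi z) * R"
    unfolding phi_def unf[of "e2pi z"] R_def h by simp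
  have 2: "phi (z + \<tau>) \<tau> = e2pi (- (z + \<tau>) / 2) * (1 - e2pi (- z)) * R"
    unfolding phi_def R_def h unf[of "e2pi (- z)"] by simp
  have 3: "1 - e2pi (- z) = - e2pi (- z) * (1 - e2pi z)"
    by (simp add: e2pi_minus field_simps)
  have 4: "e2pi (- (z + \<tau>) / 2) * e2pi (- z) = e2pi (- \<tau> / 2 - z) * e2pi (- z / 2)"
    unfolding e2pi_add[symmetric] by (rule arg_cong[where f = e2pi]) (simp add: field_simps)
  have "phi (z + \<tau>) \<tau> = - (e2pi (- (z + \<tau>) / 2) * e2pi (- z)) * (1 - e2pi z) * R"
    unfolding 2 3 by simp
  thus ?thesis unfolding 4 1 by simp
qed

lemma phi_add_int: "phi (z + of_int n) \<tau> = sg n * phi z \<tau>"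
proof (induction n rule: int_induct[where k = 0])
  case base thus ?case by simp
next
  case (step1 i)
  have "phi (z + of_int (i + 1)) \<tau> = phi (z + of_int i + 1) \<tau>" by (simp add: add_ac)
  thus ?case unfolding phi_add_1 step1 sg_add by simp
next
  case (step2 i)
  have "phi (z + of_int i) \<tau> = phi (z + of_int (i - 1) + 1) \<tau>" by simp
  hence "sg i * phi z \<tau> = - phi (z + of_int (i - 1)) \<tau>"
    unfolding phi_add_1 step2 .
  moreover have "sg (i - 1) = - sg i" by (simp add: sg_def)
  ultimately show ?case by simp
qed

lemma phi_add_tau_int: "phi (z + of_int m * \<tau>) \<tau> = sg m * e2pi (- (of_int m)\<^sup>2 * \<tau> / 2 - of_int m * z) * phi z \<tau>"
proof -
  define E where "E = (\<lambda>m::int. e2pi (- (of_int m)\<^sup>2 * \<tau> / 2 - of_int m * z))"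
  have E: "E (i + 1) = e2pi (- \<tau> / 2 - (z + of_int i * \<tau>)) * E i" for i
    unfolding E_def e2pi_add[symmetric] by (rule arg_cong[where f = e2pi]) (simp add: field_simps power2_eq_square)
  have step: "phi (z + of_int (i + 1) * \<tau>) \<tau> = - e2pi (- \<tau> / 2 - (z + of_int i * \<tau>)) * phi (z + of_int i * \<tau>) \<tau>" for i
    using phi_add_tau[of "z + of_int i * \<tau>"] by (simp add: algebra_simps)
  have "phi (z + of_int m * \<tau>) \<tau> = sg m * E m * phi z \<tau>"
  proof (induction m rule: int_induct[where k = 0])
    case base thus ?case by (simp add: E_def)
  next
    case (step1 i)
    thus ?case unfolding step E sg_add step1 by simp
  next
    case (step2 i)
    have s: "sg i = - sg (i - 1)" by (simp add: sg_def)
    have "e2pi (- \<tau> / 2 - (z + of_int (i - 1) * \<tau>)) * phi (z + of_int (i - 1) * \<tau>) \<tau>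
        = e2pi (- \<tau> / 2 - (z + of_int (i - 1) * \<tau>)) * (sg (i - 1) * E (i - 1) * phi z \<tau>)"
      using step[of "i - 1"] E[of "i - 1"] step2 s by (simp add: mult_ac)
    thus ?case using mult_left_cancel[OF e2pi_nonzero] by blast
  qed
  thus ?thesis by (simp add: E_def)
qed

lemma phi_lattice:
  "phi (z + of_int m * \<tau> + of_int n) \<tau> = sg (m + n) * e2pi (- (of_int m)\<^sup>2 * \<tau> / 2 - of_int m * z) * phi z \<tau>"
  unfolding phi_add_int phi_add_tau_int sg_add by simp

lemma phi_0 [simp]: "phi 0 \<tau> = 0"
proof -
  have "qpoch_inf 1 (e2pi \<tau>) = 0"
    using qpoch_inf_unfold_1[OF norm_e2pi_less_1[OF \<tau>], of 1] by simp
  thus ?thesis by (simp add: phi_def)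
qed

lemma phi_eq_0D:
  assumes "phi z \<tau> = 0"
  obtains m n :: int where "z = of_int m * \<tau> + of_int n"
proof -
  note q = norm_e2pi_less_1[OF \<tau>]
  have "qpoch_inf (e2pi z) (e2pi \<tau>) = 0 \<or> qpoch_inf (e2pi (\<tau> - z)) (e2pi \<tau>) = 0"
    using assms qpoch_inf_nonzero[OF q q] by (auto simp: phi_def)
  then obtain k where "e2pi z * e2pi \<tau> ^ k = 1 \<or> e2pi (\<tau> - z) * e2pi \<tau> ^ k = 1"
    using qpoch_inf_nonzero_iff[OF q] by blast
  hence "e2pi (z + of_nat k * \<tau>) = 1 \<or> e2pi (\<tau> - z + of_nat k * \<tau>) = 1"
    by (simp add: e2pi_add e2pi_of_nat_mult)
  then consider n :: int where "z + of_nat k * \<tau> = of_int n" | n :: int where "\<tau> - z + of_nat k * \<tau> = of_int n"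
    by (auto simp: e2pi_eq_1_iff)
  thus ?thesis
  proof cases
    case 1
    hence "z = of_int (- int k) * \<tau> + of_int n" by (simp add: algebra_simps)
    thus ?thesis by (rule that)
  next
    case 2
    hence "z = of_int (int k + 1) * \<tau> + of_int (- n)" by (simp add: algebra_simps)
    thus ?thesis by (rule that)
  qed
qed

text \<open>The denominator of \<open>phi\<close> is chosen such that this value is independent of
  \<open>\<tau>\<close>, so no unknown constant enters the transformation law. The factor
  \<open>1 - e2pi z\<close> carries the zero, and the cofactor \<open>R\<close> is 1 at 0.\<close>

lemma phi_DERIV_0: "((\<lambda>z. phi z \<tau>) has_field_derivative (- 2 * of_real pi * \<i>)) (at 0)"
proof -
  note q = norm_e2pi_less_1[OF \<tau>]
  define R where "R = (\<lambda>z. e2pi (- z / 2) * (qpoch_inf (e2pi (z + \<tau>)) (e2pi \<tau>) * qpoch_inf (e2pi (\<tau> - z)) (e2pi \<tau>)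
                        / (qpoch_inf (e2pi \<tau>) (e2pi \<tau>))\<^sup>2))"
  have nz: "qpoch_inf (e2pi \<tau>) (e2pi \<tau>) \<noteq> 0" using qpoch_inf_nonzero[OF q q] .
  have "(\<lambda>z. qpoch_inf (e2pi (z + \<tau>)) (e2pi \<tau>)) holomorphic_on UNIV"
       "(\<lambda>z. qpoch_inf (e2pi (\<tau> - z)) (e2pi \<tau>)) holomorphic_on UNIV"
    by (rule holomorphic_on_qpoch_inf; (intro holomorphic_intros q)?; simp)+
  hence "R holomorphic_on UNIV"
    unfolding R_def using nz by (intro holomorphic_intros) auto
  hence "(R has_field_derivative deriv R 0) (at 0)"
    using holomorphic_derivI by blast
  hence "((\<lambda>z. R z * (1 - e2pi z)) has_field_derivative (- 2 * of_real pi * \<i>) * R 0) (at 0)"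
    by (auto intro!: derivative_eq_intros)
  moreover have "R 0 = 1" using nz by (simp add: R_def power2_eq_square)
  moreover have "(\<lambda>z. R z * (1 - e2pi z)) = (\<lambda>z. phi z \<tau>)"
  proof
    fix z
    have "qpoch_inf (e2pi z) (e2pi \<tau>) = (1 - e2pi z) * qpoch_inf (e2pi (z + \<tau>)) (e2pi \<tau>)"
      unfolding e2pi_add by (rule qpoch_inf_unfold_1[OF q])
    thus "R z * (1 - e2pi z) = phi z \<tau>" unfolding R_def phi_def by simp
  qed
  ultimately show ?thesis by simp
qed

lemma phi_eventually_nonzero: "eventually (\<lambda>z. phi z \<tau> \<noteq> 0) (at 0)"
proof -
  have "((\<lambda>z. phi z \<tau> / z) \<longlongrightarrow> - 2 * of_real pi * \<i>) (at 0)"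
    using phi_DERIV_0 by (simp add: has_field_derivative_iff)
  hence "eventually (\<lambda>z. phi z \<tau> / z \<noteq> 0) (at 0)"
    by (rule tendsto_imp_eventually_ne) simp
  thus ?thesis by eventually_elim auto
qed

end

text \<open>For integers \<open>M\<close>, \<open>N\<close> the number \<open>M + N + M N\<close> is
  even exactly if both are even, a condition preserved by matrices that are invertible modulo 2.
  Hence the signs of the quasi-periods do not depend on the basis of the lattice.\<close>

lemma unimodular_parity:
  fixes a b c d m n :: int
  assumes "a * d - b * c = 1"
  shows "sg ((d * m - c * n) + (a * n - b * m)) * sg ((d * m - c * n) * (a * n - b * m) - m * n) = sg (m + n)"
proof -
  have "odd (a * d - b * c)" using assms by simp
  thus ?thesis unfolding sg_add[symmetric] sg_def
    by (cases "even a"; cases "even b"; cases "even c"; cases "even d"; cases "even m"; cases "even n"; simp)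
qed

abbreviation mob :: "int \<Rightarrow> int \<Rightarrow> int \<Rightarrow> int \<Rightarrow> complex \<Rightarrow> complex" where
  "mob a b c d \<tau> \<equiv> (of_int a * \<tau> + of_int b) / (of_int c * \<tau> + of_int d)"

lemma Im_moebius_pos:
  fixes a b c d :: int
  assumes "a * d - b * c = 1" "Im \<tau> > 0"
  shows "of_int c * \<tau> + of_int d \<noteq> 0"
    and "Im (mob a b c d \<tau>) > 0"
proof -
  show nz: "of_int c * \<tau> + of_int d \<noteq> 0"
  proof
    assume 0: "of_int c * \<tau> + of_int d = 0"
    hence "Im (of_int c * \<tau> + of_int d) = 0" by simp
    hence "c = 0" using assms by simp
    with 0 have "d = 0" by simp
    with \<open>c = 0\<close> assms show False by simp
  qed
  have "of_int a * of_int d - of_int b * of_int c = (1::real)"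
    using assms(1) by (simp flip: of_int_mult of_int_diff)
  hence "Im ((of_int a * \<tau> + of_int b) * cnj (of_int c * \<tau> + of_int d)) = Im \<tau>"
    by (simp add: algebra_simps)
  moreover have "Im (mob a b c d \<tau>)
     = Im ((of_int a * \<tau> + of_int b) * cnj (of_int c * \<tau> + of_int d)) / (norm (of_int c * \<tau> + of_int d))\<^sup>2"
    by (subst complex_div_cnj) simp
  ultimately show "Im (mob a b c d \<tau>) > 0"
    using nz assms by simp
qed

lemma lattice_coordinates:
  assumes "Im \<tau> > 0"
  obtains s t :: real where "z = of_real s * \<tau> + of_real t"
proof
  show "z = of_real (Im z / Im \<tau>) * \<tau> + of_real (Re z - Im z / Im \<tau> * Re \<tau>)"
    using assms by (simp add: complex_eq_iff)
qed

text \<open>An elliptic function without poles is constant.\<close>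

lemma elliptic_quotient_eq:
  assumes \<tau>: "Im \<tau> > 0" and G: "G holomorphic_on UNIV"
    and quasi: "\<And>z m n. G (z + of_int m * \<tau> + of_int n) = sg (m + n) * e2pi (- (of_int m)\<^sup>2 * \<tau> / 2 - of_int m * z) * G z"
    and G0: "G 0 = 0" and G': "(G has_field_derivative (- 2 * of_real pi * \<i>)) (at 0)"
  shows "G z = phi z \<tau>"
proof -
  \<comment> \<open>The value 1 is the limit of the quotient at 0, because numerator and denominator
    have the same derivative there; periodicity carries this to all lattice points.\<close>
  define F where "F = (\<lambda>z. if phi z \<tau> = 0 then 1 else G z / phi z \<tau>)"
  have sg0: "sg k \<noteq> 0" for k by (simp add: sg_def)
  have per: "F (z + of_int m * \<tau> + of_int n) = F z" for z m n
    unfolding F_def quasi phi_lattice[OF \<tau>] using sg0 by simp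
  have phi_holo: "(\<lambda>z. phi z \<tau>) holomorphic_on UNIV" by (rule phi_holomorphic[OF \<tau>])
  have F_lim: "(F \<longlongrightarrow> 1) (at 0)"
  proof -
    have "((\<lambda>z. G z / z) \<longlongrightarrow> - 2 * of_real pi * \<i>) (at 0)"
      using G' G0 by (simp add: has_field_derivative_iff)
    moreover have "((\<lambda>z. phi z \<tau> / z) \<longlongrightarrow> - 2 * of_real pi * \<i>) (at 0)"
      using phi_DERIV_0[OF \<tau>] phi_0[OF \<tau>] by (simp add: has_field_derivative_iff)
    ultimately have "((\<lambda>z. (G z / z) / (phi z \<tau> / z)) \<longlongrightarrow> (- 2 * of_real pi * \<i>) / (- 2 * of_real pi * \<i>)) (at 0)"
      by (intro tendsto_divide) auto
    hence "((\<lambda>z. (G z / z) / (phi z \<tau> / z)) \<longlongrightarrow> 1) (at 0)" by simp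
    moreover have "eventually (\<lambda>z. (G z / z) / (phi z \<tau> / z) = F z) (at 0)"
      using phi_eventually_nonzero[OF \<tau>] eventually_neq_at_within[of 0 0 UNIV]
      by eventually_elim (simp add: F_def)
    ultimately show ?thesis by (rule Lim_transform_eventually)
  qed
  have F_diff_0: "F field_differentiable (at 0)"
  proof -
    obtain e where e: "e > 0" "\<And>z. z \<noteq> 0 \<Longrightarrow> dist z 0 < e \<Longrightarrow> phi z \<tau> \<noteq> 0"
      using phi_eventually_nonzero[OF \<tau>] unfolding eventually_at by blast
    have "F holomorphic_on ball 0 e"
    proof (rule no_isolated_singularity')
      show "F holomorphic_on ball 0 e - {0}"
      proof (rule holomorphic_transform)
        show "(\<lambda>z. G z / phi z \<tau>) holomorphic_on ball 0 e - {0}"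
          using e by (intro holomorphic_intros holomorphic_on_subset[OF G] holomorphic_on_subset[OF phi_holo])
                     (auto simp: dist_commute)
      qed (use e in \<open>auto simp: F_def dist_commute\<close>)
      fix z :: complex assume "z \<in> {0}"
      thus "(F \<longlongrightarrow> F z) (at z within ball 0 e)"
        using F_lim phi_0[OF \<tau>] by (auto simp: F_def intro: tendsto_within_subset)
    qed auto
    thus ?thesis using e(1) by (auto simp: holomorphic_on_open field_differentiable_def)
  qed
  have F_holo: "F holomorphic_on UNIV"
    unfolding holomorphic_on_def
  proof safe
    fix w :: complex
    show "F field_differentiable (at w)"
    proof (cases "phi w \<tau> = 0")
      case True
      then obtain m n where w: "w = of_int m * \<tau> + of_int n" using phi_eq_0D[OF \<tau>] by blast
      have F_eq: "F = (\<lambda>z. F (z - w))"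
      proof
        fix z show "F z = F (z - w)" using per[of "z - w" m n] by (simp add: w add.assoc)
      qed
      have "F field_differentiable (at (w - w))" using F_diff_0 by simp
      hence "(F \<circ> (\<lambda>z. z - w)) field_differentiable (at w)"
        by (intro field_differentiable_compose) (auto intro: field_differentiable_diff)
      thus ?thesis using F_eq by (simp add: o_def)
    next
      case False
      have cont: "continuous_on UNIV (\<lambda>z. phi z \<tau>)"
        using phi_holo holomorphic_on_imp_continuous_on by blast
      define S where "S = {z. phi z \<tau> \<noteq> 0}"
      have "open S" unfolding S_def
        using open_Collect_neq[OF cont continuous_on_const[of UNIV 0]] by simp
      moreover have "F holomorphic_on S"
      proof (rule holomorphic_transform)
        show "(\<lambda>z. G z / phi z \<tau>) holomorphic_on S"
          by (intro holomorphic_intros holomorphic_on_subset[OF G] holomorphic_on_subset[OF phi_holo])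
             (auto simp: S_def)
      qed (auto simp: F_def S_def)
      moreover have "w \<in> S" using False by (simp add: S_def)
      ultimately show ?thesis by (auto simp: holomorphic_on_open field_differentiable_def)
    qed
  qed
  define P where "P = (\<lambda>(s::real, t::real). of_real s * \<tau> + of_real t) ` ({0..1} \<times> {0..1})"
  have "compact P"
    unfolding P_def case_prod_unfold
    by (intro compact_continuous_image compact_Times continuous_intros) auto
  hence "bounded (F ` P)"
    using F_holo holomorphic_on_imp_continuous_on holomorphic_on_subset
    by (intro compact_imp_bounded compact_continuous_image) blast+
  moreover have "range F \<subseteq> F ` P"
  proof safe
    fix z
    obtain s t where z: "z = of_real s * \<tau> + of_real t" using lattice_coordinates[OF \<tau>] by blast
    define w where "w = of_real (frac s) * \<tau> + of_real (frac t)"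
    have "w \<in> P" unfolding P_def w_def
      by (rule image_eqI[of _ _ "(frac s, frac t)"]) (auto simp: frac_lt_1 less_imp_le)
    moreover have "z = w + of_int \<lfloor>s\<rfloor> * \<tau> + of_int \<lfloor>t\<rfloor>"
      by (simp add: z w_def frac_def algebra_simps)
    ultimately show "F z \<in> F ` P" using per by auto
  qed
  ultimately have "bounded (range F)" using bounded_subset by blast
  then obtain k where k: "\<And>z. F z = k"
    using Liouville_theorem[OF F_holo] unfolding constant_on_def by blast
  have "k = 1" using k[of 0] phi_0[OF \<tau>] by (simp add: F_def)
  show ?thesis
  proof (cases "phi z \<tau> = 0")
    case True
    then obtain m n where "z = of_int m * \<tau> + of_int n" using phi_eq_0D[OF \<tau>] by blast
    hence "G z = 0" using quasi[of 0 m n] G0 by simp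
    thus ?thesis using True by simp
  next
    case False
    thus ?thesis using k[of z] \<open>k = 1\<close> by (simp add: F_def)
  qed
qed

section \<open>The transformation law under the modular group\<close>

context
  fixes a b c d :: int and \<tau> :: complex
  assumes det: "a * d - b * c = 1" and \<tau>: "Im \<tau> > 0"
begin

text \<open>Multiplication by \<open>j\<close> maps the lattice of \<open>\<tau>'\<close> onto that
  of \<open>\<tau>\<close>, so both sides have the same zeros in \<open>z\<close>. The quadratic
  exponential corrects the multipliers of the quasi-periods.\<close>

lemma phi_modular:
  defines "j \<equiv> of_int c * \<tau> + of_int d"
  defines "\<tau>' \<equiv> (of_int a * \<tau> + of_int b) / j"
  shows "j * phi (z / j) \<tau>' * e2pi (- (of_int c * z\<^sup>2 / (2 * j))) = phi z \<tau>"
proof -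
  have j: "j \<noteq> 0" and \<tau>': "Im \<tau>' > 0"
    using Im_moebius_pos[OF det \<tau>] by (auto simp: j_def \<tau>'_def)
  have detc: "of_int a * of_int d - of_int b * of_int c = (1::complex)"
    using det by (metis of_int_1 of_int_diff of_int_mult)
  show ?thesis
  proof (rule elliptic_quotient_eq[OF \<tau>, where G = "\<lambda>z. j * phi (z / j) \<tau>' * e2pi (- (of_int c * z\<^sup>2 / (2 * j)))"])
    have "(\<lambda>z. phi (z / j) \<tau>') holomorphic_on UNIV"
    proof -
      have "(\<lambda>z. z / j) holomorphic_on UNIV" using j by (intro holomorphic_intros) auto
      from holomorphic_on_compose_gen[OF this phi_holomorphic[OF \<tau>', of UNIV]] show ?thesis
        by (simp add: o_def)
    qed
    thus "(\<lambda>z. j * phi (z / j) \<tau>' * e2pi (- (of_int c * z\<^sup>2 / (2 * j)))) holomorphic_on UNIV"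
      using j by (intro holomorphic_intros) auto
    show "j * phi (0 / j) \<tau>' * e2pi (- (of_int c * 0\<^sup>2 / (2 * j))) = 0"
      using phi_0[OF \<tau>'] by simp
    have "((\<lambda>z. phi (z / j) \<tau>') has_field_derivative (- 2 * of_real pi * \<i>) * (1 / j)) (at 0)"
      by (rule DERIV_chain'[where f = "\<lambda>z. z / j"]) (use j phi_DERIV_0[OF \<tau>'] in \<open>auto intro!: derivative_eq_intros\<close>)
    thus "((\<lambda>z. j * phi (z / j) \<tau>' * e2pi (- (of_int c * z\<^sup>2 / (2 * j)))) has_field_derivative - 2 * of_real pi * \<i>) (at 0)"
      using j phi_0[OF \<tau>'] by (auto intro!: derivative_eq_intros)
    fix z m n
    \<comment> \<open>\<open>(M, N)\<close> is the row vector \<open>(m, n)\<close> times the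
      inverse matrix: the coordinates of \<open>\<omega> / j\<close> with respect to
      \<open>\<tau>'\<close> and 1.\<close>
    define M where "M = d * m - c * n"
    define N where "N = a * n - b * m"
    define \<omega> where "\<omega> = of_int m * \<tau> + of_int n"
    have c1: "of_int M + of_int c * \<omega> = of_int m * j"
      by (simp add: M_def \<omega>_def j_def algebra_simps)
    have c2: "of_int M * \<tau>' = \<omega> / j - of_int N"
    proof -
      have "of_int M * (of_int a * \<tau> + of_int b) + of_int N * j
          = (of_int a * of_int d - of_int b * of_int c) * \<omega>"
        by (simp add: M_def N_def \<omega>_def j_def algebra_simps)
      hence "of_int M * (of_int a * \<tau> + of_int b) + of_int N * j = \<omega>" using detc by simp
      hence "of_int M * (of_int a * \<tau> + of_int b) = \<omega> - of_int N * j" by (simp add: eq_diff_eq)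
      thus ?thesis using j by (simp add: \<tau>'_def diff_divide_distrib)
    qed
    have zj: "(z + of_int m * \<tau> + of_int n) / j = z / j + of_int M * \<tau>' + of_int N"
      unfolding c2 by (simp add: \<omega>_def add_divide_distrib add.assoc)
    \<comment> \<open>Apart from the multiplier for \<open>\<tau>\<close>, the exponents leave only
      the half-integer \<open>(M N - m n) / 2\<close>, a sign that \<open>unimodular_parity\<close>
      absorbs.\<close>
    have e: "e2pi (- (of_int M)\<^sup>2 * \<tau>' / 2 - of_int M * (z / j)) * e2pi (- (of_int c * (z + of_int m * \<tau> + of_int n)\<^sup>2 / (2 * j)))
        = e2pi (of_int (M * N - m * n) / 2) * e2pi (- (of_int m)\<^sup>2 * \<tau> / 2 - of_int m * z) * e2pi (- (of_int c * z\<^sup>2 / (2 * j)))"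
    proof -
      have w: "z + of_int m * \<tau> + of_int n = z + \<omega>" by (simp add: \<omega>_def add.assoc)
      have "(of_int M)\<^sup>2 * \<tau>' = of_int M * (\<omega> / j - of_int N)"
        unfolding power2_eq_square mult.assoc c2 ..
      moreover have "of_int c * (z + \<omega>)\<^sup>2 = of_int c * z\<^sup>2 + 2 * z * (of_int m * j - of_int M) + (of_int m * j - of_int M) * \<omega>"
      proof -
        have c\<omega>: "of_int c * \<omega> = of_int m * j - of_int M" using c1 by (simp add: eq_diff_eq add.commute)
        have "of_int c * (z + \<omega>)\<^sup>2 = of_int c * z\<^sup>2 + 2 * z * (of_int c * \<omega>) + (of_int c * \<omega>) * \<omega>"
          by (simp add: power2_eq_square algebra_simps)
        thus ?thesis unfolding c\<omega> .
      qed
      ultimately have "- (of_int M)\<^sup>2 * \<tau>' / 2 - of_int M * (z / j) + - (of_int c * (z + \<omega>)\<^sup>2 / (2 * j))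
         = - (of_int M * (\<omega> / j - of_int N)) / 2 - of_int M * (z / j)
           - (of_int c * z\<^sup>2 + 2 * z * (of_int m * j - of_int M) + (of_int m * j - of_int M) * \<omega>) / (2 * j)"
        by simp
      also have "\<dots> = (of_int M * of_int N - of_int m * \<omega>) / 2 - of_int m * z - of_int c * z\<^sup>2 / (2 * j)"
        using j by (simp add: field_simps)
      also have "\<dots> = of_int (M * N - m * n) / 2 + (- (of_int m)\<^sup>2 * \<tau> / 2 - of_int m * z) + - (of_int c * z\<^sup>2 / (2 * j))"
        by (simp add: \<omega>_def field_simps power2_eq_square)
      finally show ?thesis unfolding w e2pi_add[symmetric] by (rule arg_cong)
    qed
    have "j * phi ((z + of_int m * \<tau> + of_int n) / j) \<tau>' * e2pi (- (of_int c * (z + of_int m * \<tau> + of_int n)\<^sup>2 / (2 * j)))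
       = j * sg (M + N) * phi (z / j) \<tau>' * (e2pi (- (of_int M)\<^sup>2 * \<tau>' / 2 - of_int M * (z / j)) * e2pi (- (of_int c * (z + of_int m * \<tau> + of_int n)\<^sup>2 / (2 * j))))"
      unfolding zj phi_lattice[OF \<tau>'] by (simp only: mult_ac)
    also have "\<dots> = (sg (M + N) * sg (M * N - m * n)) * e2pi (- (of_int m)\<^sup>2 * \<tau> / 2 - of_int m * z) * (j * phi (z / j) \<tau>' * e2pi (- (of_int c * z\<^sup>2 / (2 * j))))"
      unfolding e e2pi_half_int by (simp only: mult_ac)
    also have "sg (M + N) * sg (M * N - m * n) = sg (m + n)"
      unfolding M_def N_def by (rule unimodular_parity[OF det])
    finally show "j * phi ((z + of_int m * \<tau> + of_int n) / j) \<tau>' * e2pi (- (of_int c * (z + of_int m * \<tau> + of_int n)\<^sup>2 / (2 * j))) =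
       sg (m + n) * e2pi (- (of_int m)\<^sup>2 * \<tau> / 2 - of_int m * z) * (j * phi (z / j) \<tau>' * e2pi (- (of_int c * z\<^sup>2 / (2 * j))))" .
  qed
qed

end

text \<open>The classical Klein form of characteristic \<open>(x, y)\<close>, up to the constant
  \<open>-2 pi i\<close> already present in \<open>phi\<close>.\<close>

definition klein :: "complex \<Rightarrow> complex \<Rightarrow> complex \<Rightarrow> complex" where
  "klein x y \<tau> = e2pi (x * (x * \<tau> + y) / 2) * phi (x * \<tau> + y) \<tau>"

text \<open>For rational characteristics the factor is a root of unity. In the invariance proof it
  is always a sign.\<close>

lemma klein_shift:
  assumes \<tau>: "Im \<tau> > 0"
  shows "klein (x + of_int m) (y + of_int n) \<tau> =
           sg (m + n + m * n) * e2pi ((x * of_int n - y * of_int m) / 2) * klein x y \<tau>"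
proof -
  have z: "(x + of_int m) * \<tau> + (y + of_int n) = (x * \<tau> + y) + of_int m * \<tau> + of_int n"
    by (simp add: algebra_simps)
  have "e2pi ((x + of_int m) * ((x * \<tau> + y) + of_int m * \<tau> + of_int n) / 2) * e2pi (- (of_int m)\<^sup>2 * \<tau> / 2 - of_int m * (x * \<tau> + y))
      = e2pi (of_int (m * n) / 2) * e2pi ((x * of_int n - y * of_int m) / 2) * e2pi (x * (x * \<tau> + y) / 2)"
    unfolding e2pi_add[symmetric]
    by (rule arg_cong[where f = e2pi]) (simp add: field_simps power2_eq_square)
  hence e: "e2pi ((x + of_int m) * ((x * \<tau> + y) + of_int m * \<tau> + of_int n) / 2) * e2pi (- (of_int m)\<^sup>2 * \<tau> / 2 - of_int m * (x * \<tau> + y))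
      = sg (m * n) * e2pi ((x * of_int n - y * of_int m) / 2) * e2pi (x * (x * \<tau> + y) / 2)"
    unfolding e2pi_half_int .
  have "klein (x + of_int m) (y + of_int n) \<tau>
     = sg (m + n) * (e2pi ((x + of_int m) * ((x * \<tau> + y) + of_int m * \<tau> + of_int n) / 2) * e2pi (- (of_int m)\<^sup>2 * \<tau> / 2 - of_int m * (x * \<tau> + y))) * phi (x * \<tau> + y) \<tau>"
    unfolding klein_def z phi_lattice[OF \<tau>] by (simp only: mult_ac)
  also have "\<dots> = sg (m + n) * sg (m * n) * e2pi ((x * of_int n - y * of_int m) / 2) * klein x y \<tau>"
    unfolding e klein_def by (simp only: mult_ac)
  finally show ?thesis unfolding sg_add .
qed

text \<open>With \<open>X\<close> the new first characteristic and \<open>z\<close> the point of the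
  new form one has \<open>x + c z = X j\<close>. This merges the old prefactor and the quadratic
  exponential of \<open>phi_modular\<close> into the prefactor of the new form.\<close>

lemma klein_modular:
  fixes a b c d :: int
  assumes det: "a * d - b * c = 1" and \<tau>: "Im \<tau> > 0"
  shows "(of_int c * \<tau> + of_int d) * klein x y (mob a b c d \<tau>)
           = klein (of_int a * x + of_int c * y) (of_int b * x + of_int d * y) \<tau>"
proof -
  define j where "j = of_int c * \<tau> + of_int d"
  define \<tau>' where "\<tau>' = (of_int a * \<tau> + of_int b) / j"
  define X where "X = of_int a * x + of_int c * y"
  define z where "z = X * \<tau> + (of_int b * x + of_int d * y)"
  have j: "j \<noteq> 0" using Im_moebius_pos[OF det \<tau>] by (simp add: j_def)
  have detc: "of_int a * of_int d - of_int b * of_int c = (1::complex)"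
    using det by (metis of_int_1 of_int_diff of_int_mult)
  have z': "x * \<tau>' + y = z / j"
  proof -
    have "x * (of_int a * \<tau> + of_int b) + y * j = z"
      by (simp add: z_def X_def j_def algebra_simps)
    thus ?thesis using j by (simp add: \<tau>'_def field_simps)
  qed
  have X: "x + of_int c * z = X * j"
  proof -
    have "X * j - of_int c * z = (of_int a * of_int d - of_int b * of_int c) * x"
      by (simp add: z_def X_def j_def algebra_simps)
    thus ?thesis using detc by (simp add: algebra_simps)
  qed
  have e: "e2pi (x * (z / j) / 2) = e2pi (X * z / 2) * e2pi (- (of_int c * z\<^sup>2 / (2 * j)))"
  proof -
    have "x * (z / j) / 2 + of_int c * z\<^sup>2 / (2 * j) = (x + of_int c * z) * z / (2 * j)"
      using j by (simp add: field_simps power2_eq_square)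
    also have "\<dots> = X * z / 2" unfolding X using j by simp
    finally have "x * (z / j) / 2 = X * z / 2 + - (of_int c * z\<^sup>2 / (2 * j))"
      by (simp add: eq_diff_eq)
    thus ?thesis by (simp only: e2pi_add)
  qed
  have "j * klein x y \<tau>' = e2pi (X * z / 2) * (j * phi (z / j) \<tau>' * e2pi (- (of_int c * z\<^sup>2 / (2 * j))))"
    unfolding klein_def z' e by (simp only: mult_ac)
  also have "j * phi (z / j) \<tau>' * e2pi (- (of_int c * z\<^sup>2 / (2 * j))) = phi z \<tau>"
    unfolding j_def \<tau>'_def by (rule phi_modular[OF det \<tau>])
  finally show ?thesis unfolding j_def[symmetric] \<tau>'_def[symmetric]
    by (simp add: klein_def z_def X_def)
qed

section \<open>Behaviour at the cusps\<close>

text \<open>\<open>meromorphic_at_cusp\<close> with the matrix already applied, to be propagated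
  through products, sums and reciprocals. The width \<open>h\<close> is existential, so functions of
  different widths can be combined.\<close>

definition cusp_mero :: "(complex \<Rightarrow> complex) \<Rightarrow> bool" where
  "cusp_mero F \<longleftrightarrow> (\<exists>h::nat. h > 0 \<and> (\<exists>g. g meromorphic_on {0} \<and>
      (\<exists>Y>0. \<forall>\<tau>. Im \<tau> > Y \<longrightarrow> F \<tau> = g (e2pi (\<tau> / of_nat h)))))"

lemma cusp_meroI:
  assumes "h > 0" "g meromorphic_on {0}" "Y > 0" "\<And>\<tau>. Im \<tau> > Y \<Longrightarrow> F \<tau> = g (e2pi (\<tau> / of_nat h))"
  shows "cusp_mero F"
  using assms unfolding cusp_mero_def by blast

lemma meromorphic_on_subst_power:
  assumes "g meromorphic_on {0}" "n > 0"
  shows "(\<lambda>w. g (c * w ^ n)) meromorphic_on {0}"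
  by (rule meromorphic_on_compose[OF assms(1)]) (use assms(2) in \<open>auto intro!: analytic_intros simp: power_0_left\<close>)

text \<open>A rational translation multiplies the local parameter by the constant \<open>c\<close>,
  and division by \<open>\<delta>\<close> is absorbed by the width
  \<open>\<delta> * h\<close>.\<close>

lemma cusp_mero_subst:
  fixes \<alpha> \<delta> :: nat and \<beta> :: int
  assumes "cusp_mero F" "\<alpha> > 0" "\<delta> > 0"
  shows "cusp_mero (\<lambda>\<tau>. F ((of_nat \<alpha> * \<tau> + of_int \<beta>) / of_nat \<delta>))"
proof -
  from assms(1) obtain h g Y where h: "h > 0" and g: "g meromorphic_on {0}" and Y: "Y > 0"
    "\<And>\<tau>. Im \<tau> > Y \<Longrightarrow> F \<tau> = g (e2pi (\<tau> / of_nat h))"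
    unfolding cusp_mero_def by blast
  define c where "c = e2pi (of_int \<beta> / of_nat (\<delta> * h))"
  show ?thesis
  proof (rule cusp_meroI)
    show "\<delta> * h > 0" using h assms by simp
    show "(\<lambda>w. g (c * w ^ \<alpha>)) meromorphic_on {0}"
      by (rule meromorphic_on_subst_power[OF g assms(2)])
    show "Y * of_nat \<delta> / of_nat \<alpha> > 0" using Y assms by simp
    fix \<tau> assume \<tau>: "Im \<tau> > Y * of_nat \<delta> / of_nat \<alpha>"
    have "Im ((of_nat \<alpha> * \<tau> + of_int \<beta>) / of_nat \<delta>) = real \<alpha> * Im \<tau> / real \<delta>"
      by (simp add: Im_divide_of_nat)
    moreover have "real \<alpha> * Im \<tau> / real \<delta> > Y" using \<tau> assms by (simp add: field_simps)
    ultimately have "F ((of_nat \<alpha> * \<tau> + of_int \<beta>) / of_nat \<delta>) = g (e2pi ((of_nat \<alpha> * \<tau> + of_int \<beta>) / of_nat \<delta> / of_nat h))"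
      using Y(2) by simp
    also have "(of_nat \<alpha> * \<tau> + of_int \<beta>) / of_nat \<delta> / of_nat h
        = of_int \<beta> / of_nat (\<delta> * h) + of_nat \<alpha> * (\<tau> / of_nat (\<delta> * h))"
      using h assms by (simp add: field_simps)
    also have "e2pi \<dots> = c * e2pi (\<tau> / of_nat (\<delta> * h)) ^ \<alpha>"
      by (simp only: e2pi_add e2pi_of_nat_mult c_def)
    finally show "F ((of_nat \<alpha> * \<tau> + of_int \<beta>) / of_nat \<delta>) = g (c * e2pi (\<tau> / of_nat (\<delta> * h)) ^ \<alpha>)" .
  qed
qed

lemma cusp_mero_const: "cusp_mero (\<lambda>_. c)"
  by (rule cusp_meroI[of 1 "\<lambda>_. c" 1]) auto

lemma cusp_mero_inverse:
  assumes "cusp_mero F"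
  shows "cusp_mero (\<lambda>\<tau>. inverse (F \<tau>))"
proof -
  from assms obtain h g Y where "h > 0" "g meromorphic_on {0}" "Y > 0"
    "\<And>\<tau>. Im \<tau> > Y \<Longrightarrow> F \<tau> = g (e2pi (\<tau> / of_nat h))"
    unfolding cusp_mero_def by blast
  thus ?thesis
    by (intro cusp_meroI[of h "\<lambda>w. inverse (g w)" Y]) (auto intro!: meromorphic_intros)
qed

lemma cusp_mero_binop:
  assumes "cusp_mero F" "cusp_mero G"
    and "\<And>f g. f meromorphic_on {0} \<Longrightarrow> g meromorphic_on {0} \<Longrightarrow> (\<lambda>w. k (f w) (g w)) meromorphic_on {0}"
  shows "cusp_mero (\<lambda>\<tau>. k (F \<tau>) (G \<tau>))"
proof -
  from assms(1,2) obtain h1 f Y1 h2 g Y2 where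
    F: "h1 > 0" "f meromorphic_on {0}" "Y1 > 0" "\<And>\<tau>. Im \<tau> > Y1 \<Longrightarrow> F \<tau> = f (e2pi (\<tau> / of_nat h1))" and
    G: "h2 > 0" "g meromorphic_on {0}" "Y2 > 0" "\<And>\<tau>. Im \<tau> > Y2 \<Longrightarrow> G \<tau> = g (e2pi (\<tau> / of_nat h2))"
    unfolding cusp_mero_def by blast
  have e: "e2pi (\<tau> / of_nat h1) = e2pi (\<tau> / of_nat (h1 * h2)) ^ h2" "e2pi (\<tau> / of_nat h2) = e2pi (\<tau> / of_nat (h1 * h2)) ^ h1" for \<tau>
    using F(1) G(1) by (subst e2pi_of_nat_mult[symmetric], simp)+
  have "(\<lambda>w. f (w ^ h2)) meromorphic_on {0}" "(\<lambda>w. g (w ^ h1)) meromorphic_on {0}"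
    using meromorphic_on_subst_power[OF F(2) G(1), of 1] meromorphic_on_subst_power[OF G(2) F(1), of 1]
    by simp_all
  note mero = assms(3)[OF this]
  show ?thesis
    by (rule cusp_meroI[of "h1 * h2" _ "max Y1 Y2", OF _ mero]) (use F G e in auto)
qed

lemma cusp_mero_mult: "cusp_mero F \<Longrightarrow> cusp_mero G \<Longrightarrow> cusp_mero (\<lambda>\<tau>. F \<tau> * G \<tau>)"
  by (erule (1) cusp_mero_binop) (rule meromorphic_on_mult)

lemma cusp_mero_add: "cusp_mero F \<Longrightarrow> cusp_mero G \<Longrightarrow> cusp_mero (\<lambda>\<tau>. F \<tau> + G \<tau>)"
  by (erule (1) cusp_mero_binop) (rule meromorphic_on_add)

lemma cusp_mero_power: "cusp_mero F \<Longrightarrow> cusp_mero (\<lambda>\<tau>. F \<tau> ^ n)"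
  by (induction n) (auto intro: cusp_mero_const cusp_mero_mult)

lemma cusp_mero_prod_list:
  "(\<And>x. x \<in> set xs \<Longrightarrow> cusp_mero (F x)) \<Longrightarrow> cusp_mero (\<lambda>\<tau>. \<Prod>x\<leftarrow>xs. F x \<tau>)"
  by (induction xs) (auto intro: cusp_mero_const cusp_mero_mult)

lemma cusp_mero_cong:
  assumes "cusp_mero F" "\<And>\<tau>. Im \<tau> > 0 \<Longrightarrow> F \<tau> = G \<tau>"
  shows "cusp_mero G"
  using assms unfolding cusp_mero_def by (metis order_less_trans)

lemma klein_q_expansion:
  "klein x y \<tau> = e2pi (y * (x - 1) / 2) * e2pi ((x\<^sup>2 - x) * \<tau> / 2) * qpoch_inf (e2pi y * e2pi (x * \<tau>)) (e2pi \<tau>)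
      * qpoch_inf (e2pi (- y) * e2pi ((1 - x) * \<tau>)) (e2pi \<tau>) / (qpoch_inf (e2pi \<tau>) (e2pi \<tau>))\<^sup>2"
proof -
  have 1: "e2pi (x * (x * \<tau> + y) / 2) * e2pi (- (x * \<tau> + y) / 2) = e2pi (y * (x - 1) / 2) * e2pi ((x\<^sup>2 - x) * \<tau> / 2)"
    unfolding e2pi_add[symmetric] by (rule arg_cong[where f = e2pi]) (simp add: field_simps power2_eq_square)
  have 2: "e2pi (x * \<tau> + y) = e2pi y * e2pi (x * \<tau>)" by (simp add: e2pi_add)
  have 3: "e2pi (\<tau> - (x * \<tau> + y)) = e2pi (- y) * e2pi ((1 - x) * \<tau>)"
    unfolding e2pi_add[symmetric] by (rule arg_cong[where f = e2pi]) (simp add: algebra_simps)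
  have "klein x y \<tau> = (e2pi (x * (x * \<tau> + y) / 2) * e2pi (- (x * \<tau> + y) / 2)) * qpoch_inf (e2pi (x * \<tau> + y)) (e2pi \<tau>)
     * qpoch_inf (e2pi (\<tau> - (x * \<tau> + y))) (e2pi \<tau>) / (qpoch_inf (e2pi \<tau>) (e2pi \<tau>))\<^sup>2"
    by (simp add: klein_def phi_def)
  thus ?thesis unfolding 1 2 3 .
qed

text \<open>For a first characteristic in \<open>[0, 1)\<close> the only negative exponent in the
  expansion is the leading one, \<open>- p (h - p) / (2 h^2)\<close>; this dictates the width
  \<open>2 * h\<^sup>2\<close> and the order of the possible pole.\<close>

lemma cusp_mero_klein_0:
  fixes p h :: nat
  assumes p: "p < h"
  shows "cusp_mero (klein (of_nat p / of_nat h) y)"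
proof (rule cusp_meroI)
  define k where "k = 2 * h\<^sup>2"
  define x :: complex where "x = of_nat p / of_nat h"
  have h: "h > 0" using p by simp
  show k: "k > 0" using h by (simp add: k_def)
  define g where "g = (\<lambda>w. e2pi (y * (x - 1) / 2) * inverse (w ^ (p * (h - p)))
      * qpoch_inf (e2pi y * w ^ (2 * h * p)) (w ^ k) * qpoch_inf (e2pi (- y) * w ^ (2 * h * (h - p))) (w ^ k)
      / (qpoch_inf (w ^ k) (w ^ k))\<^sup>2)"
  have mero: "(\<lambda>w. qpoch_inf (c * w ^ n) (w ^ k)) meromorphic_on {0}" for c n
  proof -
    have "(\<lambda>w. qpoch_inf (c * w ^ n) (w ^ k)) holomorphic_on ball 0 1"
    proof (rule holomorphic_on_qpoch_inf)
      fix z :: complex assume "z \<in> ball 0 1"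
      thus "norm (z ^ k) < 1" using k by (simp add: norm_power power_less_one_iff)
    qed (auto intro!: holomorphic_intros)
    hence "(\<lambda>w. qpoch_inf (c * w ^ n) (w ^ k)) analytic_on {0}"
      unfolding analytic_at by (intro exI[of _ "ball 0 1"]) auto
    thus ?thesis by (rule analytic_on_imp_meromorphic_on)
  qed
  show "g meromorphic_on {0}"
    unfolding g_def using mero[of 1 k] by (intro meromorphic_intros mero) auto
  show "(1::real) > 0" by simp
  fix \<tau> :: complex
  define w where "w = e2pi (\<tau> / of_nat k)"
  have e: "e2pi (of_nat n * (\<tau> / of_nat k)) = w ^ n" for n
    by (simp only: e2pi_of_nat_mult w_def)
  have h0: "(of_nat h :: complex) \<noteq> 0" using h by simp
  have "e2pi \<tau> = w ^ k" using e[of k] k by simp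
  moreover have "e2pi (x * \<tau>) = w ^ (2 * h * p)"
    unfolding e[symmetric] by (rule arg_cong[where f = e2pi]) (use h0 in \<open>simp add: x_def k_def field_simps power2_eq_square\<close>)
  moreover have "e2pi ((1 - x) * \<tau>) = w ^ (2 * h * (h - p))"
    unfolding e[symmetric] by (rule arg_cong[where f = e2pi])
      (use h0 p in \<open>simp add: x_def k_def field_simps power2_eq_square of_nat_diff\<close>)
  moreover have "e2pi ((x\<^sup>2 - x) * \<tau> / 2) = inverse (w ^ (p * (h - p)))"
    unfolding e[symmetric] e2pi_minus[symmetric] by (rule arg_cong[where f = e2pi])
      (use h0 p in \<open>simp add: x_def k_def field_simps power2_eq_square of_nat_diff\<close>)
  ultimately show "klein (of_nat p / of_nat h) y \<tau> = g (e2pi (\<tau> / of_nat k))"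
    unfolding x_def[symmetric] w_def[symmetric] klein_q_expansion g_def by simp
qed

lemma cusp_mero_klein:
  assumes "x \<in> \<rat>"
  shows "cusp_mero (klein x y)"
proof -
  from assms obtain r :: rat where r: "x = of_rat r" by (auto elim: Rats_cases)
  obtain a b where ab: "r = Fract a b" "b > 0" using quotient_of_unique by (cases r) auto
  define h where "h = nat b"
  define p where "p = nat (a mod b)"
  have h: "int h = b" "p < h" using ab by (auto simp: h_def p_def nat_less_iff)
  have p: "int p = a mod b" using ab by (simp add: p_def)
  have bh: "(of_int b :: complex) = of_nat h" using h(1) by (metis of_int_of_nat_eq)
  have "of_int a = of_int (a mod b) + of_int b * (of_int (a div b) :: complex)"
    by (simp flip: of_int_mult of_int_add)
  hence "of_int a = of_nat p + of_nat h * (of_int (a div b) :: complex)"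
    unfolding bh p[symmetric] by simp
  hence x: "x = of_nat p / of_nat h + of_int (a div b)"
    using h ab bh by (simp add: r ab of_rat_rat field_simps)
  define c where "c = sg (a div b) * e2pi (- y * of_int (a div b) / 2)"
  have "cusp_mero (\<lambda>\<tau>. c * klein (of_nat p / of_nat h) y \<tau>)"
    by (intro cusp_mero_mult cusp_mero_const cusp_mero_klein_0 h)
  moreover have "c * klein (of_nat p / of_nat h) y \<tau> = klein x y \<tau>" if "Im \<tau> > 0" for \<tau>
    using klein_shift[OF that, of "of_nat p / of_nat h" "a div b" y 0] by (simp add: x c_def)
  ultimately show ?thesis by (rule cusp_mero_cong)
qed

text \<open>The matrix with rows \<open>(M A, M B)\<close> and \<open>(C, D)\<close> is a product of
  a unimodular and an upper triangular matrix. The weight factor stays attached to the form, as for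
  \<open>C \<noteq> 0\<close> it is not periodic and so by itself not a function of a local
  parameter.\<close>

lemma cusp_mero_klein_scaled:
  fixes A B C D :: int and M :: nat
  assumes det: "A * D - B * C = 1" and M: "M > 0" and x: "x \<in> \<rat>" "y \<in> \<rat>"
  shows "cusp_mero (\<lambda>\<tau>. (of_int C * \<tau> + of_int D) * klein x y (of_nat M * (mob A B C D \<tau>)))"
proof -
  \<comment> \<open>The first column is \<open>g\<close> times a primitive vector
    \<open>(a, c)\<close>, which Bezout completes to a unimodular matrix. In the new basis the
    second column is \<open>(\<beta>, \<delta>)\<close>, with
    \<open>g * \<delta> = M\<close>.\<close>
  define g where "g = gcd (int M * A) C"
  have nz: "int M * A \<noteq> 0 \<or> C \<noteq> 0" using det M by auto
  hence g: "g > 0" by (simp add: g_def)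
  obtain a c where a: "int M * A = g * a" and c: "C = g * c"
    unfolding g_def by (meson dvdE gcd_dvd1 gcd_dvd2)
  obtain u v where "u * (int M * A) + v * C = g"
    unfolding g_def using bezout_int by blast
  hence "g * (u * a + v * c) = g * 1" unfolding a c by (simp add: algebra_simps)
  hence uv: "u * a + v * c = 1" using g by (simp only: mult_cancel_left) auto
  define b where "b = - v"
  define d where "d = u"
  have det': "a * d - b * c = 1" using uv by (simp add: b_def d_def algebra_simps)
  define \<beta> where "\<beta> = d * (int M * B) - b * D"
  define \<delta> where "\<delta> = a * D - c * (int M * B)"
  have "g * \<delta> = (g * a) * D - (g * c) * (int M * B)" by (simp add: \<delta>_def algebra_simps)
  also have "\<dots> = int M * (A * D - B * C)" unfolding a[symmetric] c[symmetric] by (simp add: algebra_simps)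
  finally have g\<delta>: "g * \<delta> = int M" using det by simp
  hence \<delta>: "\<delta> > 0" using g M by (metis of_nat_0_less_iff zero_less_mult_pos)
  have eB: "a * \<beta> + b * \<delta> = int M * B"
  proof -
    have "a * \<beta> + b * \<delta> = (a * d - b * c) * (int M * B)" by (simp add: \<beta>_def \<delta>_def algebra_simps)
    thus ?thesis using det' by simp
  qed
  have eD: "c * \<beta> + d * \<delta> = D"
  proof -
    have "c * \<beta> + d * \<delta> = (a * d - b * c) * D" by (simp add: \<beta>_def \<delta>_def algebra_simps)
    thus ?thesis using det' by simp
  qed
  define X where "X = of_int a * x + of_int c * y"
  define Y where "Y = of_int b * x + of_int d * y"
  have "X \<in> \<rat>" using x by (simp add: X_def)
  hence "cusp_mero (\<lambda>\<tau>. klein X Y ((of_nat (nat g) * \<tau> + of_int \<beta>) / of_nat (nat \<delta>)))"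
    by (intro cusp_mero_subst cusp_mero_klein) (use g \<delta> in auto)
  hence "cusp_mero (\<lambda>\<tau>. of_int \<delta> * klein X Y ((of_nat (nat g) * \<tau> + of_int \<beta>) / of_nat (nat \<delta>)))"
    by (intro cusp_mero_mult cusp_mero_const)
  thus ?thesis
  proof (rule cusp_mero_cong)
    fix \<tau> :: complex assume \<tau>: "Im \<tau> > 0"
    define t where "t = (of_nat (nat g) * \<tau> + of_int \<beta>) / of_nat (nat \<delta>)"
    have t: "t = (of_int g * \<tau> + of_int \<beta>) / of_int \<delta>"
      using g \<delta> by (simp add: t_def)
    have \<delta>0: "(of_int \<delta> :: complex) \<noteq> 0" using \<delta> by simp
    have "Im t = Im ((of_int g * \<tau> + of_int \<beta>) / of_real (of_int \<delta>))" by (simp add: t)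
    also have "\<dots> = of_int g * Im \<tau> / of_int \<delta>" by (subst Im_divide_of_real) simp
    finally have "Im t = of_int g * Im \<tau> / of_int \<delta>" .
    hence It: "Im t > 0" using g \<delta> \<tau> by simp
    have n0: "of_int C * \<tau> + of_int D \<noteq> 0" using Im_moebius_pos(1)[OF det \<tau>] .
    have den: "of_int c * t + of_int d = (of_int C * \<tau> + of_int D) / of_int \<delta>"
    proof -
      have "of_int c * (of_int g * \<tau> + of_int \<beta>) + of_int d * of_int \<delta> = of_int (g * c) * \<tau> + of_int (c * \<beta> + d * \<delta>)"
        by (simp add: algebra_simps)
      thus ?thesis unfolding eD c[symmetric] t using \<delta>0 by (simp add: field_simps)
    qed
    have num: "of_int a * t + of_int b = of_nat M * (of_int A * \<tau> + of_int B) / of_int \<delta>"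
    proof -
      have "of_int a * (of_int g * \<tau> + of_int \<beta>) + of_int b * of_int \<delta> = of_int (g * a) * \<tau> + of_int (a * \<beta> + b * \<delta>)"
        by (simp add: algebra_simps)
      also have "\<dots> = of_nat M * (of_int A * \<tau> + of_int B)"
        unfolding eB a[symmetric] by (simp add: algebra_simps)
      finally show ?thesis unfolding t using \<delta>0 by (simp add: field_simps)
    qed
    have arg: "(of_int a * t + of_int b) / (of_int c * t + of_int d)
        = of_nat M * (mob A B C D \<tau>)"
      unfolding num den using \<delta>0 by simp
    have "(of_int C * \<tau> + of_int D) / of_int \<delta> * klein x y (of_nat M * (mob A B C D \<tau>))
       = klein X Y t"
      using klein_modular[OF det' It, of x y] unfolding arg unfolding den X_def Y_def .
    thus "of_int \<delta> * klein X Y ((of_nat (nat g) * \<tau> + of_int \<beta>) / of_nat (nat \<delta>)) =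
      (of_int C * \<tau> + of_int D) * klein x y (of_nat M * (mob A B C D \<tau>))"
      unfolding t_def[symmetric] using \<delta>0 by (simp add: field_simps)
  qed
qed

section \<open>Invariance under the congruence subgroup\<close>

text \<open>With 784 = 28^2 the characteristic \<open>e / 28\<close> corresponds to the power
  \<open>p ^ e\<close> of \<open>p = e2pi (28 * \<tau>)\<close>, and the nome is
  \<open>p ^ 28\<close>.\<close>

definition klein28 :: "nat \<Rightarrow> complex \<Rightarrow> complex" where
  "klein28 e \<tau> = klein (of_nat e / 28) 0 (784 * \<tau>)"

text \<open>The Klein forms of level 2 have the product \<open>c \<eta>\<^sup>-\<^sup>6\<close>; its cube supplies the power \<open>\<eta>(784 \<tau>)\<^sup>-\<^sup>1\<^sup>8\<close>
  that the forms of characteristic \<open>(e/28, 0)\<close> cannot produce.\<close>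

definition klein2_product :: "complex \<Rightarrow> complex" where
  "klein2_product \<tau> = klein (1/2) 0 (784 * \<tau>) * klein 0 (1/2) (784 * \<tau>) * klein (1/2) (1/2) (784 * \<tau>)"

text \<open>The cube stands for nine forms of weight -1, so the total weight is 0 if
  \<open>D\<close> has nine entries more than \<open>N\<close>.\<close>

definition kquot :: "nat list \<Rightarrow> nat list \<Rightarrow> complex \<Rightarrow> complex" where
  "kquot N D \<tau> = (\<Prod>e\<leftarrow>N. klein28 e \<tau>) * klein2_product \<tau> ^ 3 / (\<Prod>e\<leftarrow>D. klein28 e \<tau>)"

lemma prod_list_scale:
  fixes f g :: "nat \<Rightarrow> complex"
  assumes "\<And>e. w * f e = sg (b * int e) * g e"
  shows "w ^ length N * (\<Prod>e\<leftarrow>N. f e) = sg (b * int (sum_list N)) * (\<Prod>e\<leftarrow>N. g e)"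
proof (induction N)
  case (Cons e N)
  have "w ^ length (e # N) * (\<Prod>e\<leftarrow>e # N. f e) = (w * f e) * (w ^ length N * (\<Prod>e\<leftarrow>N. f e))"
    by simp
  also have "\<dots> = (sg (b * int e) * g e) * (sg (b * int (sum_list N)) * (\<Prod>e\<leftarrow>N. g e))"
    unfolding assms Cons ..
  also have "\<dots> = (sg (b * int e) * sg (b * int (sum_list N))) * (g e * (\<Prod>e\<leftarrow>N. g e))"
    by (simp only: mult_ac)
  also have "sg (b * int e) * sg (b * int (sum_list N)) = sg (b * int (sum_list (e # N)))"
    unfolding sg_add[symmetric] by (simp add: distrib_left)
  finally show ?case by simp
qed simp

lemma quotient_cancel_weight:
  fixes w :: complex
  assumes "w \<noteq> 0" "l = k + 9"
    and "w ^ k * x = x'" "w ^ 3 * h = h'" "w ^ l * y = y'"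
  shows "x * h ^ 3 / y = x' * h' ^ 3 / y'"
proof -
  have "x' * h' ^ 3 = w ^ l * (x * h ^ 3)"
    unfolding assms(2) assms(3,4)[symmetric] by (simp add: power_mult_distrib power_add flip: power_mult)
  thus ?thesis unfolding assms(5)[symmetric] using assms(1) by simp
qed

text \<open>Each form receives its own weight factor, which makes it meromorphic at the cusp; by the
  length condition the factors cancel in the quotient.\<close>

lemma kquot_cusp:
  assumes det: "a * d - b * c = 1" and len: "length D = length N + 9"
  shows "cusp_mero (\<lambda>\<tau>. kquot N D (mob a b c d \<tau>))"
proof -
  define t where "t = (\<lambda>\<tau>::complex. mob a b c d \<tau>)"
  define w where "w = (\<lambda>\<tau>::complex. of_int c * \<tau> + (of_int d :: complex))"
  have k: "cusp_mero (\<lambda>\<tau>. w \<tau> * klein x y (784 * t \<tau>))" if "x \<in> \<rat>" "y \<in> \<rat>" for x y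
    using cusp_mero_klein_scaled[OF det, of 784 x y] that by (simp add: w_def t_def)
  have K: "cusp_mero (\<lambda>\<tau>. w \<tau> * klein28 e (t \<tau>))" for e
    unfolding klein28_def by (rule k) auto
  define h where "h = (\<lambda>\<tau>. (w \<tau> * klein (1/2) 0 (784 * t \<tau>)) * (w \<tau> * klein 0 (1/2) (784 * t \<tau>)) * (w \<tau> * klein (1/2) (1/2) (784 * t \<tau>)))"
  have h: "cusp_mero h"
    unfolding h_def by (intro cusp_mero_mult k) auto
  have "cusp_mero (\<lambda>\<tau>. (\<Prod>e\<leftarrow>N. w \<tau> * klein28 e (t \<tau>)) * h \<tau> ^ 3 * inverse (\<Prod>e\<leftarrow>D. w \<tau> * klein28 e (t \<tau>)))"
    by (intro cusp_mero_mult cusp_mero_inverse cusp_mero_power cusp_mero_prod_list K h)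
  hence "cusp_mero (\<lambda>\<tau>. kquot N D (t \<tau>))"
  proof (rule cusp_mero_cong)
    fix \<tau> :: complex assume \<tau>: "Im \<tau> > 0"
    have w0: "w \<tau> \<noteq> 0" using Im_moebius_pos(1)[OF det \<tau>] by (simp add: w_def)
    have p: "w \<tau> ^ length L * (\<Prod>e\<leftarrow>L. klein28 e (t \<tau>)) = (\<Prod>e\<leftarrow>L. w \<tau> * klein28 e (t \<tau>))" for L
      by (induction L) (simp_all add: mult_ac)
    have q: "w \<tau> ^ 3 * klein2_product (t \<tau>) = h \<tau>"
      by (simp add: h_def klein2_product_def power3_eq_cube mult_ac)
    have "kquot N D (t \<tau>) = (\<Prod>e\<leftarrow>N. w \<tau> * klein28 e (t \<tau>)) * h \<tau> ^ 3 / (\<Prod>e\<leftarrow>D. w \<tau> * klein28 e (t \<tau>))"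
      unfolding kquot_def by (rule quotient_cancel_weight[OF w0 len p q p])
    thus "(\<Prod>e\<leftarrow>N. w \<tau> * klein28 e (t \<tau>)) * h \<tau> ^ 3 * inverse (\<Prod>e\<leftarrow>D. w \<tau> * klein28 e (t \<tau>)) = kquot N D (t \<tau>)"
      by (simp add: divide_inverse)
  qed
  thus ?thesis by (simp add: t_def)
qed

context
  fixes a b c d \<alpha> \<gamma> \<delta> :: int and \<tau> :: complex
  assumes det: "a * d - b * c = 1" and \<tau>: "Im \<tau> > 0"
    and cong: "a = 1 + 3136 * \<alpha>" "c = 3136 * \<gamma>" "d = 1 + 3136 * \<delta>"
begin

text \<open>Multiplication of \<open>\<tau>\<close> by 784 conjugates the matrix into one with
  off-diagonal entries \<open>784 * b\<close> and \<open>c / 784 = 4 * \<gamma>\<close>.\<close>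

lemma klein_Gamma1:
  "(of_int c * \<tau> + of_int d) * klein x y (784 * (mob a b c d \<tau>))
      = klein (x + of_int (3136 * \<alpha>) * x + of_int (4 * \<gamma>) * y) (y + of_int (784 * b) * x + of_int (3136 * \<delta>) * y) (784 * \<tau>)"
proof -
  have det': "a * d - (784 * b) * (4 * \<gamma>) = 1" using det by (simp add: cong(2) algebra_simps)
  have \<tau>': "Im (784 * \<tau>) > 0" using \<tau> by simp
  have den: "of_int (4 * \<gamma>) * (784 * \<tau>) + of_int d = of_int c * \<tau> + of_int d" by (simp add: cong(2))
  have num: "(of_int a * (784 * \<tau>) + of_int (784 * b)) / w = 784 * ((of_int a * \<tau> + of_int b) / w)" for w
    by (simp add: field_simps)
  have e: "of_int a * x + of_int (4 * \<gamma>) * y = x + of_int (3136 * \<alpha>) * x + of_int (4 * \<gamma>) * y"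
    "of_int (784 * b) * x + of_int d * y = y + of_int (784 * b) * x + of_int (3136 * \<delta>) * y"
    by (simp_all add: cong algebra_simps)
  show ?thesis using klein_modular[OF det' \<tau>', of x y] unfolding den num e .
qed

text \<open>The characteristic moves by the even integers \<open>112 \<alpha> e\<close> and
  \<open>28 b e\<close>. Only the root of unity in the shift law survives, which is the sign of
  parity \<open>b e^2\<close>.\<close>

lemma klein28_Gamma1:
  "(of_int c * \<tau> + of_int d) * klein28 e (mob a b c d \<tau>) = sg (b * int e) * klein28 e \<tau>"
proof -
  have \<tau>': "Im (784 * \<tau>) > 0" using \<tau> by simp
  define x :: complex where "x = of_nat e / 28"
  have 1: "x + of_int (3136 * \<alpha>) * x + of_int (4 * \<gamma>) * 0 = x + of_int (112 * \<alpha> * int e)"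
    "0 + of_int (784 * b) * x + of_int (3136 * \<delta>) * 0 = 0 + of_int (28 * b * int e)"
    by (simp_all add: x_def)
  have 2: "(x * of_int (28 * b * int e) - 0 * of_int (112 * \<alpha> * int e)) / 2 = of_int (b * int e * int e) / 2"
    by (simp add: x_def)
  have 3: "sg (112 * \<alpha> * int e + 28 * b * int e + 112 * \<alpha> * int e * (28 * b * int e)) = 1"
    "sg (b * int e * int e) = sg (b * int e)"
    by (simp_all add: sg_def)
  show ?thesis unfolding klein28_def x_def[symmetric] klein_Gamma1 1 klein_shift[OF \<tau>'] 2 e2pi_half_int 3 by simp
qed

text \<open>The two forms with second characteristic 1/2 each acquire the sign
  \<open>sg \<gamma>\<close>, caused by the entry \<open>4 * \<gamma>\<close>; in the product these
  signs cancel.\<close>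

lemma klein2_product_Gamma1:
  "(of_int c * \<tau> + of_int d) ^ 3 * klein2_product (mob a b c d \<tau>) = klein2_product \<tau>"
proof -
  have \<tau>': "Im (784 * \<tau>) > 0" using \<tau> by simp
  define w where "w = of_int c * \<tau> + of_int d"
  define t where "t = (of_int a * \<tau> + of_int b) / w"
  note k' = klein_Gamma1[folded w_def, folded t_def]
  have 1: "w * klein (1/2) 0 (784 * t) = klein (1/2) 0 (784 * \<tau>)"
  proof -
    have "w * klein (1/2) 0 (784 * t) = klein (1/2 + of_int (1568 * \<alpha>)) (0 + of_int (392 * b)) (784 * \<tau>)"
      unfolding k' by simp
    also have "\<dots> = sg (1568 * \<alpha> + 392 * b + 1568 * \<alpha> * (392 * b)) * e2pi (of_int (196 * b) / 2) * klein (1/2) 0 (784 * \<tau>)"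
      unfolding klein_shift[OF \<tau>'] by simp
    also have "\<dots> = klein (1/2) 0 (784 * \<tau>)"
      unfolding e2pi_half_int by (simp add: sg_def)
    finally show ?thesis .
  qed
  have 2: "w * klein 0 (1/2) (784 * t) = sg \<gamma> * klein 0 (1/2) (784 * \<tau>)"
  proof -
    have "w * klein 0 (1/2) (784 * t) = klein (0 + of_int (2 * \<gamma>)) (1/2 + of_int (1568 * \<delta>)) (784 * \<tau>)"
      unfolding k' by simp
    also have "\<dots> = sg (2 * \<gamma> + 1568 * \<delta> + 2 * \<gamma> * (1568 * \<delta>)) * e2pi (of_int (-\<gamma>) / 2) * klein 0 (1/2) (784 * \<tau>)"
      unfolding klein_shift[OF \<tau>'] by simp
    also have "\<dots> = sg \<gamma> * klein 0 (1/2) (784 * \<tau>)"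
      unfolding e2pi_half_int by (simp add: sg_def)
    finally show ?thesis .
  qed
  have 3: "w * klein (1/2) (1/2) (784 * t) = sg \<gamma> * klein (1/2) (1/2) (784 * \<tau>)"
  proof -
    have "w * klein (1/2) (1/2) (784 * t) = klein (1/2 + of_int (1568 * \<alpha> + 2 * \<gamma>)) (1/2 + of_int (392 * b + 1568 * \<delta>)) (784 * \<tau>)"
      unfolding k' by (simp add: algebra_simps)
    also have "\<dots> = sg (1568 * \<alpha> + 2 * \<gamma> + (392 * b + 1568 * \<delta>) + (1568 * \<alpha> + 2 * \<gamma>) * (392 * b + 1568 * \<delta>))
        * e2pi (of_int (196 * b + 784 * \<delta> - 784 * \<alpha> - \<gamma>) / 2) * klein (1/2) (1/2) (784 * \<tau>)"
    proof -
      have "(1/2 * of_int (392 * b + 1568 * \<delta>) - 1/2 * of_int (1568 * \<alpha> + 2 * \<gamma>)) / 2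
          = (of_int (196 * b + 784 * \<delta> - 784 * \<alpha> - \<gamma>) / 2 :: complex)"
        by (simp add: field_simps)
      thus ?thesis unfolding klein_shift[OF \<tau>'] by (simp only:)
    qed
    also have "\<dots> = sg \<gamma> * klein (1/2) (1/2) (784 * \<tau>)"
      unfolding e2pi_half_int by (simp add: sg_def)
    finally show ?thesis .
  qed
  have "w ^ 3 * klein2_product t = (w * klein (1/2) 0 (784 * t)) * (w * klein 0 (1/2) (784 * t)) * (w * klein (1/2) (1/2) (784 * t))"
    by (simp add: klein2_product_def power3_eq_cube mult_ac)
  also have "\<dots> = (sg \<gamma> * sg \<gamma>) * klein2_product \<tau>"
    unfolding 1 2 3 klein2_product_def by (simp only: mult_ac)
  also have "sg \<gamma> * sg \<gamma> = 1" by (simp add: sg_def)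
  finally show ?thesis by (simp add: w_def t_def)
qed

text \<open>Numerator and denominator acquire signs of parity \<open>b\<close> times the sum of the
  respective list; the parity condition makes them equal.\<close>

lemma kquot_Gamma1:
  assumes len: "length D = length N + 9" and even: "even (sum_list N + sum_list D)"
  shows "kquot N D (mob a b c d \<tau>) = kquot N D \<tau>"
proof -
  have "sg (b * int (sum_list N)) = sg (b * int (sum_list D))"
    using even by (simp add: sg_def)
  moreover have "sg k \<noteq> 0" for k by (simp add: sg_def)
  moreover note quotient_cancel_weight[OF Im_moebius_pos(1)[OF det \<tau>] len prod_list_scale[OF klein28_Gamma1] klein2_product_Gamma1 prod_list_scale[OF klein28_Gamma1]]
  ultimately show ?thesis unfolding kquot_def by simp
qed

end

section \<open>The products as quotients of Klein forms\<close>

text \<open>The product of the forms \<open>klein28 e\<close> over a list has leading exponent half of this in \<open>e2pi \<tau>\<close>.\<close>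

definition kexp :: "nat list \<Rightarrow> int" where
  "kexp L = (\<Sum>e\<leftarrow>L. int e * int e - 28 * int e)"

text \<open>\<open>JJ p e 28\<close> without its third factor: the part of the Klein form that
  depends on \<open>e\<close>, up to a power of the nome. For \<open>e = 14\<close> it is a
  square.\<close>

definition theta28 :: "complex \<Rightarrow> nat \<Rightarrow> complex" where
  "theta28 p e = qp p e * qp p (28 - e)"

lemma theta28_nonzero: "norm p < 1 \<Longrightarrow> 0 < e \<Longrightarrow> e < 28 \<Longrightarrow> theta28 p e \<noteq> 0"
  by (simp add: theta28_def qp_nonzero)

lemma prod_theta28_nonzero:
  "norm p < 1 \<Longrightarrow> (\<And>e. e \<in> set L \<Longrightarrow> 0 < e \<and> e < 28) \<Longrightarrow> (\<Prod>e\<leftarrow>L. theta28 p e) \<noteq> 0"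
  by (induction L) (auto simp: theta28_nonzero)

context
  fixes p :: complex
  assumes p: "norm p < 1"
begin

lemma J4_qp: "J p 4 = qp p 4 * qp p 8 * qp p 12 * qp p 16 * qp p 20 * qp p 24 * qp p 28"
  using qpoch_inf_eq_prod_qp[OF p, of 4 7 4] by (simp add: J_def lessThan_nat_numeral mult_ac)

text \<open>\<open>J p 2\<close> contains the even residues and \<open>J p 4\<close> the multiples
  of 4; two copies of \<open>qp p 14\<close> form \<open>theta28 p 14\<close>. All powers of
  \<open>qp p 28\<close> cancel.\<close>

lemma theta_quotient:
  "J p 4 * JJ p c 28 / (J p 2)\<^sup>2 = (\<Prod>e\<leftarrow>[c]. theta28 p e) / (\<Prod>e\<leftarrow>[2, 2, 4, 6, 6, 8, 10, 10, 12, 14]. theta28 p e)" (is "?a / ?b = ?c / ?d")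
proof (rule divide_eqI_cross)
  show "?b \<noteq> 0" by (simp add: J2_qp[OF p] qp_nonzero[OF p])
  show "?d \<noteq> 0" by (rule prod_theta28_nonzero[OF p]) auto
  show "?a * ?d = ?c * ?b"
    unfolding J4_qp J2_qp[OF p] JJ_qp[OF p] theta28_def list.map prod_list.Cons prod_list.Nil power2_eq_square
    by (simp only: mult_ac mult_1_right mult_1_left diff_numeral_Suc arith_simps) simp
qed

text \<open>\<open>J p 1 / J p 2\<close> contains exactly the odd residues, whence the entries 1, 3,
  ..., 13 at the end of the denominator; the square of \<open>J p 14\<close> yields the entry 14.
  Again the powers of \<open>qp p 28\<close> cancel.\<close>

lemma eta_quotient_1:
  "J p 2 * (J p 14)\<^sup>2 * J p 28 * JJ p 2 28 * JJ p 6 28 / (J p 1 * JJ p 1 28 * JJ p 4 28 * JJ p 7 28 * JJ p 12 28 * JJ p 13 28) = (\<Prod>e\<leftarrow>[2, 6, 14]. theta28 p e) / (\<Prod>e\<leftarrow>[1, 4, 7, 12, 13, 1, 3, 5, 7, 9, 11, 13]. theta28 p e)" (is "?a / ?b = ?c / ?d")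
proof (rule divide_eqI_cross)
  show "?b \<noteq> 0"
    by (simp add: J1_qp[OF p, unfolded One_nat_def] JJ_qp[OF p] qp_nonzero[OF p])
  show "?d \<noteq> 0" by (rule prod_theta28_nonzero[OF p]) auto
  show "?a * ?d = ?c * ?b"
    unfolding J1_qp[OF p] J2_qp[OF p] J14_qp[OF p] J28_qp[OF p] JJ_qp[OF p] theta28_def list.map prod_list.Cons prod_list.Nil power2_eq_square
    by (simp only: mult_ac mult_1_right mult_1_left diff_numeral_Suc arith_simps) simp
qed

lemma eta_quotient_2:
  "J p 2 * (J p 14)\<^sup>2 * J p 28 * JJ p 6 28 * JJ p 10 28 / (J p 1 * JJ p 3 28 * JJ p 7 28 * JJ p 8 28 * JJ p 11 28 * JJ p 12 28) = (\<Prod>e\<leftarrow>[6, 10, 14]. theta28 p e) / (\<Prod>e\<leftarrow>[3, 7, 8, 11, 12, 1, 3, 5, 7, 9, 11, 13]. theta28 p e)" (is "?a / ?b = ?c / ?d")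
proof (rule divide_eqI_cross)
  show "?b \<noteq> 0"
    by (simp add: J1_qp[OF p, unfolded One_nat_def] JJ_qp[OF p] qp_nonzero[OF p])
  show "?d \<noteq> 0" by (rule prod_theta28_nonzero[OF p]) auto
  show "?a * ?d = ?c * ?b"
    unfolding J1_qp[OF p] J2_qp[OF p] J14_qp[OF p] J28_qp[OF p] JJ_qp[OF p] theta28_def list.map prod_list.Cons prod_list.Nil power2_eq_square
    by (simp only: mult_ac mult_1_right mult_1_left diff_numeral_Suc arith_simps) simp
qed

lemma eta_quotient_3:
  "J p 2 * (J p 14)\<^sup>2 * J p 28 * JJ p 2 28 * JJ p 10 28 / (J p 1 * JJ p 4 28 * JJ p 5 28 * JJ p 7 28 * JJ p 8 28 * JJ p 9 28) = (\<Prod>e\<leftarrow>[2, 10, 14]. theta28 p e) / (\<Prod>e\<leftarrow>[4, 5, 7, 8, 9, 1, 3, 5, 7, 9, 11, 13]. theta28 p e)" (is "?a / ?b = ?c / ?d")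
proof (rule divide_eqI_cross)
  show "?b \<noteq> 0"
    by (simp add: J1_qp[OF p, unfolded One_nat_def] JJ_qp[OF p] qp_nonzero[OF p])
  show "?d \<noteq> 0" by (rule prod_theta28_nonzero[OF p]) auto
  show "?a * ?d = ?c * ?b"
    unfolding J1_qp[OF p] J2_qp[OF p] J14_qp[OF p] J28_qp[OF p] JJ_qp[OF p] theta28_def list.map prod_list.Cons prod_list.Nil power2_eq_square
    by (simp only: mult_ac mult_1_right mult_1_left diff_numeral_Suc arith_simps) simp
qed

end

text \<open>Euler's identity \<open>(r;r^2) (-r;r) = 1\<close>, the equality of the numbers of
  partitions into odd and into distinct parts. It collapses the three forms of level 2 to a pure
  power of \<open>(r;r)\<close>.\<close>

lemma Euler_odd_product:
  assumes r: "norm r < 1" and b: "b\<^sup>2 = r"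
  shows "qpoch_inf b r * qpoch_inf (-b) r * qpoch_inf (-r) r = 1"
proof -
  have r2: "norm (r\<^sup>2) < 1" using r by (simp add: norm_power power_less_one_iff)
  have nz: "qpoch_inf (r\<^sup>2) (r\<^sup>2) \<noteq> 0" by (rule qpoch_inf_nonzero[OF r2 r2])
  have "qpoch_inf b r * qpoch_inf (-b) r = qpoch_inf r (r\<^sup>2)"
    using qpoch_inf_mult_uminus[OF r, of b] by (simp add: b)
  moreover have "qpoch_inf r r = qpoch_inf r (r\<^sup>2) * qpoch_inf (r\<^sup>2) (r\<^sup>2)"
    using qpoch_inf_multisection[OF r, of 2 r] by (simp add: numeral_2_eq_2 lessThan_Suc mult_ac)
  moreover have "qpoch_inf r r * qpoch_inf (-r) r = qpoch_inf (r\<^sup>2) (r\<^sup>2)"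
    by (rule qpoch_inf_mult_uminus[OF r])
  ultimately have "(qpoch_inf b r * qpoch_inf (-b) r * qpoch_inf (-r) r) * qpoch_inf (r\<^sup>2) (r\<^sup>2) = 1 * qpoch_inf (r\<^sup>2) (r\<^sup>2)"
    by (simp add: mult_ac)
  thus ?thesis using nz by (simp only: mult_cancel_right) auto
qed

context
  fixes \<tau> p :: complex
  assumes \<tau>: "Im \<tau> > 0" and p: "p = e2pi (28 * \<tau>)"
begin

lemma norm_p: "norm p < 1"
  unfolding p by (rule norm_e2pi_less_1) (use \<tau> in simp)

lemma p_power: "p ^ n = e2pi (of_nat (28 * n) * \<tau>)"
  unfolding p e2pi_of_nat_mult[symmetric] by (simp add: mult.assoc mult.left_commute)

lemma xa28: "qp p 28 \<noteq> 0"
  by (rule qp_nonzero[OF norm_p]) simp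

lemma klein28_product:
  assumes "0 < e" "e < 28"
  shows "klein28 e \<tau> = e2pi (of_int (int e * int e - 28 * int e) * \<tau> / 2) * theta28 p e / (qp p 28)\<^sup>2"
proof -
  have 1: "e2pi (((of_nat e / 28)\<^sup>2 - of_nat e / 28) * (784 * \<tau>) / 2) = e2pi (of_int (int e * int e - 28 * int e) * \<tau> / 2)"
    by (rule arg_cong[where f = e2pi]) (simp add: field_simps power2_eq_square)
  have 2: "e2pi (of_nat e / 28 * (784 * \<tau>)) = p ^ e"
    unfolding p_power by (rule arg_cong[where f = e2pi]) simp
  have 3: "e2pi ((1 - of_nat e / 28) * (784 * \<tau>)) = p ^ (28 - e)"
    unfolding p_power by (rule arg_cong[where f = e2pi]) (use assms in \<open>simp add: of_nat_diff algebra_simps\<close>)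
  have 4: "e2pi (784 * \<tau>) = p ^ 28"
    unfolding p_power by simp
  show ?thesis
    unfolding klein28_def klein_q_expansion 1 2 3 4 by (simp add: theta28_def qp_def)
qed

lemma prod_klein28:
  assumes "\<And>e. e \<in> set L \<Longrightarrow> 0 < e \<and> e < 28"
  shows "(\<Prod>e\<leftarrow>L. klein28 e \<tau>) = e2pi (of_int (kexp L) * \<tau> / 2) * (\<Prod>e\<leftarrow>L. theta28 p e) / (qp p 28) ^ (2 * length L)"
  using assms
proof (induction L)
  case Nil thus ?case by (simp add: kexp_def)
next
  case (Cons e L)
  have "e2pi (of_int (kexp (e # L)) * \<tau> / 2) = e2pi (of_int (int e * int e - 28 * int e) * \<tau> / 2) * e2pi (of_int (kexp L) * \<tau> / 2)"
    unfolding e2pi_add[symmetric] by (rule arg_cong[where f = e2pi]) (simp add: kexp_def field_simps)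
  moreover have "klein28 e \<tau> = e2pi (of_int (int e * int e - 28 * int e) * \<tau> / 2) * theta28 p e / (qp p 28)\<^sup>2"
    using Cons.prems[of e] by (intro klein28_product) auto
  moreover have "(\<Prod>e\<leftarrow>L. klein28 e \<tau>) = e2pi (of_int (kexp L) * \<tau> / 2) * (\<Prod>e\<leftarrow>L. theta28 p e) / (qp p 28) ^ (2 * length L)"
    using Cons by auto
  moreover have "(qp p 28) ^ (2 * length (e # L)) = (qp p 28)\<^sup>2 * (qp p 28) ^ (2 * length L)"
    by (simp flip: power_add)
  ultimately show ?case by (simp only: list.map prod_list.Cons times_divide_times_eq mult_ac)
qed

text \<open>The exponent -196 = -6 * 784 / 24 is that of the sixth power of the reciprocal eta
  function. The factor 2 is the first factor of the symbol with parameter -1 belonging to the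
  characteristic \<open>(0, 1/2)\<close>.\<close>

lemma klein2_product_product: "klein2_product \<tau> = 2 * e2pi (-3/8) * e2pi (- 196 * \<tau>) / (qp p 28) ^ 6"
proof -
  define r where "r = p ^ 28"
  define b where "b = p ^ 14"
  have r: "norm r < 1" unfolding r_def using norm_p by (simp add: norm_power power_less_one_iff)
  have b: "b\<^sup>2 = r" by (simp add: b_def r_def flip: power_mult)
  have eb: "e2pi (392 * \<tau>) = b" and er: "e2pi (784 * \<tau>) = r"
    unfolding b_def r_def p_power by simp_all
  have half: "e2pi (1/2) = -1" "e2pi (-1/2) = -1"
    using e2pi_half_int[of 1] e2pi_half_int[of "-1"] by simp_all
  have k1: "klein (1/2) 0 (784 * \<tau>) = e2pi (- 98 * \<tau>) * (qpoch_inf b r)\<^sup>2 / (qpoch_inf r r)\<^sup>2"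
    unfolding klein_q_expansion er by (simp add: power2_eq_square eb)
  have k2: "klein 0 (1/2) (784 * \<tau>) = 2 * e2pi (-1/4) * (qpoch_inf (-r) r)\<^sup>2 / (qpoch_inf r r)\<^sup>2"
    unfolding klein_q_expansion er using half qpoch_inf_unfold_1[OF r, of "-1"]
    by (simp add: power2_eq_square er)
  have k3: "klein (1/2) (1/2) (784 * \<tau>) = e2pi (-1/8) * e2pi (- 98 * \<tau>) * (qpoch_inf (-b) r)\<^sup>2 / (qpoch_inf r r)\<^sup>2"
    unfolding klein_q_expansion er using half by (simp add: power2_eq_square eb)
  have e: "e2pi (-3/8) = e2pi (-1/4) * e2pi (-1/8)" "e2pi (- 196 * \<tau>) = e2pi (- 98 * \<tau>) * e2pi (- 98 * \<tau>)"
    by (simp_all flip: e2pi_add)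
  have "klein2_product \<tau> = 2 * e2pi (-3/8) * e2pi (- 196 * \<tau>) * (qpoch_inf b r * qpoch_inf (-b) r * qpoch_inf (-r) r)\<^sup>2 / (qpoch_inf r r) ^ 6"
    unfolding klein2_product_def k1 k2 k3 e by (simp add: power2_eq_square eval_nat_numeral mult_ac)
  thus ?thesis unfolding Euler_odd_product[OF r b] by (simp add: qp_def r_def)
qed

text \<open>The condition on \<open>t\<close> matches leading exponents, 588 = 3 * 196 being the
  share of the cubed product of level 2. Its denominator \<open>x ^ 18\<close> cancels the squares
  \<open>x ^ 2\<close> of the nine surplus forms in \<open>D\<close>.\<close>

lemma kquot_product:
  assumes "\<And>e. e \<in> set N \<union> set D \<Longrightarrow> 0 < e \<and> e < 28" and len: "length D = length N + 9"
    and t: "kexp N - kexp D = 2 * (t + 588)"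
  shows "e2pi (of_int t * \<tau>) * ((\<Prod>e\<leftarrow>N. theta28 p e) / (\<Prod>e\<leftarrow>D. theta28 p e)) = inverse ((2 * e2pi (-3/8)) ^ 3) * kquot N D \<tau>"
proof -
  define x where "x = qp p 28"
  define P where "P = (\<Prod>e\<leftarrow>N. theta28 p e)"
  define R where "R = (\<Prod>e\<leftarrow>D. theta28 p e)"
  have x: "x \<noteq> 0" using xa28 by (simp add: x_def)
  have N: "(\<Prod>e\<leftarrow>N. klein28 e \<tau>) = e2pi (of_int (kexp N) * \<tau> / 2) * P / x ^ (2 * length N)"
    and D: "(\<Prod>e\<leftarrow>D. klein28 e \<tau>) = e2pi (of_int (kexp D) * \<tau> / 2) * R / x ^ (2 * length D)"
    unfolding x_def P_def R_def by (rule prod_klein28; use assms in auto)+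
  have R: "R \<noteq> 0" unfolding R_def by (rule prod_theta28_nonzero[OF norm_p]) (use assms in auto)
  have xD: "x ^ (2 * length D) = x ^ (2 * length N) * x ^ 18"
    unfolding len by (simp flip: power_add)
  have e: "e2pi (of_int (kexp N) * \<tau> / 2) * e2pi (- 196 * \<tau>) ^ 3 = e2pi (of_int t * \<tau>) * e2pi (of_int (kexp D) * \<tau> / 2)"
  proof -
    have "kexp N = kexp D + 2 * (t + 588)" using t by simp
    hence "of_int (kexp N) * \<tau> / 2 + of_nat 3 * (- 196 * \<tau>) = of_int t * \<tau> + of_int (kexp D) * \<tau> / 2"
      by (simp add: field_simps)
    thus ?thesis by (simp only: e2pi_of_nat_mult[symmetric] e2pi_add[symmetric])
  qed
  have "kquot N D \<tau> = (e2pi (of_int (kexp N) * \<tau> / 2) * e2pi (- 196 * \<tau>) ^ 3) * (2 * e2pi (-3/8)) ^ 3 * P / (e2pi (of_int (kexp D) * \<tau> / 2) * R)"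
    unfolding kquot_def N D klein2_product_product x_def[symmetric] xD
    using x R by (simp add: power_divide power_mult_distrib field_simps flip: power_mult)
  also have "\<dots> = e2pi (of_int t * \<tau>) * (2 * e2pi (-3/8)) ^ 3 * P / R"
    unfolding e by simp
  finally show ?thesis by (simp add: P_def R_def)
qed

end

section \<open>Modularity\<close>

lemma open_upper_half_plane: "open upper_half_plane"
  unfolding upper_half_plane_def by (rule open_halfspace_Im_gt)

lemma holomorphic_on_prod_theta28:
  "(\<lambda>\<tau>. \<Prod>e\<leftarrow>L. theta28 (e2pi (28 * \<tau>)) e) holomorphic_on upper_half_plane"
proof -
  have less: "norm (e2pi (28 * \<tau>)) < 1" if "\<tau> \<in> upper_half_plane" for \<tau>
    using that by (intro norm_e2pi_less_1) (simp add: upper_half_plane_def)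
  have qp: "(\<lambda>\<tau>. qp (e2pi (28 * \<tau>)) a) holomorphic_on upper_half_plane" for a
  proof (rule holomorphic_transform)
    show "(\<lambda>\<tau>. qpoch_inf (e2pi (28 * \<tau>) ^ a) (e2pi (28 * \<tau>) ^ 28)) holomorphic_on upper_half_plane"
    proof (rule holomorphic_on_qpoch_inf[OF open_upper_half_plane])
      fix \<tau> assume "\<tau> \<in> upper_half_plane"
      from less[OF this] show "norm (e2pi (28 * \<tau>) ^ 28) < 1" by (simp add: norm_power power_less_one_iff)
    qed (intro holomorphic_intros)+
  qed (simp add: qp_def less)
  show ?thesis
    by (induction L) (auto simp: theta28_def intro!: holomorphic_intros qp)
qed

lemma kquot_holomorphic:
  assumes "\<And>e. e \<in> set N \<union> set D \<Longrightarrow> 0 < e \<and> e < 28" and "length D = length N + 9"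
    and "kexp N - kexp D = 2 * (t + 588)"
  shows "kquot N D holomorphic_on upper_half_plane"
proof (rule holomorphic_transform)
  let ?c = "(2 * e2pi (-3/8)) ^ 3"
  have nz: "(\<Prod>e\<leftarrow>D. theta28 (e2pi (28 * \<tau>)) e) \<noteq> 0" if "\<tau> \<in> upper_half_plane" for \<tau>
    by (rule prod_theta28_nonzero) (use assms that in \<open>auto simp: upper_half_plane_def intro!: norm_e2pi_less_1\<close>)
  show "(\<lambda>\<tau>. ?c * (e2pi (of_int t * \<tau>) * ((\<Prod>e\<leftarrow>N. theta28 (e2pi (28 * \<tau>)) e) / (\<Prod>e\<leftarrow>D. theta28 (e2pi (28 * \<tau>)) e))))
          holomorphic_on upper_half_plane"
    by (intro holomorphic_intros holomorphic_on_prod_theta28 nz)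
  fix \<tau> assume "\<tau> \<in> upper_half_plane"
  hence "Im \<tau> > 0" by (simp add: upper_half_plane_def)
  hence "e2pi (of_int t * \<tau>) * ((\<Prod>e\<leftarrow>N. theta28 (e2pi (28 * \<tau>)) e) / (\<Prod>e\<leftarrow>D. theta28 (e2pi (28 * \<tau>)) e)) = inverse ?c * kquot N D \<tau>"
    by (rule kquot_product[OF _ refl assms])
  hence "?c * (e2pi (of_int t * \<tau>) * ((\<Prod>e\<leftarrow>N. theta28 (e2pi (28 * \<tau>)) e) / (\<Prod>e\<leftarrow>D. theta28 (e2pi (28 * \<tau>)) e))) = ?c * (inverse ?c * kquot N D \<tau>)"
    by (rule arg_cong)
  also have "\<dots> = kquot N D \<tau>" by simp
  finally show "?c * (e2pi (of_int t * \<tau>) * ((\<Prod>e\<leftarrow>N. theta28 (e2pi (28 * \<tau>)) e) / (\<Prod>e\<leftarrow>D. theta28 (e2pi (28 * \<tau>)) e))) = kquot N D \<tau>" .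
qed

lemma act_eq: "act \<gamma> \<tau> = (of_int (\<gamma>$1$1) * \<tau> + of_int (\<gamma>$1$2)) / (of_int (\<gamma>$2$1) * \<tau> + of_int (\<gamma>$2$2))"
  by (simp add: act_def moebius_def)

lemma SL2Z_det: "\<gamma> \<in> SL2Z \<Longrightarrow> \<gamma>$1$1 * \<gamma>$2$2 - \<gamma>$1$2 * \<gamma>$2$1 = 1"
  by (simp add: SL2Z_def det_2)

lemma act_upper_half_plane:
  assumes "\<gamma> \<in> SL2Z" "\<tau> \<in> upper_half_plane"
  shows "act \<gamma> \<tau> \<in> upper_half_plane"
  using Im_moebius_pos(2)[OF SL2Z_det[OF assms(1)], of \<tau>] assms(2)
  by (simp add: upper_half_plane_def act_eq)

text \<open>The quotients have no poles in the upper half-plane, so nice meromorphy follows from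
  holomorphy; invariance and the behaviour at the cusps hold for each of the two terms
  separately.\<close>

theorem modular_function_on_kquot_combination:
  assumes f: "\<And>\<tau>. \<tau> \<in> upper_half_plane \<Longrightarrow> f \<tau> = k1 * kquot N1 D1 \<tau> + k2 * kquot N2 D2 \<tau>"
    and 1: "\<And>e. e \<in> set N1 \<union> set D1 \<Longrightarrow> 0 < e \<and> e < 28" "length D1 = length N1 + 9"
      "kexp N1 - kexp D1 = 2 * (t1 + 588)" "even (sum_list N1 + sum_list D1)"
    and 2: "\<And>e. e \<in> set N2 \<union> set D2 \<Longrightarrow> 0 < e \<and> e < 28" "length D2 = length N2 + 9"
      "kexp N2 - kexp D2 = 2 * (t2 + 588)" "even (sum_list N2 + sum_list D2)"
  shows "modular_function_on f (Gamma1 3136)"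
  unfolding modular_function_on_def
proof (intro conjI ballI)
  have "f holomorphic_on upper_half_plane"
  proof (rule holomorphic_transform)
    show "(\<lambda>\<tau>. k1 * kquot N1 D1 \<tau> + k2 * kquot N2 D2 \<tau>) holomorphic_on upper_half_plane"
      by (intro holomorphic_intros kquot_holomorphic[OF 1(1-3)] kquot_holomorphic[OF 2(1-3)])
  qed (simp add: f)
  hence "f analytic_on upper_half_plane"
    by (simp add: analytic_on_open open_upper_half_plane)
  thus "f nicely_meromorphic_on upper_half_plane"
    by (rule analytic_on_imp_nicely_meromorphic_on)
next
  fix \<gamma> \<tau> assume \<gamma>: "\<gamma> \<in> Gamma1 3136" and \<tau>: "\<tau> \<in> upper_half_plane"
  have SL: "\<gamma> \<in> SL2Z" and cong: "[\<gamma>$1$1 = 1] (mod 3136)" "[\<gamma>$2$1 = 0] (mod 3136)" "[\<gamma>$2$2 = 1] (mod 3136)"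
    using \<gamma> by (auto simp: Gamma1_def)
  have \<tau>0: "Im \<tau> > 0" using \<tau> by (simp add: upper_half_plane_def)
  obtain \<alpha> \<delta> where a: "\<gamma>$1$1 = 1 + 3136 * \<alpha>" and d: "\<gamma>$2$2 = 1 + 3136 * \<delta>"
    using cong(1,3) by (metis cong_iff_lin cong_sym)
  obtain k where c: "\<gamma>$2$1 = 3136 * k"
    using cong(2) by (auto simp: cong_0_iff)
  note G = kquot_Gamma1[OF SL2Z_det[OF SL] \<tau>0 a c d]
  show "f (act \<gamma> \<tau>) = f \<tau>"
    unfolding f[OF \<tau>] f[OF act_upper_half_plane[OF SL \<tau>]] unfolding act_eq G[OF 1(2,4)] G[OF 2(2,4)] ..
next
  fix \<gamma> assume SL: "\<gamma> \<in> SL2Z"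
  have "cusp_mero (\<lambda>\<tau>. k1 * kquot N1 D1 (act \<gamma> \<tau>) + k2 * kquot N2 D2 (act \<gamma> \<tau>))"
    unfolding act_eq
    by (intro cusp_mero_add cusp_mero_mult cusp_mero_const kquot_cusp[OF SL2Z_det[OF SL] 1(2)] kquot_cusp[OF SL2Z_det[OF SL] 2(2)])
  hence "cusp_mero (\<lambda>\<tau>. f (act \<gamma> \<tau>))"
    by (rule cusp_mero_cong) (use f act_upper_half_plane[OF SL] in \<open>auto simp: upper_half_plane_def\<close>)
  thus "meromorphic_at_cusp f \<gamma>"
    by (simp add: cusp_mero_def meromorphic_at_cusp_def e2pi_def)
qed

section \<open>Specialisation to the three Nahm sums\<close>

context
  fixes \<tau> :: complex
  assumes \<tau>: "Im \<tau> > 0"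
begin

text \<open>The nome of the Nahm sum at \<open>56 * \<tau>\<close> is the eighth power of
  \<open>e2pi (7 * \<tau>)\<close>; 8 and 56 are common denominators of the vectors \<open>B\<close>
  and of the scalars \<open>C\<close>.\<close>

lemma nahm_sum_eq:
  fixes B :: "real^2" and C :: real and a c t :: int
  assumes B: "8 * B$1 = of_int a" "8 * B$2 = of_int c" and C: "56 * C = of_int t"
    and S: "((\<lambda>(i, j). e2pi (7 * \<tau>) powi (4 * (int i)^2 + 3 * (int j)^2 - 4 * int i * int j + a * int i + c * int j)
             / (qpoch (e2pi (7 * \<tau>)^8) (e2pi (7 * \<tau>)^8) i * qpoch (e2pi (7 * \<tau>)^8) (e2pi (7 * \<tau>)^8) j)) has_sum S) UNIV"
  shows "nahm_sum (vector [vector [1, -1/2], vector [-1/2, 3/4]]) B C (56 * \<tau>) = e2pi (of_int t * \<tau>) * S"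
proof -
  have powi: "e2pi (7 * \<tau>) powi k = e2pi (of_int k * (7 * \<tau>))" for k
  proof (cases "k \<ge> 0")
    case True
    then obtain n where "k = int n" using nonneg_int_cases by blast
    thus ?thesis by (simp add: e2pi_of_nat_mult)
  next
    case False
    then obtain n where "k = - int n" by (metis int_cases4 less_imp_le linorder_not_le neg_int_cases)
    thus ?thesis by (simp add: e2pi_of_nat_mult[symmetric] e2pi_minus power_int_minus)
  qed
  have q8: "qpow (56 * \<tau>) 1 = e2pi (7 * \<tau>) ^ 8"
    by (subst e2pi_of_nat_mult[symmetric]) (simp add: qpow_def e2pi_def)
  have summand: "qpow (56 * \<tau>) (1/2 * (n \<bullet> ((vector [vector [1, -1/2], vector [-1/2, 3/4]] :: real^2^2) *v n)) + n \<bullet> B + C)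
      = e2pi (of_int t * \<tau>) * e2pi (7 * \<tau>) powi (4 * (int i)^2 + 3 * (int j)^2 - 4 * int i * int j + a * int i + c * int j)"
    if n: "n = vector [real i, real j]" for n i j
  proof -
    define x where "x = 1/2 * (n \<bullet> ((vector [vector [1, -1/2], vector [-1/2, 3/4]] :: real^2^2) *v n)) + n \<bullet> B + C"
    have "56 * x = 28 * (real i)\<^sup>2 - 28 * real i * real j + 21 * (real j)\<^sup>2 + 7 * (real i * (8 * B$1) + real j * (8 * B$2)) + 56 * C"
      unfolding x_def n
      by (simp add: inner_vec_def sum_2 matrix_vector_mult_def power2_eq_square algebra_simps)
    also have "\<dots> = of_int (t + 7 * (4 * (int i)^2 + 3 * (int j)^2 - 4 * int i * int j + a * int i + c * int j))"
      unfolding B C by (simp add: algebra_simps)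
    finally have "complex_of_real (56 * x) = of_int (t + 7 * (4 * (int i)^2 + 3 * (int j)^2 - 4 * int i * int j + a * int i + c * int j))"
      by (metis of_real_of_int_eq)
    hence x: "56 * complex_of_real x = of_int (t + 7 * (4 * (int i)^2 + 3 * (int j)^2 - 4 * int i * int j + a * int i + c * int j))"
      by simp
    have "qpow (56 * \<tau>) x = e2pi (56 * complex_of_real x * \<tau>)"
      by (simp add: qpow_def e2pi_def mult_ac)
    also have "\<dots> = e2pi (of_int t * \<tau>) * e2pi (7 * \<tau>) powi (4 * (int i)^2 + 3 * (int j)^2 - 4 * int i * int j + a * int i + c * int j)"
      unfolding x powi e2pi_add[symmetric] by (rule arg_cong[where f = e2pi]) (simp add: algebra_simps)
    finally show ?thesis unfolding x_def .
  qed
  have "((\<lambda>(n1, n2). let n = vector [real n1, real n2] :: real^2; q = qpow (56 * \<tau>) 1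
        in qpow (56 * \<tau>) (1/2 * (n \<bullet> ((vector [vector [1, -1/2], vector [-1/2, 3/4]] :: real^2^2) *v n)) + n \<bullet> B + C) / (qpoch q q n1 * qpoch q q n2))
      has_sum e2pi (of_int t * \<tau>) * S) UNIV"
    using has_sum_cmult_right[OF S, of "e2pi (of_int t * \<tau>)"]
    unfolding Let_def q8 summand[OF refl] by (simp add: case_prod_unfold)
  thus ?thesis unfolding nahm_sum_def by (rule infsumI)
qed

lemma ex7: "norm (e2pi (7 * \<tau>)) < 1" "e2pi (7 * \<tau>) \<noteq> 0" "e2pi (7 * \<tau>) ^ 4 = e2pi (28 * \<tau>)" "norm (e2pi (28 * \<tau>)) < 1"
  using \<tau> by (auto intro!: norm_e2pi_less_1 simp flip: e2pi_of_nat_mult)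

lemma J_28: "J (e2pi (7 * \<tau>)) (4 * m) = J (e2pi (28 * \<tau>)) m"
  using J_p[OF ex7(1,2) refl, of m] ex7(3) by simp

lemma JJ_28: "JJ (e2pi (7 * \<tau>)) (4 * m) 112 = JJ (e2pi (28 * \<tau>)) m 28"
  using JJ_p[OF ex7(1,2) refl, of m] ex7(3) by simp

lemmas J_JJ_28 = J_28[of 1, unfolded mult_1_right] J_28[of 2, simplified] J_28[of 4, simplified] J_28[of 14, simplified] J_28[of 28, simplified]
  JJ_28[of 1, unfolded mult_1_right] JJ_28[of 2, simplified] JJ_28[of 3, simplified] JJ_28[of 4, simplified] JJ_28[of 5, simplified]
  JJ_28[of 6, simplified] JJ_28[of 7, simplified] JJ_28[of 8, simplified] JJ_28[of 9, simplified] JJ_28[of 10, simplified]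
  JJ_28[of 11, simplified] JJ_28[of 12, simplified] JJ_28[of 13, simplified]

lemma e2pi_shift: "e2pi (of_int t * \<tau>) * e2pi (7 * \<tau>) ^ d = e2pi (of_int (t + 7 * int d) * \<tau>)"
  unfolding e2pi_of_nat_mult[symmetric] e2pi_add[symmetric] by (rule arg_cong[where f = e2pi]) (simp add: algebra_simps)

end

text \<open>The two conditions on \<open>kexp\<close> share the number \<open>t = 56 * C\<close>,
  while \<open>7 * d1\<close> and \<open>7 * d2\<close> come from the powers of \<open>q\<close> in
  front of the products: a single value of \<open>C\<close> has to make both terms modular.\<close>

lemma modular_function_on_nahm_sum:
  fixes B :: "real^2" and a c t :: int
  assumes B: "8 * B$1 = of_int a" "8 * B$2 = of_int c" and C: "56 * C = of_int t"
    and S: "\<And>q. norm q < 1 \<Longrightarrow> ((\<lambda>(i, j). q powi (4 * (int i)^2 + 3 * (int j)^2 - 4 * int i * int j + a * int i + c * int j)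
             / (qpoch (q^8) (q^8) i * qpoch (q^8) (q^8) j)) has_sum R q) UNIV"
    and R: "\<And>\<tau> q p. Im \<tau> > 0 \<Longrightarrow> q = e2pi (7 * \<tau>) \<Longrightarrow> p = e2pi (28 * \<tau>) \<Longrightarrow> norm p < 1 \<Longrightarrow> R q
        = k1 * q ^ d1 * ((\<Prod>e\<leftarrow>N1. theta28 p e) / (\<Prod>e\<leftarrow>D1. theta28 p e)) + k2 * q ^ d2 * ((\<Prod>e\<leftarrow>N2. theta28 p e) / (\<Prod>e\<leftarrow>D2. theta28 p e))"
    and 1: "\<And>e. e \<in> set N1 \<union> set D1 \<Longrightarrow> 0 < e \<and> e < 28" "length D1 = length N1 + 9"
      "kexp N1 - kexp D1 = 2 * (t + 7 * int d1 + 588)" "even (sum_list N1 + sum_list D1)"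
    and 2: "\<And>e. e \<in> set N2 \<union> set D2 \<Longrightarrow> 0 < e \<and> e < 28" "length D2 = length N2 + 9"
      "kexp N2 - kexp D2 = 2 * (t + 7 * int d2 + 588)" "even (sum_list N2 + sum_list D2)"
  shows "modular_function_on
           (\<lambda>\<tau>. nahm_sum (vector [vector [1, -1/2], vector [-1/2, 3/4]]) B C (56 * \<tau>)) (Gamma1 3136)"
proof (rule modular_function_on_kquot_combination[OF _ 1 2])
  fix \<tau> assume "\<tau> \<in> upper_half_plane"
  hence \<tau>: "Im \<tau> > 0" by (simp add: upper_half_plane_def)
  define q where "q = e2pi (7 * \<tau>)"
  define p where "p = e2pi (28 * \<tau>)"
  define \<kappa> where "\<kappa> = inverse ((2 * e2pi (-3/8)) ^ 3)"
  note p = ex7(4)[OF \<tau>, folded p_def]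
  define P1 where "P1 = (\<Prod>e\<leftarrow>N1. theta28 p e) / (\<Prod>e\<leftarrow>D1. theta28 p e)"
  define P2 where "P2 = (\<Prod>e\<leftarrow>N2. theta28 p e) / (\<Prod>e\<leftarrow>D2. theta28 p e)"
  have "nahm_sum (vector [vector [1, -1/2], vector [-1/2, 3/4]]) B C (56 * \<tau>) = e2pi (of_int t * \<tau>) * R q"
    unfolding q_def by (rule nahm_sum_eq[OF \<tau> B C S[OF ex7(1)[OF \<tau>]]])
  also have "\<dots> = k1 * (e2pi (of_int t * \<tau>) * q ^ d1 * P1) + k2 * (e2pi (of_int t * \<tau>) * q ^ d2 * P2)"
    unfolding R[OF \<tau> q_def p_def p] P1_def[symmetric] P2_def[symmetric] by (simp only: distrib_left mult_ac)
  also have "e2pi (of_int t * \<tau>) * q ^ d1 * P1 = \<kappa> * kquot N1 D1 \<tau>"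
    unfolding q_def e2pi_shift[OF \<tau>] \<kappa>_def P1_def by (rule kquot_product[OF \<tau> p_def 1(1-3)])
  also have "e2pi (of_int t * \<tau>) * q ^ d2 * P2 = \<kappa> * kquot N2 D2 \<tau>"
    unfolding q_def e2pi_shift[OF \<tau>] \<kappa>_def P2_def by (rule kquot_product[OF \<tau> p_def 2(1-3)])
  finally show "nahm_sum (vector [vector [1, -1/2], vector [-1/2, 3/4]]) B C (56 * \<tau>)
    = k1 * inverse ((2 * e2pi (-3/8)) ^ 3) * kquot N1 D1 \<tau> + k2 * inverse ((2 * e2pi (-3/8)) ^ 3) * kquot N2 D2 \<tau>"
    unfolding \<kappa>_def by (simp only: mult.assoc)
qed

lemma modular_1:
  "modular_function_on (\<lambda>\<tau>. nahm_sum (vector [vector [1, -1/2], vector [-1/2, 3/4]]) (vector [-1/2, 1/4]) (1/28) (56 * \<tau>)) (Gamma1 3136)"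
proof (rule modular_function_on_nahm_sum[where R = rhs1 and a = "-4" and c = 2 and t = "2"
    and ?N1.0 = "[12]" and ?D1.0 = "[2, 2, 4, 6, 6, 8, 10, 10, 12, 14]" and ?k1.0 = 2 and ?d1.0 = 0
    and ?N2.0 = "[2, 6, 14]" and ?D2.0 = "[1, 4, 7, 12, 13, 1, 3, 5, 7, 9, 11, 13]" and ?k2.0 = 1 and ?d2.0 = 1], goal_cases)
  \<comment> \<open>The assumption on \<open>R\<close>: the products in \<open>q\<close> pass to the
    base \<open>p = q ^ 4\<close> and then to \<open>theta28\<close>. All other goals are numerical
    or the identity for the double sum.\<close>
  case (5 \<tau> q p)
  show ?case
    unfolding rhs1_def 5(2) J_JJ_28[OF 5(1)] unfolding 5(3)[symmetric] theta_quotient[OF 5(4)] eta_quotient_1[OF 5(4)]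
    by simp
qed (use Nahm_identity_1 in \<open>auto simp: kexp_def\<close>)

lemma modular_2:
  "modular_function_on (\<lambda>\<tau>. nahm_sum (vector [vector [1, -1/2], vector [-1/2, 3/4]]) (vector [0, 0]) (-3/56) (56 * \<tau>)) (Gamma1 3136)"
proof (rule modular_function_on_nahm_sum[where R = rhs2 and a = "0" and c = 0 and t = "-3"
    and ?N1.0 = "[6, 10, 14]" and ?D1.0 = "[3, 7, 8, 11, 12, 1, 3, 5, 7, 9, 11, 13]" and ?k1.0 = 1 and ?d1.0 = 0
    and ?N2.0 = "[8]" and ?D2.0 = "[2, 2, 4, 6, 6, 8, 10, 10, 12, 14]" and ?k2.0 = 2 and ?d2.0 = 3], goal_cases)
  case (5 \<tau> q p)
  show ?case
    unfolding rhs2_def 5(2) J_JJ_28[OF 5(1)] unfolding 5(3)[symmetric] theta_quotient[OF 5(4)] eta_quotient_2[OF 5(4)]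
    by simp
qed (use Nahm_identity_2 in \<open>auto simp: kexp_def\<close>)

lemma modular_3:
  "modular_function_on (\<lambda>\<tau>. nahm_sum (vector [vector [1, -1/2], vector [-1/2, 3/4]]) (vector [0, 1/2]) (1/56) (56 * \<tau>)) (Gamma1 3136)"
proof (rule modular_function_on_nahm_sum[where R = rhs3 and a = "0" and c = 4 and t = "1"
    and ?N1.0 = "[2, 10, 14]" and ?D1.0 = "[4, 5, 7, 8, 9, 1, 3, 5, 7, 9, 11, 13]" and ?k1.0 = 1 and ?d1.0 = 0
    and ?N2.0 = "[4]" and ?D2.0 = "[2, 2, 4, 6, 6, 8, 10, 10, 12, 14]" and ?k2.0 = 2 and ?d2.0 = 7], goal_cases)
  case (5 \<tau> q p)
  show ?case
    unfolding rhs3_def 5(2) J_JJ_28[OF 5(1)] unfolding 5(3)[symmetric] theta_quotient[OF 5(4)] eta_quotient_3[OF 5(4)]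
    by simp
qed (use Nahm_identity_3 in \<open>auto simp: kexp_def\<close>)

theorem theorem3p9:
  shows
  "(\<forall>q::complex. norm q < 1 \<longrightarrow>
      ((\<lambda>(i, j). q powi (4 * (int i)^2 + 3 * (int j)^2 - 4 * int i * int j - 4 * int i + 2 * int j)
                  / (qpoch (q^8) (q^8) i * qpoch (q^8) (q^8) j))
         has_sum
         (2 * (J q 16 * JJ q 48 112 / (J q 8)^2)
          + q * (J q 8 * (J q 56)^2 * J q 112 * JJ q 8 112 * JJ q 24 112
                 / (J q 4 * JJ q 4 112 * JJ q 16 112 * JJ q 28 112 * JJ q 48 112 * JJ q 52 112))))
        (UNIV :: (nat \<times> nat) set) \<and>
      ((\<lambda>(i, j). q powi (4 * (int i)^2 + 3 * (int j)^2 - 4 * int i * int j)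
                  / (qpoch (q^8) (q^8) i * qpoch (q^8) (q^8) j))
         has_sum
         (J q 8 * (J q 56)^2 * J q 112 * JJ q 24 112 * JJ q 40 112
            / (J q 4 * JJ q 12 112 * JJ q 28 112 * JJ q 32 112 * JJ q 44 112 * JJ q 48 112)
          + 2 * q^3 * (J q 16 * JJ q 32 112 / (J q 8)^2)))
        (UNIV :: (nat \<times> nat) set) \<and>
      ((\<lambda>(i, j). q powi (4 * (int i)^2 + 3 * (int j)^2 - 4 * int i * int j + 4 * int j)
                  / (qpoch (q^8) (q^8) i * qpoch (q^8) (q^8) j))
         has_sum
         (J q 8 * (J q 56)^2 * J q 112 * JJ q 8 112 * JJ q 40 112
            / (J q 4 * JJ q 16 112 * JJ q 20 112 * JJ q 28 112 * JJ q 32 112 * JJ q 36 112)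
          + 2 * q^7 * (J q 16 * JJ q 16 112 / (J q 8)^2)))
        (UNIV :: (nat \<times> nat) set))
   \<and>
   (\<forall>(B, C) \<in> {(vector [-1/2, 1/4], 1/28), (vector [0, 0], -3/56), (vector [0, 1/2], 1/56)}.
      modular_function_on
        (\<lambda>\<tau>. nahm_sum (vector [vector [1, -1/2], vector [-1/2, 3/4]]) B C (56 * \<tau>))
        (Gamma1 3136))"
proof (rule conjI, goal_cases)
  case 1
  show ?case
    using Nahm_identity_1 Nahm_identity_2 Nahm_identity_3 unfolding rhs1_def rhs2_def rhs3_def by simp
next
  case 2
  show ?case using modular_1 modular_2 modular_3 by simp
qed

end
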